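(* The Continuum Hypothesis ($\mathsf{CH}$) is equivalent (over $\mathsf{ZFC}$) to the statement that for all Parovičenko spaces $X$ and $Y$, the groups $\mathcal{H}(X)$ and $\mathcal{H}(Y)$ are algebraically isomorphic (isomorphic as abstract groups).
   Context: All topological spaces are assumed to be Tychonoff; in particular compact spaces are Hausdorff. ${\mathfrak c}=2^{\aleph_0}$. The weight of a space is the least cardinality of a base. A space is zero-dimensional if it has a base of clopen sets. An $F$-space is a space in which cozero-subsets are $C^*$-embedded (for normal spaces: disjoint open $F_\sigma$-subsets have disjoint closures). A Parovičenko space is a compact, zero-dimensional $F$-space of weight ${\mathfrak c}$ in which each nonempty $G_\delta$-subset has infinite interior. $\mathcal{H}(X)$ is the group of all homeomorphisms $X\to X$ under composition (its topology plays no role here). *)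

theory Defs
  imports "HOL-Analysis.Analysis" "HOL-Algebra.Bij"
begin

(* Set_Algebras uses the same symbol for membership in a coset *)
no_notation Set_Algebras.elt_set_eq (infix \<open>=o\<close> 50)
unbundle cardinal_syntax

definition Continuum_Hypothesis :: bool
  where "Continuum_Hypothesis \<longleftrightarrow> ctwo ^c natLeq =o cardSuc natLeq"

definition is_base :: "'a topology \<Rightarrow> 'a set set \<Rightarrow> bool"
  where "is_base X \<B> \<longleftrightarrow> openin X = arbitrary union_of (\<lambda>U. U \<in> \<B>)"

(* A cardinal is given by a well-order; has_weight X \<kappa> says that \<kappa> is the least
   cardinality of a base. *)
definition has_weight :: "'a topology \<Rightarrow> 'k rel \<Rightarrow> bool"
  where "has_weight X \<kappa> \<longleftrightarrow>
    (\<exists>\<B>. is_base X \<B> \<and> |\<B>| =o \<kappa>) \<and> (\<forall>\<B>. is_base X \<B> \<longrightarrow> \<kappa> \<le>o |\<B>| )"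

definition zero_dimensional :: "'a topology \<Rightarrow> bool"
  where "zero_dimensional X \<longleftrightarrow> (\<exists>\<B>. is_base X \<B> \<and> (\<forall>U\<in>\<B>. openin X U \<and> closedin X U))"

definition cozero_in :: "'a topology \<Rightarrow> 'a set \<Rightarrow> bool"
  where "cozero_in X U \<longleftrightarrow>
    (\<exists>f::'a \<Rightarrow> real. continuous_map X euclidean f \<and> U = {x \<in> topspace X. f x \<noteq> 0})"

definition C_star_embedded :: "'a topology \<Rightarrow> 'a set \<Rightarrow> bool"
  where "C_star_embedded X A \<longleftrightarrow> A \<subseteq> topspace X \<and>
    (\<forall>f::'a \<Rightarrow> real. continuous_map (subtopology X A) euclidean f \<and> bounded (f ` A) \<longrightarrow>
      (\<exists>g::'a \<Rightarrow> real. continuous_map X euclidean g \<and> bounded (g ` topspace X) \<and>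
         (\<forall>x\<in>A. g x = f x)))"

definition F_space :: "'a topology \<Rightarrow> bool"
  where "F_space X \<longleftrightarrow> (\<forall>U. cozero_in X U \<longrightarrow> C_star_embedded X U)"

definition Parovicenko_space :: "'a topology \<Rightarrow> bool"
  where "Parovicenko_space X \<longleftrightarrow>
    compact_space X \<and> Hausdorff_space X \<and> zero_dimensional X \<and> F_space X \<and>
    has_weight X (ctwo ^c natLeq) \<and>
    (\<forall>G. gdelta_in X G \<and> G \<noteq> {} \<longrightarrow> infinite (X interior_of G))"

(* As in BijGroup, self-maps of X are represented by functions that are extensional
   (undefined outside topspace X), so that each homeomorphism is counted exactly once. *)
definition homeo_group :: "'a topology \<Rightarrow> ('a \<Rightarrow> 'a) monoid"
  where "homeo_group X =
    BijGroup (topspace X) \<lparr>carrier := {f \<in> Bij (topspace X). homeomorphic_map X X f}\<rparr>"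

lemma group_homeo_group: "group (homeo_group X)"
proof -
  let ?S = "topspace X"
  interpret B: group "BijGroup ?S" by (rule group_BijGroup)
  have cong: "homeomorphic_map X X g"
    if "homeomorphic_map X X f" "\<And>x. x \<in> ?S \<Longrightarrow> f x = g x" for f g
    using that homeomorphic_map_eq[of X X f g] by simp
  have "subgroup {f \<in> Bij ?S. homeomorphic_map X X f} (BijGroup ?S)"
  proof (rule B.subgroupI)
    show "{f \<in> Bij ?S. homeomorphic_map X X f} \<subseteq> carrier (BijGroup ?S)"
      by (auto simp: BijGroup_def)
    have "homeomorphic_map X X (\<lambda>x\<in>?S. x)"
      by (rule cong[of "\<lambda>x. x"]) (auto simp: homeomorphic_map_id[unfolded id_def])
    then show "{f \<in> Bij ?S. homeomorphic_map X X f} \<noteq> {}"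
      using id_Bij by blast
  next
    fix f assume f: "f \<in> {f \<in> Bij ?S. homeomorphic_map X X f}"
    then obtain g where g: "homeomorphic_maps X X f g"
      using homeomorphic_map_maps[of X X f] by auto
    have bij: "bij_betw f ?S ?S" using f by (simp add: Bij_def)
    have "g x = inv_into ?S f x" if "x \<in> ?S" for x
    proof -
      have "f (g x) = x" "g x \<in> ?S"
        using g that by (auto simp: homeomorphic_maps_def continuous_map_def)
      then show ?thesis
        using bij inv_into_f_eq[of f ?S "g x" x] by (simp add: bij_betw_def)
    qed
    moreover have "homeomorphic_map X X g"
      using g homeomorphic_map_maps[of X X g] homeomorphic_maps_sym[of X X f g] by auto
    ultimately have "homeomorphic_map X X (\<lambda>x\<in>?S. inv_into ?S f x)"
      using cong[of g] by auto
    then show "inv\<^bsub>BijGroup ?S\<^esub> f \<in> {f \<in> Bij ?S. homeomorphic_map X X f}"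
      using f by (simp add: inv_BijGroup restrict_inv_into_Bij)
  next
    fix f g assume fg: "f \<in> {f \<in> Bij ?S. homeomorphic_map X X f}"
      "g \<in> {f \<in> Bij ?S. homeomorphic_map X X f}"
    then have "homeomorphic_map X X (f \<circ> g)"
      by (auto intro: homeomorphic_map_compose)
    then have "homeomorphic_map X X (compose ?S f g)"
      by (rule cong) (simp add: compose_def)
    then show "f \<otimes>\<^bsub>BijGroup ?S\<^esub> g \<in> {f \<in> Bij ?S. homeomorphic_map X X f}"
      using fg by (auto simp: BijGroup_def compose_Bij)
  qed
  then show ?thesis
    unfolding homeo_group_def by (rule B.subgroup_imp_group)
qed

(* Hence nat set set is large enough to carry a homeomorphic copy of every Parovicenko space. *)
lemma Parovicenko_space_embed:
  assumes "Parovicenko_space (X :: 'a topology)"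
  shows "\<exists>Y :: nat set set topology. X homeomorphic_space Y"
proof -
  obtain B where B: "is_base X B" and cB: "|B| =o ctwo ^c natLeq"
    using assms by (auto simp: Parovicenko_space_def has_weight_def)
  have "ctwo ^c natLeq =o |UNIV :: nat set set|"
    using ordIso_symmetric[OF card_of_Pow_Func[of "UNIV :: nat set"]]
    by (simp add: cexp_def ctwo_def Field_natLeq Field_card_of)
  then have "|B| \<le>o |UNIV :: nat set set|"
    using cB ordIso_transitive ordIso_imp_ordLeq by blast
  then obtain e :: "'a set \<Rightarrow> nat set" where e: "inj_on e B"
    using card_of_ordLeq[of B "UNIV::nat set set"] by auto
  define h where "h x = e ` {U \<in> B. x \<in> U}" for x
  have Bn: "\<exists>U\<in>B. x \<in> U \<and> U \<subseteq> W" if "openin X W" "x \<in> W" for W x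
    using B that by (auto simp: is_base_def union_of_def arbitrary_def)
  have inj: "inj_on h (topspace X)"
  proof (rule inj_onI, rule ccontr)
    fix x y assume *: "x \<in> topspace X" "y \<in> topspace X" "h x = h y" "x \<noteq> y"
    have "Hausdorff_space X" using assms by (simp add: Parovicenko_space_def)
    then obtain V W where "openin X V" "openin X W" "x \<in> V" "y \<in> W" "disjnt V W"
      using * unfolding Hausdorff_space_def by meson
    then obtain U where U: "U \<in> B" "x \<in> U" "y \<notin> U"
      using Bn[of V x] by (auto simp: disjnt_iff)
    have "{U \<in> B. x \<in> U} = {U \<in> B. y \<in> U}"
      using *(3) inj_on_image_eq_iff[OF e, of "{U \<in> B. x \<in> U}" "{U \<in> B. y \<in> U}"] by (auto simp: h_def)
    then show False using U by blast
  qed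
  let ?k = "inv_into (topspace X) h"
  let ?Y = "pullback_topology (h ` topspace X) ?k X"
  have tY: "topspace ?Y = h ` topspace X"
    using inj by (auto simp: topspace_pullback_topology)
  have "homeomorphic_maps X ?Y h ?k"
    unfolding homeomorphic_maps_def
  proof (intro conjI ballI)
    show "continuous_map X ?Y h"
      by (rule continuous_map_pullback')
         (auto intro!: continuous_map_eq[OF continuous_map_id] simp: inj)
    show "continuous_map ?Y X ?k" using continuous_map_pullback[OF continuous_map_id, of "h ` topspace X" ?k X] by simp
  qed (use inj tY in \<open>auto\<close>)
  then show ?thesis
    unfolding homeomorphic_space_def by blast
qed

end

(*
A compact zero-dimensional space is governed by its Boolean algebra of clopen sets. Being an F-space means that
two countable, mutually disjoint families of clopen sets are separated by a clopen set; the G-delta condition means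
that below a decreasing sequence of nonempty clopen sets there are two disjoint nonempty clopen sets. Under CH these
two saturation properties drive a back-and-forth construction of length omega_1, so all Parovicenko spaces are
homeomorphic (Parovicenko's theorem).

If CH fails, then omega_1 < omega_2 <= c. For a regular uncountable r <= c, an inverse limit of length r of closed
subspaces of Cantor cubes yields a Parovicenko space X(r) in which every nonempty clopen set contains r many nonempty
clopen sets that decide every clopen set, while any fewer than r nonempty clopen sets are all split by a single clopen
set. Hence X(omega_1) and X(omega_2) have no homeomorphic nonempty clopen subsets, and in the sum of two copies of each
the two exchanges of equal summands are nontrivial elements a, b such that a commutes with all conjugates of b.
The homeomorphism group of omega^* has no such pair: after conjugation a and b both move some clopen set W off itself,
and for f, h supported in W the commutators [a,f] and [b,h] act on W as the inverses of f and h. They would have to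
commute, but the group of homeomorphisms supported in W is not abelian.
*)
theory Submission
  imports Defs "HOL-Library.Countable_Set_Type"
begin

section \<open>Parovicenko spaces in terms of clopen sets\<close>

text \<open>The groups, not the spaces, have to be told apart, and the proof does not reconstruct a
  space from its group. It asks instead whether two nontrivial normal subgroups commute elementwise,
  which the abstract group alone decides. This is so as soon as the space has two complementary
  invariant pieces that each carry a nontrivial homeomorphism. Since X(r) is not shown to have any
  such homeomorphism, every summand is taken twice. The remainder omega^* is the opposite witness:
  it is a Parovicenko space in ZFC, with many involutions coming from the natural numbers. The
  invariant that separates the summands is a reaping number, the least size of a family of nonempty
  clopen sets that no single clopen set splits entirely. In the tower, gap variables give countable
  separation, point variables bound this number by r, free variables keep it from being smaller, and
  regularity of r puts every family of fewer than r clopen sets under a common level. Omega_1 and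
  omega_2 are the two least uncountable regular cardinals; the failure of CH makes omega_2 at most
  c.\<close>

definition clopens :: "'a topology \<Rightarrow> 'a set set"
  where "clopens X = {U. openin X U \<and> closedin X U}"

text \<open>The absence of countable gaps in the clopen algebra: two orthogonal countable families
  have a separating element. Sequences cover finite families as well, since terms may repeat or be
  empty.\<close>

definition countably_separated :: "'a topology \<Rightarrow> bool"
  where "countably_separated X \<longleftrightarrow>
    (\<forall>a b :: nat \<Rightarrow> 'a set. range a \<subseteq> clopens X \<and> range b \<subseteq> clopens X \<and> (\<forall>m n. a m \<inter> b n = {}) \<longrightarrow>
      (\<exists>c\<in>clopens X. \<forall>n. a n \<subseteq> c \<and> b n \<inter> c = {}))"

text \<open>Asking for two disjoint lower bounds rather than one builds in that no clopen set is an
  atom: a constant sequence yields a splitting of a single nonempty clopen set. This captures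
  infinite interiors and not merely nonempty ones.\<close>

definition splits_below :: "'a topology \<Rightarrow> bool"
  where "splits_below X \<longleftrightarrow>
    (\<forall>a :: nat \<Rightarrow> 'a set. range a \<subseteq> clopens X \<and> decseq a \<and> (\<forall>n. a n \<noteq> {}) \<longrightarrow>
      (\<exists>c\<in>clopens X. \<exists>d\<in>clopens X. c \<noteq> {} \<and> d \<noteq> {} \<and> c \<inter> d = {} \<and> (\<forall>n. c \<subseteq> a n \<and> d \<subseteq> a n)))"

lemma clopens_Int: "U \<in> clopens X \<Longrightarrow> V \<in> clopens X \<Longrightarrow> U \<inter> V \<in> clopens X"
  and clopens_Un: "U \<in> clopens X \<Longrightarrow> V \<in> clopens X \<Longrightarrow> U \<union> V \<in> clopens X"
  and clopens_Diff: "U \<in> clopens X \<Longrightarrow> V \<in> clopens X \<Longrightarrow> U - V \<in> clopens X"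
  and clopens_empty: "{} \<in> clopens X"
  and clopens_topspace: "topspace X \<in> clopens X"
  and clopens_subset: "U \<in> clopens X \<Longrightarrow> U \<subseteq> topspace X"
  by (auto simp: clopens_def dest: openin_subset)

lemmas clopens_intros = clopens_Int clopens_Un clopens_Diff clopens_empty clopens_topspace

lemma clopens_UN: "finite F \<Longrightarrow> (\<And>i. i \<in> F \<Longrightarrow> U i \<in> clopens X) \<Longrightarrow> (\<Union>i\<in>F. U i) \<in> clopens X"
  by (induction F rule: finite_induct) (auto intro: clopens_intros)

lemma clopens_INT: "finite F \<Longrightarrow> F \<noteq> {} \<Longrightarrow> (\<And>i. i \<in> F \<Longrightarrow> U i \<in> clopens X) \<Longrightarrow> (\<Inter>i\<in>F. U i) \<in> clopens X"
  by (induction F rule: finite_ne_induct) (auto intro: clopens_intros)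

lemma is_base_iff: "is_base X \<B> \<longleftrightarrow> (\<forall>U\<in>\<B>. openin X U) \<and> (\<forall>U x. openin X U \<and> x \<in> U \<longrightarrow> (\<exists>B\<in>\<B>. x \<in> B \<and> B \<subseteq> U))"
proof (intro iffI conjI ballI allI impI)
  assume B: "is_base X \<B>"
  show "openin X U" if "U \<in> \<B>" for U
    using B that arbitrary_union_of_inc[of "\<lambda>U. U \<in> \<B>" U] by (simp add: is_base_def)
  show "\<exists>B\<in>\<B>. x \<in> B \<and> B \<subseteq> U" if "openin X U \<and> x \<in> U" for U x
    using B that by (auto simp: is_base_def union_of_def arbitrary_def)
next
  assume R: "(\<forall>U\<in>\<B>. openin X U) \<and> (\<forall>U x. openin X U \<and> x \<in> U \<longrightarrow> (\<exists>B\<in>\<B>. x \<in> B \<and> B \<subseteq> U))"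
  show "is_base X \<B>" unfolding is_base_def
  proof (intro ext iffI)
    fix U assume "openin X U"
    then have "U = \<Union>{B \<in> \<B>. B \<subseteq> U}" using R by blast
    then show "(arbitrary union_of (\<lambda>U. U \<in> \<B>)) U"
      unfolding union_of_def arbitrary_def by (intro exI[of _ "{B \<in> \<B>. B \<subseteq> U}"]) auto
  next
    fix U assume "(arbitrary union_of (\<lambda>U. U \<in> \<B>)) U"
    then show "openin X U" using R by (auto simp: union_of_def arbitrary_def intro!: openin_Union)
  qed
qed

lemma zero_dimensional_iff:
  "zero_dimensional X \<longleftrightarrow> (\<forall>U x. openin X U \<and> x \<in> U \<longrightarrow> (\<exists>C\<in>clopens X. x \<in> C \<and> C \<subseteq> U))"
  unfolding zero_dimensional_def is_base_iff clopens_def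
  by (rule iffI, blast, rule exI[of _ "{U. openin X U \<and> closedin X U}"], blast)

text \<open>The compact set \<open>K\<close> is covered by finitely many clopen subsets of
  \<open>U\<close>.\<close>

lemma clopen_between:
  assumes "compact_space X" "zero_dimensional X" "closedin X K" "openin X U" "K \<subseteq> U"
  obtains C where "C \<in> clopens X" "K \<subseteq> C" "C \<subseteq> U"
proof -
  have "compactin X K" using assms closedin_compact_space by blast
  moreover have "\<forall>V\<in>{C \<in> clopens X. C \<subseteq> U}. openin X V" by (auto simp: clopens_def)
  moreover have "K \<subseteq> \<Union>{C \<in> clopens X. C \<subseteq> U}"
    using assms unfolding zero_dimensional_iff by blast
  ultimately obtain F where F: "finite F" "F \<subseteq> {C \<in> clopens X. C \<subseteq> U}" "K \<subseteq> \<Union>F"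
    unfolding compactin_def by (elim conjE allE[of _ "{C \<in> clopens X. C \<subseteq> U}"]) blast
  have "(\<Union>i\<in>F. i) \<in> clopens X" using F by (intro clopens_UN) auto
  then show ?thesis using F that[of "\<Union>F"] by auto
qed

text \<open>The frontier of a clopen set is empty, so no agreement of the two functions has to be
  checked.\<close>

lemma continuous_map_clopen_cases:
  assumes "c \<in> clopens X" "continuous_map X Y f" "continuous_map X Y g"
  shows "continuous_map X Y (\<lambda>x. if x \<in> c then f x else g x)"
proof (rule continuous_map_cases)
  have "closedin X (topspace X - c)" "closedin X c" using assms by (auto simp: clopens_def)
  moreover have "{x \<in> topspace X. x \<in> c} = c" "{x \<in> topspace X. x \<notin> c} = topspace X - c"
    using clopens_subset[OF assms(1)] by auto
  ultimately have cl: "X closure_of {x. x \<in> c} = c" "X closure_of {x. x \<notin> c} = topspace X - c"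
  proof -
    show "X closure_of {x. x \<in> c} = c" using \<open>closedin X c\<close> by (simp add: closure_of_closedin)
    have "topspace X \<inter> {x. x \<notin> c} = topspace X - c" by auto
    then show "X closure_of {x. x \<notin> c} = topspace X - c"
      using closure_of_restrict[of X "{x. x \<notin> c}"] \<open>closedin X (topspace X - c)\<close> by (simp add: closure_of_closedin)
  qed
  then show "continuous_map (subtopology X (X closure_of {x. x \<in> c})) Y f"
    "continuous_map (subtopology X (X closure_of {x. x \<notin> c})) Y g"
    using assms by (auto intro: continuous_map_from_subtopology)
  show "f x = g x" if "x \<in> X frontier_of {x. x \<in> c}" for x
  proof -
    have "X frontier_of c = {}" using assms(1) by (simp add: clopens_def frontier_of_eq_empty clopens_subset[OF assms(1)])
    then show ?thesis using that by simp
  qed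
qed

section \<open>F-spaces and countable separation of clopen sets\<close>

text \<open>The union of the two families is a cozero set on which the indicator of the first union
  is continuous. If \<open>g\<close> extends this indicator, a clopen set between
  \<open>{g >= 1}\<close> and \<open>{g > 0}\<close> is the separator.\<close>

lemma F_space_imp_countably_separated:
  assumes "compact_space X" "zero_dimensional X" "F_space X"
  shows "countably_separated X"
  unfolding countably_separated_def
proof (intro allI impI, elim conjE)
  fix a b :: "nat \<Rightarrow> 'a set"
  assume a: "range a \<subseteq> clopens X" and b: "range b \<subseteq> clopens X" and ab: "\<forall>m n. a m \<inter> b n = {}"
  define u where "u n = a n \<union> b n" for n
  have u: "u n \<in> clopens X" for n using a b by (auto simp: u_def intro!: clopens_Un)
  \<comment> \<open>The geometric weights make the partial sums converge uniformly, so
    \<open>f\<close> is continuous; it vanishes exactly off the union of all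
    \<open>u n\<close>.\<close>
  define f where "f x = (\<Sum>n. (1/2)^n * (if x \<in> u n then 1 else 0::real))" for x
  have summ: "summable (\<lambda>n. (1/2)^n * (if x \<in> u n then 1 else 0::real))" for x
    by (rule summable_comparison_test'[of "\<lambda>n. (1/2)^n"]) auto
  have unif: "uniform_limit (topspace X) (\<lambda>n x. \<Sum>i<n. (1/2)^i * (if x \<in> u i then 1 else 0::real)) f sequentially"
    unfolding f_def by (rule Weierstrass_m_test[of _ _ "\<lambda>n. (1/2)^n"]) auto
  have contf: "continuous_map X euclidean f"
  proof -
    have "continuous_map X Met_TC.mtopology f"
    proof (rule Met_TC.continuous_map_uniform_limit)
      show "\<forall>\<^sub>F n in sequentially. continuous_map X Met_TC.mtopology
         (\<lambda>x. \<Sum>i<n. (1/2)^i * (if x \<in> u i then 1 else 0::real))"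
        by (intro always_eventually allI)
          (auto intro!: continuous_map_sum continuous_map_real_mult_left continuous_map_clopen_cases u simp: mtopology_is_euclidean)
    qed (use unif in \<open>auto simp: uniform_limit_iff\<close>)
    then show ?thesis by simp
  qed
  have fpos: "f x \<noteq> 0 \<longleftrightarrow> (\<exists>n. x \<in> u n)" for x
  proof
    assume "\<exists>n. x \<in> u n"
    then obtain n where "x \<in> u n" ..
    then have "f x > 0" unfolding f_def by (intro suminf_pos2[OF summ, where i=n]) auto
    then show "f x \<noteq> 0" by simp
  next
    show "\<exists>n. x \<in> u n" if "f x \<noteq> 0"
      using that unfolding f_def by (rule contrapos_np) simp
  qed
  define U where "U = (\<Union>n. u n)"
  have Us: "U \<subseteq> topspace X" using u clopens_subset by (fastforce simp: U_def)
  have "cozero_in X U"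
    unfolding cozero_in_def using contf fpos Us by (intro exI[of _ f]) (auto simp: U_def)
  then have emb: "C_star_embedded X U" using assms by (simp add: F_space_def)
  define A where "A = (\<Union>n. a n)"
  define h where "h x = (if x \<in> A then 1 else 0::real)" for x
  have oA: "openin X A" and oB: "openin X (\<Union>n. b n)" using a b by (auto simp: clopens_def A_def)
  have "A \<in> clopens (subtopology X U)"
  proof -
    have "openin (subtopology X U) A" using oA by (auto simp: openin_subtopology A_def U_def u_def)
    \<comment> \<open>Mutual disjointness enters here: inside \<open>U\<close> the complement of
      \<open>A\<close> is the union of the other family, so \<open>A\<close> is relatively
      clopen.\<close>
    moreover have "U - A = U \<inter> (\<Union>n. b n)" using ab by (auto simp: A_def U_def u_def)
    then have "openin (subtopology X U) (U - A)" using oB by (auto simp: openin_subtopology)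
    ultimately show ?thesis using Us by (auto simp: clopens_def closedin_def openin_subset A_def U_def u_def Int_absorb1)
  qed
  then have "continuous_map (subtopology X U) euclidean h"
    unfolding h_def by (intro continuous_map_clopen_cases) auto
  moreover have "bounded (h ` U)" by (rule boundedI[of _ 1]) (auto simp: h_def)
  ultimately obtain g where g: "continuous_map X euclidean g" "\<And>x. x \<in> U \<Longrightarrow> g x = h x"
    using emb unfolding C_star_embedded_def by meson
  have "closedin X {x \<in> topspace X. g x \<in> {1..}}" "openin X {x \<in> topspace X. g x \<in> {0<..}}"
    by (rule closedin_continuous_map_preimage[OF g(1)], simp, rule openin_continuous_map_preimage[OF g(1)], simp)
  then obtain c where c: "c \<in> clopens X" "{x \<in> topspace X. g x \<in> {1..}} \<subseteq> c" "c \<subseteq> {x \<in> topspace X. g x \<in> {0<..}}"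
    using clopen_between[OF assms(1,2)] by (metis (no_types, lifting) Collect_mono atLeast_iff dual_order.strict_trans1 greaterThan_iff zero_less_one)
  show "\<exists>c\<in>clopens X. \<forall>n. a n \<subseteq> c \<and> b n \<inter> c = {}"
  proof (intro bexI[of _ c] allI conjI)
    fix n
    show "a n \<subseteq> c"
    proof
      fix x assume x: "x \<in> a n"
      then have "x \<in> U" "h x = 1" by (auto simp: U_def u_def h_def A_def)
      then show "x \<in> c" using g(2)[of x] c(2) Us by auto
    qed
    show "b n \<inter> c = {}"
    proof (rule ccontr)
      assume "b n \<inter> c \<noteq> {}"
      then obtain x where x: "x \<in> b n" "x \<in> c" by auto
      then have "x \<in> U" "h x = 0" using ab by (auto simp: U_def u_def h_def A_def)
      then show False using g(2)[of x] c(3) x by auto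
    qed
  qed (use c in auto)
qed

text \<open>A clopen set fits between each closed set \<open>\<bar>f\<bar> \<ge> 1 / Suc n\<close>
  and the cozero set, and these clopen sets exhaust it. Removing earlier finite unions makes the
  pieces disjoint and keeps them clopen.\<close>

lemma cozero_sigma_clopen:
  assumes "compact_space X" "zero_dimensional X" "cozero_in X U"
  obtains u :: "nat \<Rightarrow> 'a set" where "range u \<subseteq> clopens X" "U = (\<Union>n. u n)" "disjoint_family u"
proof -
  obtain f where f: "continuous_map X euclidean f" "U = {x \<in> topspace X. f x \<noteq> (0::real)}"
    using assms by (auto simp: cozero_in_def)
  have "\<exists>C\<in>clopens X. {x \<in> topspace X. \<bar>f x\<bar> \<ge> 1 / Suc n} \<subseteq> C \<and> C \<subseteq> U" for n
  proof -
    have "closedin X {x \<in> topspace X. f x \<in> {t. \<bar>t\<bar> \<ge> 1 / Suc n}}"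
      using f(1) by (intro closedin_continuous_map_preimage[of X euclidean]) (auto intro!: closed_Collect_le continuous_intros)
    moreover have "openin X {x \<in> topspace X. f x \<in> -{0}}"
      using f(1) by (intro openin_continuous_map_preimage[of X euclidean]) auto
    moreover have "U = {x \<in> topspace X. f x \<in> -{0}}" using f by auto
    moreover have "{x \<in> topspace X. f x \<in> {t. \<bar>t\<bar> \<ge> 1 / Suc n}} \<subseteq> U"
      using f(2) by (auto simp: divide_simps split: if_splits)
    ultimately show ?thesis
      using clopen_between[OF assms(1,2)] by (metis (no_types, lifting) mem_Collect_eq Collect_cong)
  qed
  then obtain C where C: "\<And>n. C n \<in> clopens X" "\<And>n. {x \<in> topspace X. \<bar>f x\<bar> \<ge> 1 / Suc n} \<subseteq> C n" "\<And>n. C n \<subseteq> U"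
    by metis
  have UC: "U = (\<Union>n. C n)"
  proof
    show "U \<subseteq> (\<Union>n. C n)"
    proof
      fix x assume x: "x \<in> U"
      then have "\<bar>f x\<bar> > 0" using f by auto
      then obtain n where "1 / Suc n < \<bar>f x\<bar>" using nat_approx_posE by (metis)
      then show "x \<in> (\<Union>n. C n)" using C(2)[of n] x f(2) by force
    qed
  qed (use C(3) in blast)
  have "disjointed C n \<in> clopens X" for n
    unfolding disjointed_def by (intro clopens_Diff clopens_UN C) auto
  then show ?thesis
    using that[of "disjointed C"] UC by (auto simp: UN_disjointed_eq disjoint_family_disjointed)
qed

text \<open>Each piece \<open>u n\<close> is clopen, hence compact, and has a clopen subset
  \<open>a n\<close> separating the levels \<open>\<ge> t\<close> and \<open>\<le> s\<close> of
  \<open>h\<close> on it. All \<open>a n\<close> and all \<open>u n - a n\<close> form two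
  orthogonal countable families, so a single clopen set does the same on the whole of
  \<open>U\<close>, which need not be compact.\<close>

lemma countably_separated_step:
  assumes X: "compact_space X" "zero_dimensional X" "countably_separated X"
    and U: "range u \<subseteq> clopens X" "U = (\<Union>n::nat. u n)" "disjoint_family u"
    and h: "continuous_map (subtopology X U) euclideanreal h" and "s < t"
  obtains c where "c \<in> clopens X" "\<And>x. x \<in> U \<Longrightarrow> h x \<ge> t \<Longrightarrow> x \<in> c" "\<And>x. x \<in> U \<Longrightarrow> h x \<le> s \<Longrightarrow> x \<notin> c"
proof -
  have "\<exists>a\<in>clopens X. {x \<in> u n. h x \<ge> t} \<subseteq> a \<and> a \<subseteq> {x \<in> u n. h x > s}" for n
  proof -
    have un: "u n \<in> clopens X" "u n \<subseteq> U" "u n \<subseteq> topspace X" using U clopens_subset by auto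
    have cont: "continuous_map (subtopology X (u n)) euclideanreal h"
      using h un(2) continuous_map_from_subtopology_mono by blast
    have "closedin (subtopology X (u n)) {x \<in> topspace (subtopology X (u n)). h x \<in> {t..}}"
      "openin (subtopology X (u n)) {x \<in> topspace (subtopology X (u n)). h x \<in> {s<..}}"
      by (rule closedin_continuous_map_preimage[OF cont], simp, rule openin_continuous_map_preimage[OF cont], simp)
    moreover have "{x \<in> topspace (subtopology X (u n)). h x \<in> {t..}} = {x \<in> u n. h x \<ge> t}"
      "{x \<in> topspace (subtopology X (u n)). h x \<in> {s<..}} = {x \<in> u n. h x > s}" using un by auto
    ultimately have "closedin (subtopology X (u n)) {x \<in> u n. h x \<ge> t}"
      "openin (subtopology X (u n)) {x \<in> u n. h x > s}" by simp_all
    then have "closedin X {x \<in> u n. h x \<ge> t}" "openin X {x \<in> u n. h x > s}"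
      using un by (auto simp: clopens_def intro: closedin_trans_full openin_trans_full)
    moreover have "{x \<in> u n. h x \<ge> t} \<subseteq> {x \<in> u n. h x > s}" using \<open>s < t\<close> by auto
    ultimately obtain C where "C \<in> clopens X" "{x \<in> u n. h x \<ge> t} \<subseteq> C" "C \<subseteq> {x \<in> u n. h x > s}"
      using clopen_between[OF X(1,2)] by blast
    then show ?thesis by blast
  qed
  then have "\<forall>n. \<exists>a. a \<in> clopens X \<and> {x \<in> u n. h x \<ge> t} \<subseteq> a \<and> a \<subseteq> {x \<in> u n. h x > s}" by blast
  from choice[OF this] obtain a where a: "\<And>n. a n \<in> clopens X" "\<And>n. {x \<in> u n. h x \<ge> t} \<subseteq> a n"
    "\<And>n. a n \<subseteq> {x \<in> u n. h x > s}" by blast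
  have "\<forall>m n. a m \<inter> (u n - a n) = {}"
  proof (intro allI)
    fix m n
    show "a m \<inter> (u n - a n) = {}"
    proof (cases "m = n")
      case False
      then have "u m \<inter> u n = {}" using U(3) by (auto simp: disjoint_family_on_def)
      then show ?thesis using a(3)[of m] by blast
    qed auto
  qed
  moreover have "range (\<lambda>n. u n - a n) \<subseteq> clopens X" "range a \<subseteq> clopens X"
    using U a by (auto intro: clopens_Diff)
  ultimately obtain c where c: "c \<in> clopens X" "\<And>n. a n \<subseteq> c \<and> (u n - a n) \<inter> c = {}"
    using X(3)[unfolded countably_separated_def, rule_format, of a "\<lambda>n. u n - a n"] by blast
  show ?thesis
  proof
    show "c \<in> clopens X" by (fact c)
    fix x assume "x \<in> U"
    then obtain n where n: "x \<in> u n" using U by auto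
    show "h x \<ge> t \<Longrightarrow> x \<in> c" using n a(2)[of n] c(2)[of n] by auto
    show "h x \<le> s \<Longrightarrow> x \<notin> c" using n a(3)[of n] c(2)[of n] by force
  qed
qed

text \<open>A Tietze-type series of indicators of clopen sets. If the residual lies between 0 and s,
  subtracting s/3 on a clopen set that contains the points with residual at least 2s/3 and omits
  those with residual at most s/3 leaves a residual between 0 and 2s/3; hence the ratio 2/3.\<close>

lemma unit_function_extends:
  assumes X: "compact_space X" "zero_dimensional X" "countably_separated X"
    and U: "range u \<subseteq> clopens X" "U = (\<Union>n::nat. u n)" "disjoint_family u"
    and h: "continuous_map (subtopology X U) euclideanreal h" and h01: "\<And>x. x \<in> U \<Longrightarrow> h x \<in> {0..1}"
  obtains g where "continuous_map X euclideanreal g" "\<And>x. x \<in> U \<Longrightarrow> g x = h x" "\<And>x. \<bar>g x\<bar> \<le> 1"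
proof -
  define s :: "nat \<Rightarrow> real" where "s n = (2/3)^n" for n
  define ind :: "'a set \<Rightarrow> 'a \<Rightarrow> real" where "ind c x = (if x \<in> c then 1 else 0)" for c x
  \<comment> \<open>Only the values of \<open>c\<close> below \<open>n\<close> matter, so that an
    update of \<open>c\<close> at \<open>n\<close> extends a good choice by one term.\<close>
  define good where "good n c \<longleftrightarrow> (\<forall>i<n. c i \<in> clopens X) \<and>
      (\<forall>x\<in>U. h x - (\<Sum>i<n. s i / 3 * ind (c i) x) \<in> {0..s n})" for n and c :: "nat \<Rightarrow> 'a set"
  have contind: "continuous_map X euclideanreal (\<lambda>x. \<Sum>i<n. s i / 3 * ind (c i) x)"
    if "\<And>i. i < n \<Longrightarrow> c i \<in> clopens X" for n and c :: "nat \<Rightarrow> 'a set"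
    unfolding ind_def using that
    by (intro continuous_map_sum continuous_map_real_mult_left continuous_map_clopen_cases) auto
  have step: "\<exists>d. good (Suc n) (c(n := d))" if "good n c" for n c
  proof -
    define k where "k x = h x - (\<Sum>i<n. s i / 3 * ind (c i) x)" for x
    have k: "\<And>x. x \<in> U \<Longrightarrow> k x \<in> {0..s n}" and cl: "\<And>i. i < n \<Longrightarrow> c i \<in> clopens X"
      using that by (auto simp: good_def k_def)
    have "continuous_map (subtopology X U) euclideanreal k"
      unfolding k_def by (intro continuous_map_diff h continuous_map_from_subtopology contind cl)
    moreover have "s n / 3 < 2 * s n / 3" by (simp add: s_def)
    ultimately obtain d where d: "d \<in> clopens X" "\<And>x. x \<in> U \<Longrightarrow> k x \<ge> 2 * s n / 3 \<Longrightarrow> x \<in> d"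
        "\<And>x. x \<in> U \<Longrightarrow> k x \<le> s n / 3 \<Longrightarrow> x \<notin> d"
      using countably_separated_step[OF X U] by metis
    have "good (Suc n) (c(n := d))" unfolding good_def
    proof (intro conjI allI impI ballI)
      fix x assume x: "x \<in> U"
      have "(\<Sum>i<Suc n. s i / 3 * ind ((c(n := d)) i) x) = (\<Sum>i<n. s i / 3 * ind (c i) x) + s n / 3 * ind d x"
        by (simp add: lessThan_Suc)
      then have "h x - (\<Sum>i<Suc n. s i / 3 * ind ((c(n := d)) i) x) = k x - s n / 3 * ind d x"
        by (simp add: k_def)
      moreover have "s (Suc n) = 2 * s n / 3" by (simp add: s_def)
      ultimately show "h x - (\<Sum>i<Suc n. s i / 3 * ind ((c(n := d)) i) x) \<in> {0..s (Suc n)}"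
        using k[OF x] d(2)[OF x] d(3)[OF x] unfolding ind_def atLeastAtMost_iff by (cases "x \<in> d"; simp only: if_True if_False; argo)
    qed (use cl d in auto)
    then show ?thesis ..
  qed
  then obtain nxt where nxt: "\<And>n c. good n c \<Longrightarrow> good (Suc n) (c(n := nxt n c))" by metis
  define C where "C = rec_nat (\<lambda>_. {}) (\<lambda>n c. c(n := nxt n c))"
  have C0: "C 0 = (\<lambda>_. {})" and CS: "C (Suc n) = (C n)(n := nxt n (C n))" for n by (simp_all add: C_def)
  have good: "good n (C n)" for n
  proof (induction n)
    case 0 then show ?case using h01 by (auto simp: good_def s_def C0)
  qed (simp only: CS nxt)
  \<comment> \<open>The value at \<open>n\<close> is fixed from stage \<open>Suc n\<close> on; this
    diagonal is the limit of the updates.\<close>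
  define c where "c n = C (Suc n) n" for n
  have Cc: "C n i = c i" if "i < n" for i n
    using that by (induction n) (auto simp: c_def CS less_Suc_eq)
  have good': "good n c" for n
    using good[of n] Cc[of _ n] by (simp add: good_def)
  have c: "c n \<in> clopens X" for n using good'[of "Suc n"] by (auto simp: good_def)
  define g where "g x = (\<Sum>n. s n / 3 * ind (c n) x)" for x
  have s: "(\<lambda>n. s n / 3) sums 1"
    using sums_divide[OF geometric_sums[of "2/3::real"], of 3] by (simp add: s_def)
  have ch: "0 \<le> ind d x" "ind d x \<le> 1" for d x by (auto simp: ind_def)
  have unif: "uniform_limit (topspace X) (\<lambda>n x. \<Sum>i<n. s i / 3 * ind (c i) x) g sequentially"
    unfolding g_def by (rule Weierstrass_m_test[of _ _ "\<lambda>n. s n / 3"])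
      (use s sums_summable in \<open>auto simp: s_def ind_def\<close>)
  have summ: "summable (\<lambda>n. s n / 3 * ind (c n) x)" for x
    by (rule summable_comparison_test'[of "\<lambda>n. s n / 3"]) (use s sums_summable in \<open>auto simp: s_def ind_def\<close>)
  have contg: "continuous_map X euclidean g"
  proof -
    have "continuous_map X Met_TC.mtopology g"
    proof (rule Met_TC.continuous_map_uniform_limit[where F=sequentially])
      show "\<forall>\<^sub>F n in sequentially. continuous_map X Met_TC.mtopology (\<lambda>x. \<Sum>i<n. s i / 3 * ind (c i) x)"
        using contind c by (intro always_eventually allI) simp
    qed (use unif in \<open>auto simp: uniform_limit_iff\<close>)
    then show ?thesis by simp
  qed
  have g1: "\<bar>g x\<bar> \<le> 1" for x
  proof -
    have "0 \<le> g x" unfolding g_def using ch by (intro suminf_nonneg summ) (auto simp: s_def)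
    moreover have "g x \<le> (\<Sum>n. s n / 3)"
      unfolding g_def using ch s sums_summable by (intro suminf_le summ) (auto simp: s_def mult_left_le)
    ultimately show ?thesis using sums_unique[OF s] by simp
  qed
  have "g x = h x" if "x \<in> U" for x
  proof -
    have "(\<lambda>n. \<Sum>i<n. s i / 3 * ind (c i) x) \<longlonglongrightarrow> g x"
      unfolding g_def by (rule summable_LIMSEQ[OF summ])
    moreover have "(\<lambda>n. \<Sum>i<n. s i / 3 * ind (c i) x) \<longlonglongrightarrow> h x"
    proof (rule real_tendsto_sandwich[of "\<lambda>n. h x - s n" _ _ "\<lambda>n. h x"])
      have "s \<longlonglongrightarrow> 0" unfolding s_def by (rule LIMSEQ_realpow_zero) auto
      then show "(\<lambda>n. h x - s n) \<longlonglongrightarrow> h x" using tendsto_diff[OF tendsto_const[of "h x"]] by fastforce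
      have "h x - (\<Sum>i<n. s i / 3 * ind (c i) x) \<in> {0..s n}" for n
        using good'[of n] that by (simp add: good_def)
      then have "h x - s n \<le> (\<Sum>i<n. s i / 3 * ind (c i) x)" "(\<Sum>i<n. s i / 3 * ind (c i) x) \<le> h x" for n
        by (simp_all add: field_simps)
      then show "\<forall>\<^sub>F n in sequentially. h x - s n \<le> (\<Sum>i<n. s i / 3 * ind (c i) x)"
        "\<forall>\<^sub>F n in sequentially. (\<Sum>i<n. s i / 3 * ind (c i) x) \<le> h x" by (auto intro: always_eventually)
    qed simp
    ultimately show ?thesis using LIMSEQ_unique by blast
  qed
  then show ?thesis using that contg g1 by blast
qed

lemma countably_separated_imp_F_space:
  assumes X: "compact_space X" "zero_dimensional X" "countably_separated X"
  shows "F_space X"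
  unfolding F_space_def
proof (intro allI impI)
  fix U assume coz: "cozero_in X U"
  then obtain u where u: "range u \<subseteq> clopens X" "U = (\<Union>n::nat. u n)" "disjoint_family u"
    using cozero_sigma_clopen[OF X(1,2)] by metis
  show "C_star_embedded X U" unfolding C_star_embedded_def
  proof (intro conjI allI impI)
    show "U \<subseteq> topspace X" using coz by (auto simp: cozero_in_def)
    fix f :: "'a \<Rightarrow> real"
    assume f: "continuous_map (subtopology X U) euclidean f \<and> bounded (f ` U)"
    then obtain B where B: "B > 0" "\<And>x. x \<in> U \<Longrightarrow> \<bar>f x\<bar> \<le> B" by (auto simp: bounded_pos)
    define h where "h x = (f x + B) / (2 * B)" for x
    have "continuous_map (subtopology X U) euclideanreal h"
      unfolding h_def using f B by (intro continuous_map_real_divide continuous_map_add) auto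
    moreover have "h x \<in> {0..1}" if "x \<in> U" for x
      using B(2)[OF that] B(1) by (auto simp: h_def field_simps abs_le_iff)
    ultimately obtain g where g: "continuous_map X euclideanreal g" "\<And>x. x \<in> U \<Longrightarrow> g x = h x" "\<And>x. \<bar>g x\<bar> \<le> 1"
      using unit_function_extends[OF X u] by metis
    show "\<exists>g. continuous_map X euclideanreal g \<and> bounded (g ` topspace X) \<and> (\<forall>x\<in>U. g x = f x)"
    proof (intro exI[of _ "\<lambda>x. 2 * B * g x - B"] conjI ballI)
      show "continuous_map X euclideanreal (\<lambda>x. 2 * B * g x - B)"
        using g by (intro continuous_map_diff continuous_map_real_mult_left) auto
      show "bounded ((\<lambda>x. 2 * B * g x - B) ` topspace X)"
      proof (rule boundedI)
        fix y assume "y \<in> (\<lambda>x. 2 * B * g x - B) ` topspace X"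
        then obtain x where y: "y = 2 * B * g x - B" by auto
        have "\<bar>2 * B * g x\<bar> \<le> 2 * B * 1" using g(3)[of x] B(1) unfolding abs_mult by (intro mult_mono) auto
        then show "norm y \<le> 3 * B" using y B(1) by auto
      qed
    qed (use g B in \<open>auto simp: h_def field_simps\<close>)
  qed
qed

section \<open>Weight as the number of clopen sets\<close>

lemma clopens_is_base: "zero_dimensional X \<Longrightarrow> is_base X (clopens X)"
  unfolding is_base_iff zero_dimensional_iff by (auto simp: clopens_def)

text \<open>A nonempty set of at most n+1 elements arises from an element and a set of at most n
  elements; the countable union over n does not raise the cardinal.\<close>

lemma card_of_Fpow_infinite:
  assumes "infinite A"
  shows "|Fpow A| \<le>o |A|"
proof -
  define F where "F n = {S. S \<subseteq> A \<and> finite S \<and> card S \<le> n}" for n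
  have F: "|F n| \<le>o |A|" for n
  proof (induction n)
    case 0
    have "F 0 = {{}}" by (auto simp: F_def)
    moreover have "A \<noteq> {}" using assms by auto
    ultimately show ?case by (simp add: card_of_singl_ordLeq)
  next
    case (Suc n)
    have "F (Suc n) \<subseteq> (\<lambda>(x, S). insert x S) ` (A \<times> F n) \<union> {{}}"
    proof
      fix S assume S: "S \<in> F (Suc n)"
      show "S \<in> (\<lambda>(x, S). insert x S) ` (A \<times> F n) \<union> {{}}"
      proof (cases "S = {}")
        case False
        then obtain x where x: "x \<in> S" by auto
        then have "S = insert x (S - {x})" "S - {x} \<in> F n" "x \<in> A" using S by (auto simp: F_def)
        then have "S \<in> (\<lambda>(x, S). insert x S) ` (A \<times> F n)" by (intro image_eqI[of _ _ "(x, S - {x})"]) simp_all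
        then show ?thesis by blast
      qed simp
    qed
    then have "|F (Suc n)| \<le>o |(\<lambda>(x, S). insert x S) ` (A \<times> F n) \<union> {{}}|" by (rule card_of_mono1)
    also have "|(\<lambda>(x, S). insert x S) ` (A \<times> F n) \<union> {{}}| \<le>o |A|"
    proof (intro card_of_Un_ordLeq_infinite_Field)
      have "|A \<times> F n| \<le>o |A|"
        using card_of_Times_ordLeq_infinite_Field[OF _ card_of_mono1[OF subset_refl] Suc card_of_Card_order] assms
        by (simp add: Field_card_of)
      then show "|(\<lambda>(x, S). insert x S) ` (A \<times> F n)| \<le>o |A|" using card_of_image ordLeq_transitive by blast
      have "A \<noteq> {}" using assms by auto
      then show "|{{}}| \<le>o |A|" by (simp add: card_of_singl_ordLeq)
    qed (use assms card_of_Card_order in \<open>simp_all add: Field_card_of\<close>)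
    finally show ?case .
  qed
  have "Fpow A = (\<Union>n. F n)" by (auto simp: F_def Fpow_def)
  moreover have "|\<Union>n. F n| \<le>o |A|"
    using F assms by (intro card_of_UNION_ordLeq_infinite) (auto simp: infinite_iff_card_of_nat[symmetric])
  ultimately show ?thesis by simp
qed

lemma clopens_le_base:
  assumes "compact_space X" "is_base X B"
  shows "clopens X \<subseteq> Union ` Fpow B"
proof
  fix C assume C: "C \<in> clopens X"
  have "compactin X C" using assms C closedin_compact_space by (auto simp: clopens_def)
  moreover have "\<forall>V\<in>{V \<in> B. V \<subseteq> C}. openin X V" using assms by (auto simp: is_base_iff)
  moreover have "C \<subseteq> \<Union>{V \<in> B. V \<subseteq> C}"
    using assms C unfolding is_base_iff clopens_def by blast
  ultimately obtain F where F: "finite F" "F \<subseteq> {V \<in> B. V \<subseteq> C}" "C \<subseteq> \<Union>F"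
    unfolding compactin_def by (elim conjE allE[of _ "{V \<in> B. V \<subseteq> C}"]) blast
  then have "C = \<Union>F" "F \<in> Fpow B" by (auto simp: Fpow_def)
  then show "C \<in> Union ` Fpow B" by blast
qed

text \<open>The clopen sets form a base themselves and, by compactness, are finite unions of members
  of any other base. A finite base would leave only finitely many of them.\<close>

lemma has_weight_iff_clopens:
  assumes "compact_space X" "zero_dimensional X" "Cinfinite \<kappa>"
  shows "has_weight X \<kappa> \<longleftrightarrow> |clopens X| =o \<kappa>"
proof -
  have le: "|clopens X| \<le>o |B|" if "is_base X B" "infinite B" for B
  proof -
    have "|clopens X| \<le>o |Fpow B|"
      using clopens_le_base[OF assms(1) that(1)] by (rule surj_imp_ordLeq)
    then show ?thesis using card_of_Fpow_infinite[OF that(2)] ordLeq_transitive by blast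
  qed
  have inf: "infinite B" if "|B| =o \<kappa>" for B :: "'a set set"
    using that assms(3) by (metis Cinfinite_cong card_of_Field_ordIso cinfinite_def Field_card_of ordIso_symmetric)
  have fin: "finite (clopens X)" if "is_base X B" "finite B" for B
    by (rule finite_subset[OF clopens_le_base[OF assms(1) that(1)]]) (use that in \<open>auto simp: Fpow_def\<close>)
  show ?thesis
  proof
    assume w: "has_weight X \<kappa>"
    then obtain B where B: "is_base X B" "|B| =o \<kappa>" by (auto simp: has_weight_def)
    have "|clopens X| \<le>o \<kappa>" using le[OF B(1) inf[OF B(2)]] B(2) by (rule ordLeq_ordIso_trans)
    moreover have "\<kappa> \<le>o |clopens X|" using w clopens_is_base[OF assms(2)] by (auto simp: has_weight_def)
    ultimately show "|clopens X| =o \<kappa>" by (simp add: ordIso_iff_ordLeq)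
  next
    assume c: "|clopens X| =o \<kappa>"
    show "has_weight X \<kappa>" unfolding has_weight_def
    proof (intro conjI allI impI)
      show "\<exists>\<B>. is_base X \<B> \<and> |\<B>| =o \<kappa>" using c clopens_is_base[OF assms(2)] by blast
      fix B assume B: "is_base X B"
      then have "infinite B" using fin inf[OF c] by blast
      then show "\<kappa> \<le>o |B|" using le[OF B] c ordIso_ordLeq_trans ordIso_symmetric by blast
    qed
  qed
qed

lemma Cinfinite_continuum: "Cinfinite (ctwo ^c natLeq)"
  by (intro Cinfinite_cexp natLeq_Cinfinite ordLeq_refl Card_order_ctwo)

section \<open>The G-delta condition in terms of clopen sets\<close>

text \<open>Splitting a finite clopen set would give a strictly smaller nonempty one, without
  end.\<close>

lemma clopen_infinite:
  assumes "splits_below X" "C \<in> clopens X" "C \<noteq> {}"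
  shows "infinite C"
proof
  assume "finite C"
  then show False using assms(2,3)
  proof (induction C rule: finite_psubset_induct)
    case (psubset C)
    have "\<exists>c\<in>clopens X. \<exists>d\<in>clopens X. c \<noteq> {} \<and> d \<noteq> {} \<and> c \<inter> d = {} \<and> (\<forall>n::nat. c \<subseteq> C \<and> d \<subseteq> C)"
      using assms(1) psubset.prems unfolding splits_below_def
      by (elim allE[of _ "\<lambda>_. C"]) (auto simp: decseq_def)
    then obtain c d where cd: "c \<in> clopens X" "d \<noteq> {}" "c \<noteq> {}" "c \<inter> d = {}" "c \<subseteq> C" "d \<subseteq> C" by auto
    then have "c \<subset> C" by blast
    then show False using psubset.IH cd by blast
  qed
qed

text \<open>From left to right, compactness makes the intersection of the sequence nonempty, and two
  points of its infinite interior are separated by clopen sets. From right to left, finite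
  intersections of clopen neighbourhoods of a point of the G-delta set form a decreasing sequence; a
  clopen lower bound lies in the interior and is infinite.\<close>

lemma gdelta_interior_iff_splits_below:
  assumes "compact_space X" "Hausdorff_space X" "zero_dimensional X"
  shows "(\<forall>G. gdelta_in X G \<and> G \<noteq> {} \<longrightarrow> infinite (X interior_of G)) \<longleftrightarrow> splits_below X"
proof
  assume L: "\<forall>G. gdelta_in X G \<and> G \<noteq> {} \<longrightarrow> infinite (X interior_of G)"
  show "splits_below X" unfolding splits_below_def
  proof (intro allI impI, elim conjE)
    fix a :: "nat \<Rightarrow> 'a set"
    assume a: "range a \<subseteq> clopens X" "decseq a" "\<forall>n. a n \<noteq> {}"
    have "\<And>n. openin X (a n)" "\<And>n. closedin X (a n)" using a(1) by (auto simp: clopens_def)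
    then have "gdelta_in X (\<Inter>n. a n)" "(\<Inter>n. a n) \<noteq> {}"
      using a(2,3) compact_space_imp_nest[OF assms(1), of a]
      by (auto simp: gdelta_in_descending decseq_Suc_iff intro!: exI[of _ a])
    then have inf: "infinite (X interior_of (\<Inter>n. a n))" using L by blast
    define I where "I = X interior_of (\<Inter>n. a n)"
    obtain x where x: "x \<in> I" using inf unfolding I_def by (metis ex_in_conv finite.emptyI)
    obtain y where y: "y \<in> I" "y \<noteq> x" using inf unfolding I_def
      by (metis finite.emptyI finite_insert finite_subset insertI1 subsetI)
    have I: "openin X I" "I \<subseteq> (\<Inter>n. a n)" by (auto simp: I_def interior_of_subset)
    then have "x \<in> topspace X" "y \<in> topspace X" using x y openin_subset[OF I(1)] by auto
    then obtain U V where UV: "openin X U" "openin X V" "x \<in> U" "y \<in> V" "disjnt U V"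
      using assms(2) y(2) unfolding Hausdorff_space_def by metis
    obtain c where c: "c \<in> clopens X" "x \<in> c" "c \<subseteq> U \<inter> I"
      using assms(3) UV I x unfolding zero_dimensional_iff by (metis IntI openin_Int)
    obtain d where d: "d \<in> clopens X" "y \<in> d" "d \<subseteq> V \<inter> I"
      using assms(3) UV I y unfolding zero_dimensional_iff by (metis IntI openin_Int)
    show "\<exists>c\<in>clopens X. \<exists>d\<in>clopens X. c \<noteq> {} \<and> d \<noteq> {} \<and> c \<inter> d = {} \<and> (\<forall>n. c \<subseteq> a n \<and> d \<subseteq> a n)"
      using c d UV(5) I(2) by (intro bexI[of _ c] bexI[of _ d]) (auto simp: disjnt_def)
  qed
next
  assume R: "splits_below X"
  show "\<forall>G. gdelta_in X G \<and> G \<noteq> {} \<longrightarrow> infinite (X interior_of G)"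
  proof (intro allI impI, elim conjE)
    fix G assume "gdelta_in X G" "G \<noteq> {}"
    then obtain C :: "nat \<Rightarrow> 'a set" where C: "\<And>n. openin X (C n)" "\<Inter>(range C) = G"
      unfolding gdelta_in_descending by metis
    obtain x where x: "x \<in> G" using \<open>G \<noteq> {}\<close> by blast
    have "\<forall>n. \<exists>K\<in>clopens X. x \<in> K \<and> K \<subseteq> C n"
      using assms(3) C x unfolding zero_dimensional_iff by blast
    then obtain K where K: "\<And>n. K n \<in> clopens X" "\<And>n. x \<in> K n" "\<And>n. K n \<subseteq> C n" by metis
    define a where "a n = (\<Inter>i\<le>n. K i)" for n
    have "range a \<subseteq> clopens X" using K by (auto simp: a_def intro!: clopens_INT)
    moreover have "decseq a" by (auto simp: a_def decseq_def)
    moreover have "\<forall>n. a n \<noteq> {}" using K(2) by (auto simp: a_def)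
    ultimately obtain c where c: "c \<in> clopens X" "c \<noteq> {}" "\<And>n. c \<subseteq> a n"
      using R unfolding splits_below_def by metis
    have "c \<subseteq> G"
    proof -
      have "c \<subseteq> C n" for n using c(3)[of n] K(3)[of n] by (auto simp: a_def)
      then show ?thesis using C(2) by auto
    qed
    then have "c \<subseteq> X interior_of G" using c by (simp add: clopens_def interior_of_maximal)
    then show "infinite (X interior_of G)" using clopen_infinite[OF R c(1,2)] finite_subset by blast
  qed
qed

theorem Parovicenko_space_iff:
  "Parovicenko_space X \<longleftrightarrow>
    compact_space X \<and> Hausdorff_space X \<and> zero_dimensional X \<and> countably_separated X \<and> splits_below X \<and>
    |clopens X| =o ctwo ^c natLeq"
proof (cases "compact_space X \<and> Hausdorff_space X \<and> zero_dimensional X")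
  case True
  then have "F_space X \<longleftrightarrow> countably_separated X"
    using F_space_imp_countably_separated countably_separated_imp_F_space by blast
  then show ?thesis
    using True gdelta_interior_iff_splits_below[of X] has_weight_iff_clopens[OF _ _ Cinfinite_continuum, of X]
    unfolding Parovicenko_space_def by argo
qed (auto simp: Parovicenko_space_def)

section \<open>Invariance under homeomorphism\<close>

lemma homeomorphic_maps_clopens:
  assumes "homeomorphic_maps X Y f g" "U \<in> clopens X"
  shows "f ` U \<in> clopens Y"
proof -
  have f: "homeomorphic_map X Y f" using homeomorphic_maps_imp_map[OF assms(1)] .
  show ?thesis
    using homeomorphic_map_openness[OF f clopens_subset[OF assms(2)]]
      homeomorphic_map_closedness[OF f clopens_subset[OF assms(2)]] assms(2) by (simp add: clopens_def)
qed

lemma homeomorphic_maps_image_inverse: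
  assumes "homeomorphic_maps X Y f g" "U \<subseteq> topspace X"
  shows "g ` f ` U = U"
  using assms by (force simp: homeomorphic_maps_def image_image subset_iff)

text \<open>Lets spaces built on convenient types be replaced by copies on
  \<open>nat set set\<close>. As the property has been reduced to clopen sets, images under two
  mutually inverse maps carry each clause across.\<close>

lemma Parovicenko_space_homeomorphic:
  assumes "X homeomorphic_space Y" "Parovicenko_space X"
  shows "Parovicenko_space Y"
proof -
  obtain f g where fg: "homeomorphic_maps X Y f g" using assms(1) by (auto simp: homeomorphic_space_def)
  then have gf: "homeomorphic_maps Y X g f" using homeomorphic_maps_sym by blast
  have P: "compact_space X" "Hausdorff_space X" "zero_dimensional X" "countably_separated X" "splits_below X"
    "|clopens X| =o ctwo ^c natLeq" using assms(2) by (auto simp: Parovicenko_space_iff)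
  note F = homeomorphic_maps_clopens[OF fg] and G = homeomorphic_maps_clopens[OF gf]
  note GF = homeomorphic_maps_image_inverse[OF fg] and FG = homeomorphic_maps_image_inverse[OF gf]
  have GI: "g ` U \<inter> g ` V = g ` (U \<inter> V)" if "U \<in> clopens Y" "V \<in> clopens Y" for U V
  proof -
    have "inj_on g (topspace Y)" using gf homeomorphic_imp_injective_map homeomorphic_maps_imp_map by blast
    then show ?thesis using clopens_subset[OF that(1)] clopens_subset[OF that(2)] by (simp add: inj_on_image_Int)
  qed
  have FI: "f ` U \<inter> f ` V = f ` (U \<inter> V)" if "U \<in> clopens X" "V \<in> clopens X" for U V
  proof -
    have "inj_on f (topspace X)" using fg homeomorphic_imp_injective_map homeomorphic_maps_imp_map by blast
    then show ?thesis using clopens_subset[OF that(1)] clopens_subset[OF that(2)] by (simp add: inj_on_image_Int)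
  qed
  have "zero_dimensional Y" unfolding zero_dimensional_iff
  proof (intro allI impI, elim conjE)
    fix U y assume U: "openin Y U" "y \<in> U"
    have Us: "U \<subseteq> topspace Y" using openin_subset[OF U(1)] .
    then have "openin X (g ` U)"
      using homeomorphic_map_openness[OF homeomorphic_maps_imp_map[OF gf] Us] U(1) by simp
    then obtain C where C: "C \<in> clopens X" "g y \<in> C" "C \<subseteq> g ` U" using P(3) U(2) unfolding zero_dimensional_iff by blast
    have "f (g y) = y" using gf U(2) Us by (auto simp: homeomorphic_maps_def)
    then have "y \<in> f ` C" using imageI[OF C(2), of f] by simp
    moreover have "f ` C \<subseteq> U" using image_mono[OF C(3), of f] FG[OF Us] by simp
    ultimately show "\<exists>C\<in>clopens Y. y \<in> C \<and> C \<subseteq> U" using F[OF C(1)] by blast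
  qed
  moreover have "countably_separated Y" unfolding countably_separated_def
  proof (intro allI impI, elim conjE)
    fix a b :: "nat \<Rightarrow> 'b set"
    assume ab: "range a \<subseteq> clopens Y" "range b \<subseteq> clopens Y" "\<forall>m n. a m \<inter> b n = {}"
    have cl: "a n \<in> clopens Y" "b n \<in> clopens Y" for n using ab by auto
    have "\<forall>m n. g ` a m \<inter> g ` b n = {}" using GI[OF cl(1) cl(2)] ab(3) by simp
    moreover have "range (\<lambda>n. g ` a n) \<subseteq> clopens X" "range (\<lambda>n. g ` b n) \<subseteq> clopens X" using G cl by auto
    ultimately obtain c where c: "c \<in> clopens X" "\<forall>n. g ` a n \<subseteq> c \<and> g ` b n \<inter> c = {}"
      using P(4)[unfolded countably_separated_def, rule_format, of "\<lambda>n. g ` a n" "\<lambda>n. g ` b n"] by blast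
    show "\<exists>c\<in>clopens Y. \<forall>n. a n \<subseteq> c \<and> b n \<inter> c = {}"
    proof (intro bexI[of _ "f ` c"] allI conjI F c)
      fix n
      have "f ` g ` a n \<subseteq> f ` c" using c(2) by blast
      then show "a n \<subseteq> f ` c" using FG[OF clopens_subset[OF cl(1)]] by simp
      have "f ` g ` b n \<inter> f ` c = {}" using FI[OF G[OF cl(2)] c(1)] c(2) by simp
      then show "b n \<inter> f ` c = {}" using FG[OF clopens_subset[OF cl(2)]] by simp
    qed
  qed
  moreover have "splits_below Y" unfolding splits_below_def
  proof (intro allI impI, elim conjE)
    fix a :: "nat \<Rightarrow> 'b set"
    assume a: "range a \<subseteq> clopens Y" "decseq a" "\<forall>n. a n \<noteq> {}"
    have cl: "a n \<in> clopens Y" for n using a by auto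
    have "range (\<lambda>n. g ` a n) \<subseteq> clopens X" "decseq (\<lambda>n. g ` a n)" "\<forall>n. g ` a n \<noteq> {}"
      using G cl a by (auto simp: decseq_def image_mono)
    then have "\<exists>c\<in>clopens X. \<exists>d\<in>clopens X. c \<noteq> {} \<and> d \<noteq> {} \<and> c \<inter> d = {} \<and> (\<forall>n. c \<subseteq> g ` a n \<and> d \<subseteq> g ` a n)"
      by (intro P(5)[unfolded splits_below_def, THEN spec, THEN mp] conjI)
    then obtain c d where cd: "c \<in> clopens X" "d \<in> clopens X" "c \<noteq> {}" "d \<noteq> {}" "c \<inter> d = {}"
        and cd': "\<forall>n. c \<subseteq> g ` a n \<and> d \<subseteq> g ` a n" by (elim bexE conjE)
    have "f ` c \<subseteq> a n" "f ` d \<subseteq> a n" for n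
      using image_mono[OF cd'[THEN spec, THEN conjunct1, of n], of f] image_mono[OF cd'[THEN spec, THEN conjunct2, of n], of f] FG[OF clopens_subset[OF cl]] by simp_all
    then show "\<exists>c\<in>clopens Y. \<exists>d\<in>clopens Y. c \<noteq> {} \<and> d \<noteq> {} \<and> c \<inter> d = {} \<and> (\<forall>n. c \<subseteq> a n \<and> d \<subseteq> a n)"
      using F cd FI[OF cd(1,2)] by (intro bexI[of _ "f ` c"] bexI[of _ "f ` d"]) auto
  qed
  moreover have "|clopens Y| =o ctwo ^c natLeq"
  proof -
    have "bij_betw (image f) (clopens X) (clopens Y)"
      by (rule bij_betw_byWitness[of _ "image g"])
        (simp_all add: F G GF[OF clopens_subset] FG[OF clopens_subset] image_subset_iff)
    then have "|clopens X| =o |clopens Y|" using card_of_ordIso by blast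
    then show ?thesis using P(6) ordIso_symmetric ordIso_transitive by blast
  qed
  ultimately show ?thesis
    using P(1,2) homeomorphic_compact_space[OF assms(1)] homeomorphic_Hausdorff_space[OF assms(1)]
    by (simp add: Parovicenko_space_iff)
qed

lemma carrier_homeo_group: "carrier (homeo_group X) = {f \<in> Bij (topspace X). homeomorphic_map X X f}"
  by (simp add: homeo_group_def)

lemma mult_homeo_group:
  "f \<in> carrier (homeo_group X) \<Longrightarrow> g \<in> carrier (homeo_group X) \<Longrightarrow>
    f \<otimes>\<^bsub>homeo_group X\<^esub> g = compose (topspace X) f g"
  by (simp add: homeo_group_def BijGroup_def)

lemma restrict_in_homeo_group:
  assumes "homeomorphic_map X X f"
  shows "restrict f (topspace X) \<in> carrier (homeo_group X)"
proof -
  have "homeomorphic_map X X (restrict f (topspace X))"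
    using assms homeomorphic_map_eq[of X X f "restrict f (topspace X)"] by simp
  moreover have "bij_betw f (topspace X) (topspace X)"
    using homeomorphic_imp_injective_map[OF assms] homeomorphic_imp_surjective_map[OF assms] by (simp add: bij_betw_def)
  then have "bij_betw (restrict f (topspace X)) (topspace X) (topspace X)"
    by (simp cong: bij_betw_cong)
  ultimately show ?thesis by (simp add: carrier_homeo_group Bij_def)
qed

text \<open>The isomorphism is conjugation by a homeomorphism; \<open>restrict\<close> keeps the
  conjugates extensional, as membership in the group demands.\<close>

lemma homeo_group_cong:
  assumes "X homeomorphic_space Y"
  shows "homeo_group X \<cong> homeo_group Y"
proof -
  obtain f g where fg: "homeomorphic_maps X Y f g" using assms by (auto simp: homeomorphic_space_def)
  then have f: "homeomorphic_map X Y f" and g: "homeomorphic_map Y X g"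
    using homeomorphic_maps_sym homeomorphic_maps_imp_map by blast+
  have gf: "x \<in> topspace X \<Longrightarrow> g (f x) = x \<and> f x \<in> topspace Y" and fg': "y \<in> topspace Y \<Longrightarrow> f (g y) = y \<and> g y \<in> topspace X" for x y
    using fg by (auto simp: homeomorphic_maps_def continuous_map_def)
  define \<phi> where "\<phi> h = restrict (f \<circ> h \<circ> g) (topspace Y)" for h
  define \<psi> where "\<psi> h = restrict (g \<circ> h \<circ> f) (topspace X)" for h
  have \<phi>: "\<phi> h \<in> carrier (homeo_group Y)" if "h \<in> carrier (homeo_group X)" for h
    using that f g unfolding \<phi>_def
    by (intro restrict_in_homeo_group) (auto simp: carrier_homeo_group intro!: homeomorphic_map_compose)
  have \<psi>: "\<psi> h \<in> carrier (homeo_group X)" if "h \<in> carrier (homeo_group Y)" for h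
    using that f g unfolding \<psi>_def
    by (intro restrict_in_homeo_group) (auto simp: carrier_homeo_group intro!: homeomorphic_map_compose)
  have cX: "x \<in> topspace X \<Longrightarrow> h x \<in> topspace X" "h \<in> extensional (topspace X)" if "h \<in> carrier (homeo_group X)" for h x
    using that by (auto simp: carrier_homeo_group Bij_def bij_betw_def)
  have cY: "x \<in> topspace Y \<Longrightarrow> h x \<in> topspace Y" "h \<in> extensional (topspace Y)" if "h \<in> carrier (homeo_group Y)" for h x
    using that by (auto simp: carrier_homeo_group Bij_def bij_betw_def)
  have "bij_betw \<phi> (carrier (homeo_group X)) (carrier (homeo_group Y))"
  proof (rule bij_betw_byWitness[of _ \<psi>])
    show "\<forall>h\<in>carrier (homeo_group X). \<psi> (\<phi> h) = h"
    proof
      fix h assume h: "h \<in> carrier (homeo_group X)"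
      show "\<psi> (\<phi> h) = h"
        by (rule extensionalityI[of _ "topspace X"]) (use gf cX[OF h] in \<open>auto simp: \<phi>_def \<psi>_def\<close>)
    qed
    show "\<forall>h\<in>carrier (homeo_group Y). \<phi> (\<psi> h) = h"
    proof
      fix h assume h: "h \<in> carrier (homeo_group Y)"
      show "\<phi> (\<psi> h) = h"
        by (rule extensionalityI[of _ "topspace Y"]) (use fg' cY[OF h] in \<open>auto simp: \<phi>_def \<psi>_def\<close>)
    qed
  qed (use \<phi> \<psi> in auto)
  moreover have "\<phi> \<in> hom (homeo_group X) (homeo_group Y)"
  proof (rule homI)
    fix h k assume h: "h \<in> carrier (homeo_group X)" and k: "k \<in> carrier (homeo_group X)"
    have "\<phi> (compose (topspace X) h k) = compose (topspace Y) (\<phi> h) (\<phi> k)"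
      by (rule extensionalityI[of _ "topspace Y"])
        (use gf fg' cX[OF h] cX[OF k] in \<open>auto simp: \<phi>_def compose_def\<close>)
    then show "\<phi> (h \<otimes>\<^bsub>homeo_group X\<^esub> k) = \<phi> h \<otimes>\<^bsub>homeo_group Y\<^esub> \<phi> k"
      using h k \<phi> by (simp add: mult_homeo_group)
  qed (use \<phi> in auto)
  ultimately show ?thesis by (auto intro: is_isoI simp: iso_def)
qed

section \<open>Parovicenko's theorem\<close>

text \<open>The graph of an isomorphism between subalgebras of the clopen algebras. The clause on
  empty sets makes it single-valued and injective: if \<open>a\<close> is related to both
  \<open>a'\<close> and \<open>b'\<close>, the empty set is related to \<open>a' - b'\<close> and to
  \<open>b' - a'\<close>. As a relation it can be inverted by \<open>converse\<close> and united
  along chains.\<close>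

definition partial_clopen_iso :: "'a topology \<Rightarrow> 'b topology \<Rightarrow> ('a set \<times> 'b set) set \<Rightarrow> bool"
  where "partial_clopen_iso X Y R \<longleftrightarrow> R \<subseteq> clopens X \<times> clopens Y \<and> (topspace X, topspace Y) \<in> R \<and>
    (\<forall>a a' b b'. (a, a') \<in> R \<and> (b, b') \<in> R \<longrightarrow> (a - b, a' - b') \<in> R \<and> (a \<union> b, a' \<union> b') \<in> R) \<and>
    (\<forall>a a'. (a, a') \<in> R \<longrightarrow> (a = {} \<longleftrightarrow> a' = {}))"

lemma partial_clopen_isoD:
  assumes "partial_clopen_iso X Y R"
  shows "(a, a') \<in> R \<Longrightarrow> a \<in> clopens X" "(a, a') \<in> R \<Longrightarrow> a' \<in> clopens Y"
    "(topspace X, topspace Y) \<in> R" "({}, {}) \<in> R"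
    "(a, a') \<in> R \<Longrightarrow> (b, b') \<in> R \<Longrightarrow> (a - b, a' - b') \<in> R"
    "(a, a') \<in> R \<Longrightarrow> (b, b') \<in> R \<Longrightarrow> (a \<union> b, a' \<union> b') \<in> R"
    "(a, a') \<in> R \<Longrightarrow> a = {} \<longleftrightarrow> a' = {}"
proof -
  have "(topspace X - topspace X, topspace Y - topspace Y) \<in> R"
    using assms unfolding partial_clopen_iso_def by blast
  then show "({}, {}) \<in> R" by simp
qed (use assms in \<open>unfold partial_clopen_iso_def, blast+\<close>)

lemma partial_clopen_iso_UN:
  assumes "partial_clopen_iso X Y R" "finite F" "\<And>i. i \<in> F \<Longrightarrow> (u i, v i) \<in> R"
  shows "((\<Union>i\<in>F. u i), (\<Union>i\<in>F. v i)) \<in> R"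
  using assms(2,3)
  by (induction F rule: finite_induct) (simp_all add: partial_clopen_isoD[OF assms(1)])

lemma partial_clopen_iso_converse:
  "partial_clopen_iso X Y R \<Longrightarrow> partial_clopen_iso Y X (R\<inverse>)"
  unfolding partial_clopen_iso_def by auto

lemma partial_clopen_iso_Union:
  assumes "\<C> \<noteq> {}" and iso: "\<And>R. R \<in> \<C> \<Longrightarrow> partial_clopen_iso X Y R"
    and chain: "\<And>R S. R \<in> \<C> \<Longrightarrow> S \<in> \<C> \<Longrightarrow> R \<subseteq> S \<or> S \<subseteq> R"
  shows "partial_clopen_iso X Y (\<Union>\<C>)"
  unfolding partial_clopen_iso_def
proof (intro conjI allI impI; (elim conjE)?)
  show "\<Union>\<C> \<subseteq> clopens X \<times> clopens Y" using iso unfolding partial_clopen_iso_def by blast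
  show "(topspace X, topspace Y) \<in> \<Union>\<C>" using iso assms(1) unfolding partial_clopen_iso_def by blast
  show "a = {} \<longleftrightarrow> a' = {}" if "(a, a') \<in> \<Union>\<C>" for a a' using that iso partial_clopen_isoD(7) by blast
  fix a a' b b' assume "(a, a') \<in> \<Union>\<C>" "(b, b') \<in> \<Union>\<C>"
  then obtain R where R: "R \<in> \<C>" "(a, a') \<in> R" "(b, b') \<in> R" using chain by blast
  show "(a - b, a' - b') \<in> \<Union>\<C>" using partial_clopen_isoD(5)[OF iso[OF R(1)] R(2,3)] R(1) by blast
  show "(a \<union> b, a' \<union> b') \<in> \<Union>\<C>" using partial_clopen_isoD(6)[OF iso[OF R(1)] R(2,3)] R(1) by blast
qed

section \<open>One-step extension of countable partial isomorphisms\<close>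

lemma countably_separated_countable:
  assumes "countably_separated X" "countable \<A>" "countable \<B>" "\<A> \<subseteq> clopens X" "\<B> \<subseteq> clopens X"
    and disj: "\<And>A B. A \<in> \<A> \<Longrightarrow> B \<in> \<B> \<Longrightarrow> A \<inter> B = {}"
  obtains c where "c \<in> clopens X" "\<And>A. A \<in> \<A> \<Longrightarrow> A \<subseteq> c" "\<And>B. B \<in> \<B> \<Longrightarrow> B \<inter> c = {}"
proof -
  \<comment> \<open>Inserting the empty set makes both families enumerable and changes neither
    disjointness nor the separator.\<close>
  let ?a = "from_nat_into (insert {} \<A>)" and ?b = "from_nat_into (insert {} \<B>)"
  have r: "range ?a = insert {} \<A>" "range ?b = insert {} \<B>"
    using assms(2,3) by (simp_all add: range_from_nat_into)
  have "?a m \<inter> ?b n = {}" for m n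
    using r disj by (metis inf_bot_left inf_bot_right insertE rangeI)
  moreover have "range ?a \<subseteq> clopens X" "range ?b \<subseteq> clopens X"
    unfolding r using assms(4,5) by (auto intro: clopens_empty)
  ultimately obtain c where c: "c \<in> clopens X" "\<forall>n. ?a n \<subseteq> c \<and> ?b n \<inter> c = {}"
    using assms(1)[unfolded countably_separated_def, rule_format, of ?a ?b] by blast
  have "\<forall>A\<in>range ?a. A \<subseteq> c" "\<forall>B\<in>range ?b. B \<inter> c = {}" using c(2) by blast+
  then show ?thesis using that[OF c(1)] unfolding r by blast
qed

lemma splits_belowD:
  assumes "splits_below X" "range a \<subseteq> clopens X" "decseq a" "\<forall>n. a n \<noteq> {}"
  shows "\<exists>c d. c \<in> clopens X \<and> d \<in> clopens X \<and> c \<noteq> {} \<and> d \<noteq> {} \<and> c \<inter> d = {} \<and> (\<forall>n. c \<subseteq> a n) \<and> (\<forall>n. d \<subseteq> a n)"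
proof -
  have "\<exists>c\<in>clopens X. \<exists>d\<in>clopens X. c \<noteq> {} \<and> d \<noteq> {} \<and> c \<inter> d = {} \<and> (\<forall>n. c \<subseteq> a n \<and> d \<subseteq> a n)"
    by (intro assms(1)[unfolded splits_below_def, THEN spec, THEN mp] conjI assms)
  then show ?thesis by fast
qed

lemma splits_below_avoid:
  assumes "splits_below X" "u \<in> clopens X" "\<And>n. q n \<in> clopens X" "\<And>n::nat. u - (\<Union>i\<le>n. q i) \<noteq> {}"
  obtains c where "c \<in> clopens X" "c \<noteq> {}" "c \<subseteq> u" "\<And>n. c \<inter> q n = {}"
proof -
  define a where "a n = u - (\<Union>i\<le>n. q i)" for n
  have "range a \<subseteq> clopens X" using assms(2,3) by (auto simp: a_def intro!: clopens_Diff clopens_UN)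
  moreover have "decseq a" unfolding decseq_def a_def by (intro allI impI Diff_mono UN_mono) auto
  moreover have "\<forall>n. a n \<noteq> {}" using assms(4) by (simp add: a_def)
  ultimately obtain c where c: "c \<in> clopens X" "c \<noteq> {}" "\<And>n. c \<subseteq> a n"
    using splits_belowD[OF assms(1), of a] by fast
  show ?thesis using that[OF c(1,2)] c(3) unfolding a_def by blast
qed

text \<open>Of two disjoint nonempty clopen parts of \<open>c\<close>, at most one can contain the
  nonempty set \<open>h\<close>.\<close>

lemma splits_below_half:
  assumes "splits_below X" "c \<in> clopens X" "c \<noteq> {}" "h \<noteq> {}"
  shows "\<exists>d\<in>clopens X. d \<noteq> {} \<and> d \<subseteq> c \<and> \<not> h \<subseteq> d"
proof -
  have "range (\<lambda>_::nat. c) \<subseteq> clopens X" "decseq (\<lambda>_::nat. c)" "\<forall>n::nat. c \<noteq> {}"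
    using assms(2,3) by (auto simp: decseq_def)
  from splits_belowD[OF assms(1) this]
  obtain d e where "d \<in> clopens X" "e \<in> clopens X" "d \<noteq> {}" "e \<noteq> {}" "d \<inter> e = {}" "d \<subseteq> c" "e \<subseteq> c"
    by (elim exE conjE) simp
  then have "\<not> h \<subseteq> d \<or> \<not> h \<subseteq> e" using assms(4) by auto
  then show ?thesis
  proof
    assume "\<not> h \<subseteq> d"
    then show ?thesis using \<open>d \<in> clopens X\<close> \<open>d \<noteq> {}\<close> \<open>d \<subseteq> c\<close> by (intro bexI[of _ d] conjI)
  next
    assume "\<not> h \<subseteq> e"
    then show ?thesis using \<open>e \<in> clopens X\<close> \<open>e \<noteq> {}\<close> \<open>e \<subseteq> c\<close> by (intro bexI[of _ e] conjI)
  qed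
qed

text \<open>\<open>p\<close> is shrunk once for every \<open>n\<close>, each time to a set that does
  not contain \<open>h n\<close>; a common lower bound contains none of them.\<close>

lemma splits_below_not_covering:
  assumes X: "splits_below X" "p \<in> clopens X" "p \<noteq> {}" and h: "\<And>n::nat. h n \<noteq> {}"
  obtains e where "e \<in> clopens X" "e \<noteq> {}" "e \<subseteq> p" "\<And>n. \<not> h n \<subseteq> e"
proof -
  have "\<exists>a. \<forall>n. (a n \<in> clopens X \<and> a n \<noteq> {} \<and> a n \<subseteq> p) \<and> (a (Suc n) \<subseteq> a n \<and> \<not> h n \<subseteq> a (Suc n))"
  proof (rule dependent_nat_choice)
    show "\<exists>c. c \<in> clopens X \<and> c \<noteq> {} \<and> c \<subseteq> p" using X by blast
    fix c n assume c: "c \<in> clopens X \<and> c \<noteq> {} \<and> c \<subseteq> p"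
    then show "\<exists>d. (d \<in> clopens X \<and> d \<noteq> {} \<and> d \<subseteq> p) \<and> d \<subseteq> c \<and> \<not> h n \<subseteq> d"
      using splits_below_half[OF X(1), of c "h n"] h by blast
  qed
  then obtain a where a: "\<And>n. a n \<in> clopens X" "\<And>n. a n \<noteq> {}" "\<And>n. a n \<subseteq> p"
      "\<And>n. a (Suc n) \<subseteq> a n" "\<And>n. \<not> h n \<subseteq> a (Suc n)" by blast
  have "range a \<subseteq> clopens X" "decseq a" "\<forall>n. a n \<noteq> {}" using a by (auto simp: decseq_Suc_iff)
  then obtain e where e: "e \<in> clopens X" "e \<noteq> {}" "\<And>n. e \<subseteq> a n"
    using splits_belowD[OF X(1), of a] by fast
  show ?thesis
    using that[OF e(1,2)] e(3) a(3,5) by (metis order_trans)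
qed

text \<open>The sets are chosen one after another. The invariant that the union \<open>E n\<close>
  of those already chosen contains no \<open>g m\<close> leaves room for every later choice, and
  \<open>splits_below_not_covering\<close> supplies a choice that preserves it.\<close>

lemma disjoint_refinement:
  assumes X: "splits_below X" and g: "\<And>n::nat. g n \<in> clopens X" "\<And>n. g n \<noteq> {}"
  obtains e where "\<And>n. e n \<in> clopens X" "\<And>n. e n \<noteq> {}" "\<And>n. e n \<subseteq> g n" "\<And>m n. m \<noteq> n \<Longrightarrow> e m \<inter> e n = {}"
proof -
  have "\<exists>E. \<forall>n. (E n \<in> clopens X \<and> (\<forall>m. \<not> g m \<subseteq> E n)) \<and>
      (E n \<subseteq> E (Suc n) \<and> E (Suc n) - E n \<subseteq> g n \<and> E (Suc n) - E n \<noteq> {})"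
  proof (rule dependent_nat_choice)
    show "\<exists>E. E \<in> clopens X \<and> (\<forall>m. \<not> g m \<subseteq> E)" using g(2) clopens_empty by blast
    fix E n assume E: "E \<in> clopens X \<and> (\<forall>m. \<not> g m \<subseteq> E)"
    then have "g n - E \<in> clopens X" "g n - E \<noteq> {}" "\<And>m. g m - E \<noteq> {}"
      using g by (auto intro: clopens_Diff)
    then obtain e where e: "e \<in> clopens X" "e \<noteq> {}" "e \<subseteq> g n - E" "\<And>m. \<not> g m - E \<subseteq> e"
      using splits_below_not_covering[OF X, of "g n - E" "\<lambda>m. g m - E"] by metis
    show "\<exists>E'. (E' \<in> clopens X \<and> (\<forall>m. \<not> g m \<subseteq> E')) \<and> E \<subseteq> E' \<and> E' - E \<subseteq> g n \<and> E' - E \<noteq> {}"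
      using e E by (intro exI[of _ "E \<union> e"]) (auto intro!: clopens_Un)
  qed
  then obtain E where E: "\<And>n. E n \<in> clopens X" "\<And>n. E n \<subseteq> E (Suc n)" "\<And>n. E (Suc n) - E n \<subseteq> g n"
      "\<And>n. E (Suc n) - E n \<noteq> {}" by blast
  have mono: "E m \<subseteq> E n" if "m \<le> n" for m n using E(2) that by (rule lift_Suc_mono_le)
  have disj: "(E (Suc m) - E m) \<inter> (E (Suc n) - E n) = {}" if "m < n" for m n
    using mono[of "Suc m" n] that by auto
  show ?thesis
  proof (rule that[of "\<lambda>n. E (Suc n) - E n"])
    show "(E (Suc m) - E m) \<inter> (E (Suc n) - E n) = {}" if "m \<noteq> n" for m n
      using disj[of m n] disj[of n m] that by (cases "m < n") (auto simp: Int_commute)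
  qed (use E in \<open>auto intro: clopens_Diff\<close>)
qed

text \<open>Provides a place in \<open>u'\<close> where the image of \<open>a\<close> may have a
  nonempty trace. Finitely many \<open>q\<close> disjoint from \<open>a\<close> cannot cover
  \<open>u\<close>, a fact that the partial isomorphism carries over to \<open>Y\<close>;
  \<open>splits_below_avoid\<close> passes to countably many.\<close>

lemma partial_clopen_iso_avoid:
  assumes R: "partial_clopen_iso X Y R" "countable R" and Y: "splits_below Y"
    and u: "(u, u') \<in> R" "u \<inter> a \<noteq> {}"
  obtains c where "c \<in> clopens Y" "c \<noteq> {}" "c \<subseteq> u'" "\<And>q q'. (q, q') \<in> R \<Longrightarrow> q \<inter> a = {} \<Longrightarrow> c \<inter> q' = {}"
proof -
  define Q where "Q = {z \<in> R. fst z \<inter> a = {}}"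
  have Q: "countable Q" "Q \<noteq> {}" using R(2) partial_clopen_isoD(4)[OF R(1)] by (auto simp: Q_def)
  define z where "z = from_nat_into Q"
  have z: "z n \<in> Q" "range z = Q" for n
    using from_nat_into[OF Q(2)] range_from_nat_into[OF Q(2,1)] by (auto simp: z_def)
  have zR: "(fst (z n), snd (z n)) \<in> R" "fst (z n) \<inter> a = {}" for n using z(1) by (auto simp: Q_def)
  have "u' - (\<Union>i\<le>n. snd (z i)) \<noteq> {}" for n
  proof -
    have "((\<Union>i\<le>n. fst (z i)), (\<Union>i\<le>n. snd (z i))) \<in> R"
      using zR(1) by (intro partial_clopen_iso_UN[OF R(1)]) auto
    then have "(u - (\<Union>i\<le>n. fst (z i)), u' - (\<Union>i\<le>n. snd (z i))) \<in> R"
      using partial_clopen_isoD(5)[OF R(1) u(1)] by blast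
    moreover have "u - (\<Union>i\<le>n. fst (z i)) \<noteq> {}" using u(2) zR(2) by blast
    ultimately show ?thesis using partial_clopen_isoD(7)[OF R(1)] by metis
  qed
  then obtain c where c: "c \<in> clopens Y" "c \<noteq> {}" "c \<subseteq> u'" "\<And>n. c \<inter> snd (z n) = {}"
    using splits_below_avoid[OF Y, of u' "\<lambda>n. snd (z n)"] partial_clopen_isoD(2)[OF R(1)] u(1) zR(1) by metis
  show ?thesis
  proof (rule that[OF c(1-3)])
    fix q q' assume "(q, q') \<in> R" "q \<inter> a = {}"
    then have "(q, q') \<in> range z" using z(2) by (simp add: Q_def)
    then obtain n where "(q, q') = z n" by blast
    then show "c \<inter> q' = {}" using c(4)[of n] by (metis snd_conv)
  qed
qed

text \<open>The image \<open>b\<close> of \<open>a\<close> has to satisfy, for every pair of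
  \<open>R\<close>, that \<open>u'\<close> meets \<open>b\<close> exactly when \<open>u\<close>
  meets \<open>a\<close>, and that \<open>u'\<close> lies in \<open>b\<close> exactly when
  \<open>u\<close> lies in \<open>a\<close>. Putting the images of sets inside \<open>a\<close> into
  \<open>b\<close> and keeping the images of sets disjoint from \<open>a\<close> off it settles one
  direction of each. The other directions need nonempty clopen witnesses in \<open>u'\<close> that
  go into \<open>b\<close> or stay off it. Once the countably many witnesses are made disjoint, all
  demands amount to two orthogonal countable families, and countable separation yields
  \<open>b\<close>.\<close>

lemma partial_clopen_iso_extend:
  assumes R: "partial_clopen_iso X Y R" "countable R"
    and Y: "splits_below Y" "countably_separated Y" "topspace Y \<noteq> {}" and a: "a \<in> clopens X"
  obtains R' where "partial_clopen_iso X Y R'" "countable R'" "R \<subseteq> R'" "a \<in> Domain R'"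
proof -
  note D = partial_clopen_isoD[OF R(1)]
  have sub: "u \<subseteq> topspace X" if "(u, u') \<in> R" for u u' using D(1)[OF that] by (rule clopens_subset)
  \<comment> \<open>If \<open>fst w\<close> misses \<open>a\<close>, any nonempty set counts as
    good: the disjoint refinement needs a nonempty set at every index, and these dummies are left
    out of \<open>A\<close> and \<open>B\<close>.\<close>
  define good where "good a w c \<longleftrightarrow> c \<in> clopens Y \<and> c \<noteq> {} \<and> (fst w \<inter> a \<noteq> {} \<longrightarrow>
      c \<subseteq> snd w \<and> (\<forall>q q'. (q, q') \<in> R \<and> q \<inter> a = {} \<longrightarrow> c \<inter> q' = {}))" for a and w :: "'a set \<times> 'b set" and c
  have goodD: "c \<subseteq> snd w \<and> (\<forall>q q'. (q, q') \<in> R \<and> q \<inter> a = {} \<longrightarrow> c \<inter> q' = {})"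
    if "good a w c" "fst w \<inter> a \<noteq> {}" for a w c
    using that by (simp add: good_def)
  have ex: "\<exists>c. good a w c" if w: "w \<in> R" for a w
  proof (cases "fst w \<inter> a = {}")
    case True then show ?thesis using Y(3) clopens_topspace[of Y] unfolding good_def by blast
  next
    case False
    have "(fst w, snd w) \<in> R" using w by simp
    from partial_clopen_iso_avoid[OF R Y(1) this False] show ?thesis unfolding good_def by metis
  qed
  have Rne: "R \<noteq> {}" using D(4) by blast
  define r where "r = from_nat_into R"
  have r: "r n \<in> R" "range r = R" for n
    using from_nat_into[OF Rne] range_from_nat_into[OF Rne R(2)] by (auto simp: r_def)
  define a2 where "a2 = topspace X - a"
  \<comment> \<open>Even indices serve the witnesses for \<open>a\<close>, odd ones those for its
    complement, so that one refinement makes all of them disjoint.\<close>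
  define g where "g n = (SOME c. good (if even n then a else a2) (r (n div 2)) c)" for n
  have g: "good (if even n then a else a2) (r (n div 2)) (g n)" for n
    unfolding g_def by (rule someI_ex[OF ex[OF r(1)]])
  obtain e where e: "\<And>n. e n \<in> clopens Y" "\<And>n. e n \<noteq> {}" "\<And>n. e n \<subseteq> g n" "\<And>m n. m \<noteq> n \<Longrightarrow> e m \<inter> e n = {}"
    using disjoint_refinement[OF Y(1), of g] g unfolding good_def by metis
  define A where "A = {u'. \<exists>u. (u, u') \<in> R \<and> u \<subseteq> a} \<union> {e (2 * n) | n. fst (r n) \<inter> a \<noteq> {}}"
  define B where "B = {u'. \<exists>u. (u, u') \<in> R \<and> u \<inter> a = {}} \<union> {e (2 * n + 1) | n. \<not> fst (r n) \<subseteq> a}"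
  have g1: "e (2 * n) \<subseteq> snd (r n)" "\<And>q q'. (q, q') \<in> R \<Longrightarrow> q \<inter> a = {} \<Longrightarrow> e (2 * n) \<inter> q' = {}"
    if "fst (r n) \<inter> a \<noteq> {}" for n
  proof -
    have "(if even (2 * n) then a else a2) = a" "(2 * n) div 2 = n" by simp_all
    then have *: "g (2 * n) \<subseteq> snd (r n)" "\<And>q q'. (q, q') \<in> R \<Longrightarrow> q \<inter> a = {} \<Longrightarrow> g (2 * n) \<inter> q' = {}"
      using goodD[of a "r n" "g (2 * n)"] g[of "2 * n"] that by simp_all
    show "e (2 * n) \<subseteq> snd (r n)" using *(1) e(3) by blast
    show "e (2 * n) \<inter> q' = {}" if "(q, q') \<in> R" "q \<inter> a = {}" for q q' using *(2)[OF that] e(3) by blast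
  qed
  have g2: "e (2 * n + 1) \<subseteq> snd (r n)" "\<And>q q'. (q, q') \<in> R \<Longrightarrow> q \<subseteq> a \<Longrightarrow> e (2 * n + 1) \<inter> q' = {}"
    if "\<not> fst (r n) \<subseteq> a" for n
  proof -
    have "fst (r n) \<inter> a2 \<noteq> {}" using that sub[of "fst (r n)" "snd (r n)"] r(1)[of n] by (auto simp: a2_def)
    moreover have "(if even (2 * n + 1) then a else a2) = a2" "(2 * n + 1) div 2 = n" by simp_all
    ultimately have *: "g (2 * n + 1) \<subseteq> snd (r n)" "\<And>q q'. (q, q') \<in> R \<Longrightarrow> q \<inter> a2 = {} \<Longrightarrow> g (2 * n + 1) \<inter> q' = {}"
      using goodD[of a2 "r n" "g (2 * n + 1)"] g[of "2 * n + 1"] by simp_all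
    show "e (2 * n + 1) \<subseteq> snd (r n)" using *(1) e(3) by blast
    fix q q' assume q: "(q, q') \<in> R" "q \<subseteq> a"
    then have "q \<inter> a2 = {}" by (auto simp: a2_def)
    then show "e (2 * n + 1) \<inter> q' = {}" using *(2)[OF q(1)] e(3) by blast
  qed
  have cnt: "countable A" "countable B"
  proof -
    have "A \<subseteq> snd ` R \<union> range e" "B \<subseteq> snd ` R \<union> range e" by (force simp: A_def B_def)+
    moreover have "countable (snd ` R \<union> range e)" using R(2) by simp
    ultimately show "countable A" "countable B" using countable_subset by blast+
  qed
  have "A \<subseteq> clopens Y" "B \<subseteq> clopens Y" using D(2) e(1) by (auto simp: A_def B_def)
  moreover have "S \<inter> T = {}" if "S \<in> A" "T \<in> B" for S T
  proof -
    have 1: "u' \<inter> v' = {}" if "(u, u') \<in> R" "u \<subseteq> a" "(v, v') \<in> R" "v \<inter> a = {}" for u u' v v'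
    proof -
      have "(u - (u - v), u' - (u' - v')) \<in> R" using that D(5) by blast
      moreover have "u - (u - v) = {}" using that by blast
      ultimately have "u' - (u' - v') = {}" using D(7) by metis
      then show ?thesis by blast
    qed
    have 2: "e (2 * m) \<inter> e (2 * n + 1) = {}" for m n by (rule e(4)) presburger
    have S: "(\<exists>u. (u, S) \<in> R \<and> u \<subseteq> a) \<or> (\<exists>n. S = e (2 * n) \<and> fst (r n) \<inter> a \<noteq> {})"
      using that(1) unfolding A_def by simp
    have T: "(\<exists>u. (u, T) \<in> R \<and> u \<inter> a = {}) \<or> (\<exists>n. T = e (2 * n + 1) \<and> \<not> fst (r n) \<subseteq> a)"
      using that(2) unfolding B_def by simp
    show ?thesis using S
    proof (elim disjE exE conjE)
      fix u assume u: "(u, S) \<in> R" "u \<subseteq> a"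
      from T show ?thesis
      proof (elim disjE exE conjE)
        fix v assume "(v, T) \<in> R" "v \<inter> a = {}"
        then show ?thesis by (rule 1[OF u])
      next
        fix n assume "T = e (2 * n + 1)" "\<not> fst (r n) \<subseteq> a"
        then show ?thesis using g2(2)[OF _ u] by (simp add: Int_commute)
      qed
    next
      fix m assume m: "S = e (2 * m)" "fst (r m) \<inter> a \<noteq> {}"
      from T show ?thesis
      proof (elim disjE exE conjE)
        fix v assume "(v, T) \<in> R" "v \<inter> a = {}"
        then show ?thesis using g1(2)[OF m(2)] m(1) by simp
      next
        fix n assume "T = e (2 * n + 1)"
        then show ?thesis using 2 m(1) by simp
      qed
    qed
  qed
  ultimately obtain b where b: "b \<in> clopens Y" "\<And>S. S \<in> A \<Longrightarrow> S \<subseteq> b" "\<And>S. S \<in> B \<Longrightarrow> S \<inter> b = {}"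
    using countably_separated_countable[OF Y(2) cnt] by metis
  have inter: "u \<inter> a = {} \<longleftrightarrow> u' \<inter> b = {}" if u: "(u, u') \<in> R" for u u'
  proof
    assume "u \<inter> a = {}"
    then have "u' \<in> B" using u by (auto simp: B_def)
    then show "u' \<inter> b = {}" by (rule b(3))
  next
    assume L: "u' \<inter> b = {}"
    show "u \<inter> a = {}"
    proof (rule ccontr)
      assume ne: "u \<inter> a \<noteq> {}"
      obtain n where n: "r n = (u, u')" using u r(2) by (metis imageE)
      then have "fst (r n) \<inter> a \<noteq> {}" "snd (r n) = u'" using ne by simp_all
      then have "e (2 * n) \<in> A" unfolding A_def by (intro UnI2 CollectI exI[of _ n] conjI refl)
      moreover have "e (2 * n) \<subseteq> u'" using g1(1)[of n] \<open>fst (r n) \<inter> a \<noteq> {}\<close> \<open>snd (r n) = u'\<close> by simp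
      ultimately show False using b(2)[of "e (2 * n)"] e(2)[of "2 * n"] L by auto
    qed
  qed
  have diff: "u - a = {} \<longleftrightarrow> u' - b = {}" if u: "(u, u') \<in> R" for u u'
  proof
    assume "u - a = {}"
    then have "u' \<in> A" using u by (auto simp: A_def)
    then show "u' - b = {}" using b(2) by blast
  next
    assume L: "u' - b = {}"
    show "u - a = {}"
    proof (rule ccontr)
      assume ne: "u - a \<noteq> {}"
      obtain n where n: "r n = (u, u')" using u r(2) by (metis imageE)
      then have "\<not> fst (r n) \<subseteq> a" "snd (r n) = u'" using ne by auto
      then have "e (2 * n + 1) \<in> B" unfolding B_def by (intro UnI2 CollectI exI[of _ n] conjI refl)
      moreover have "e (2 * n + 1) \<subseteq> u'" using g2(1)[of n] \<open>\<not> fst (r n) \<subseteq> a\<close> \<open>snd (r n) = u'\<close> by simp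
      ultimately show False using b(3)[of "e (2 * n + 1)"] e(2)[of "2 * n + 1"] L by blast
    qed
  qed
  \<comment> \<open>Elements of the algebra generated by \<open>a\<close> and the domain of
    \<open>R\<close> have the form \<open>u \<inter> a \<union> (v - a)\<close>; their images are
    then forced.\<close>
  define m where "m = (\<lambda>((u, u'), (v, v')). (u \<inter> a \<union> (v - a), u' \<inter> b \<union> (v' - b)))"
  define R' where "R' = m ` (R \<times> R)"
  have mem: "(u \<inter> a \<union> (v - a), u' \<inter> b \<union> (v' - b)) \<in> R'" if "(u, u') \<in> R" "(v, v') \<in> R" for u u' v v'
  proof -
    have "((u, u'), (v, v')) \<in> R \<times> R" using that by simp
    from imageI[OF this, of m] show ?thesis by (simp add: R'_def m_def)
  qed
  have elim: "\<exists>u u' v v'. (u, u') \<in> R \<and> (v, v') \<in> R \<and> x = u \<inter> a \<union> (v - a) \<and> x' = u' \<inter> b \<union> (v' - b)"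
    if "(x, x') \<in> R'" for x x' using that by (auto simp: R'_def m_def)
  show ?thesis
  proof
    show "countable R'" using R(2) by (simp add: R'_def)
    show RR: "R \<subseteq> R'"
    proof
      fix w assume w: "w \<in> R"
      obtain u u' where uu: "w = (u, u')" by (cases w)
      have "u \<inter> a \<union> (u - a) = u" "u' \<inter> b \<union> (u' - b) = u'" by auto
      then show "w \<in> R'" using mem[of u u' u u'] w uu by simp
    qed
    have "topspace X \<inter> a \<union> ({} - a) = a" using clopens_subset[OF a] by auto
    then have "(a, topspace Y \<inter> b \<union> ({} - b)) \<in> R'" using mem[OF D(3) D(4)] by simp
    then show "a \<in> Domain R'" by blast
    show "partial_clopen_iso X Y R'" unfolding partial_clopen_iso_def
    proof (intro conjI allI impI; (elim conjE)?)
      show "R' \<subseteq> clopens X \<times> clopens Y"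
        using D(1,2) a b(1) by (auto simp: R'_def m_def intro!: clopens_intros)
      show "(topspace X, topspace Y) \<in> R'" using RR D(3) by blast
      show "x = {} \<longleftrightarrow> x' = {}" if "(x, x') \<in> R'" for x x'
        using elim[OF that] inter diff by (elim exE conjE) simp
      fix x x' y y' assume "(x, x') \<in> R'" "(y, y') \<in> R'"
      then obtain u u' v v' s s' t t' where *: "(u, u') \<in> R" "(v, v') \<in> R" "x = u \<inter> a \<union> (v - a)" "x' = u' \<inter> b \<union> (v' - b)"
        "(s, s') \<in> R" "(t, t') \<in> R" "y = s \<inter> a \<union> (t - a)" "y' = s' \<inter> b \<union> (t' - b)"
        using elim by meson
      have "x - y = (u - s) \<inter> a \<union> ((v - t) - a)" "x' - y' = (u' - s') \<inter> b \<union> ((v' - t') - b)"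
        "x \<union> y = (u \<union> s) \<inter> a \<union> ((v \<union> t) - a)" "x' \<union> y' = (u' \<union> s') \<inter> b \<union> ((v' \<union> t') - b)"
        unfolding * by blast+
      then show "(x - y, x' - y') \<in> R'" "(x \<union> y, x' \<union> y') \<in> R'"
        using mem D(5,6) *(1,2,5,6) by metis+
    qed
  qed
qed

lemma countable_converse:
  assumes "countable R"
  shows "countable (R\<inverse>)"
proof -
  have "R\<inverse> = (\<lambda>(x, y). (y, x)) ` R" by auto
  then show ?thesis using assms by simp
qed

lemma partial_clopen_iso_extend_sum:
  assumes R: "partial_clopen_iso X Y R" "countable R"
    and X: "splits_below X" "countably_separated X" "topspace X \<noteq> {}"
    and Y: "splits_below Y" "countably_separated Y" "topspace Y \<noteq> {}"
    and t: "t \<in> clopens X <+> clopens Y"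
  shows "\<exists>R'. partial_clopen_iso X Y R' \<and> countable R' \<and> R \<subseteq> R' \<and>
    (\<forall>a. t = Inl a \<longrightarrow> a \<in> Domain R') \<and> (\<forall>b. t = Inr b \<longrightarrow> b \<in> Range R')"
proof (cases t)
  case (Inl a)
  then have "a \<in> clopens X" using t by auto
  obtain R' where "partial_clopen_iso X Y R'" "countable R'" "R \<subseteq> R'" "a \<in> Domain R'"
    by (rule partial_clopen_iso_extend[OF R Y \<open>a \<in> clopens X\<close>])
  then show ?thesis using Inl by (intro exI[of _ R']) simp
next
  case (Inr b)
  then have "b \<in> clopens Y" using t by auto
  moreover have "partial_clopen_iso Y X (R\<inverse>)" using R(1) by (rule partial_clopen_iso_converse)
  moreover have "countable (R\<inverse>)" using R(2) by (rule countable_converse)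
  ultimately obtain S where S: "partial_clopen_iso Y X S" "countable S" "R\<inverse> \<subseteq> S" "b \<in> Domain S"
    using partial_clopen_iso_extend[OF _ _ X] by metis
  have "partial_clopen_iso X Y (S\<inverse>)" "countable (S\<inverse>)" "R \<subseteq> S\<inverse>" "b \<in> Range (S\<inverse>)"
    using S partial_clopen_iso_converse[OF S(1)] countable_converse by auto
  then show ?thesis using Inr by (intro exI[of _ "S\<inverse>"]) simp
qed

text \<open>Both clopen algebras are well-ordered together, as a disjoint sum, by a cardinal of at
  most omega_1. Every proper initial segment is then countable, so the partial isomorphism reached
  at each stage is countable and can take in one further element on either side. This is where the
  bound omega_1, and with it CH, is needed.\<close>

lemma total_clopen_iso:
  assumes X: "splits_below X" "countably_separated X" "topspace X \<noteq> {}"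
    and Y: "splits_below Y" "countably_separated Y" "topspace Y \<noteq> {}"
    and card: "|clopens X| \<le>o cardSuc natLeq" "|clopens Y| \<le>o cardSuc natLeq"
  obtains R where "partial_clopen_iso X Y R" "Domain R = clopens X" "Range R = clopens Y"
proof -
  define T where "T = clopens X <+> clopens Y"
  define r where "r = |T|"
  have Cr: "Card_order r" and Fr: "Field r = T" unfolding r_def by (rule card_of_Card_order, rule Field_card_of)
  have wo: "Well_order r" using Cr by (simp add: card_order_on_def)
  have infS: "infinite (Field (cardSuc natLeq))"
    using natLeq_Cinfinite Cinfinite_cardSuc unfolding cinfinite_def by blast
  have "r \<le>o cardSuc natLeq" unfolding r_def T_def
    using infS card cardSuc_Card_order[OF natLeq_Card_order] by (intro card_of_Plus_ordLeq_infinite_Field)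
  have segs: "countable (underS r t)" if "t \<in> T" for t
  proof -
    have "|underS r t| <o r" using card_of_underS[OF Cr] that Fr by blast
    then have "|underS r t| <o cardSuc natLeq" using \<open>r \<le>o cardSuc natLeq\<close> ordLess_ordLeq_trans by blast
    then have "|underS r t| \<le>o natLeq"
      using cardSuc_ordLeq_ordLess[OF natLeq_Card_order card_of_Card_order] by blast
    then show ?thesis by (simp add: countable_card_le_natLeq)
  qed
  define step where "step t U = (SOME R. partial_clopen_iso X Y R \<and> countable R \<and> U \<subseteq> R \<and>
      (\<forall>a. t = Inl a \<longrightarrow> a \<in> Domain R) \<and> (\<forall>b. t = Inr b \<longrightarrow> b \<in> Range R))" for t U
  \<comment> \<open>The least element has no predecessors; the isomorphism of the trivial algebras
    makes the union a partial isomorphism there too.\<close>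
  define base where "base = {({}, {}), (topspace X, topspace Y)}"
  have base: "partial_clopen_iso X Y base" "countable base"
    unfolding partial_clopen_iso_def base_def using X(3) Y(3) by (auto simp: clopens_empty clopens_topspace)
  define H where "H = (\<lambda>f t. step t (base \<union> (\<Union>s\<in>underS r t. f s)))"
  define F where "F = wfrec (r - Id) H"
  have wf: "wf (r - Id)" using wo by (simp add: well_order_on_def)
  have F: "F t = step t (base \<union> (\<Union>s\<in>underS r t. F s))" for t
  proof -
    have "F t = H (cut F (r - Id) t) t" unfolding F_def by (rule wfrec[OF wf])
    also have "\<dots> = step t (base \<union> (\<Union>s\<in>underS r t. F s))"
      unfolding H_def by (intro arg_cong[where f="step t"] arg_cong2[where f="(\<union>)"] refl SUP_cong)
        (auto simp: cut_def underS_def)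
    finally show ?thesis .
  qed
  have tot: "s = t \<or> s \<in> underS r t \<or> t \<in> underS r s" if "s \<in> T" "t \<in> T" for s t
    using wo that Fr unfolding well_order_on_def linear_order_on_def total_on_def underS_def by blast
  have main: "partial_clopen_iso X Y (F t) \<and> countable (F t) \<and> base \<union> (\<Union>s\<in>underS r t. F s) \<subseteq> F t \<and>
      (\<forall>a. t = Inl a \<longrightarrow> a \<in> Domain (F t)) \<and> (\<forall>b. t = Inr b \<longrightarrow> b \<in> Range (F t))" if "t \<in> T" for t
    using that
  proof (induction t rule: wf_induct_rule[OF wf])
    case (1 t)
    have sub: "s \<in> T" "(s, t) \<in> r - Id" if "s \<in> underS r t" for s
      using that Fr by (auto simp: underS_def Field_def)
    have IH: "partial_clopen_iso X Y (F s)" "countable (F s)" "base \<union> (\<Union>q\<in>underS r s. F q) \<subseteq> F s"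
      if "s \<in> underS r t" for s using 1(1)[OF sub(2) sub(1)] that by blast+
    define U where "U = \<Union>(insert base (F ` underS r t))"
    have "partial_clopen_iso X Y U" unfolding U_def
    proof (rule partial_clopen_iso_Union)
      show "partial_clopen_iso X Y R" if "R \<in> insert base (F ` underS r t)" for R
        using that base IH(1) by blast
      fix R S assume R: "R \<in> insert base (F ` underS r t)" and S: "S \<in> insert base (F ` underS r t)"
      show "R \<subseteq> S \<or> S \<subseteq> R"
      proof (cases "R = base \<or> S = base")
        case True then show ?thesis using R S IH(3) by blast
      next
        case False
        then obtain p q where pq: "p \<in> underS r t" "R = F p" "q \<in> underS r t" "S = F q" using R S by blast
        then show ?thesis using tot[OF sub(1) sub(1), OF pq(1,3)] IH(3) by blast
      qed
    qed simp
    moreover have "countable U" unfolding U_def using segs[OF 1(2)] base IH(2) by auto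
    ultimately have "\<exists>R. partial_clopen_iso X Y R \<and> countable R \<and> U \<subseteq> R \<and>
      (\<forall>a. t = Inl a \<longrightarrow> a \<in> Domain R) \<and> (\<forall>b. t = Inr b \<longrightarrow> b \<in> Range R)"
      by (rule partial_clopen_iso_extend_sum[OF _ _ X Y 1(2)[unfolded T_def]])
    from someI_ex[OF this] have *: "partial_clopen_iso X Y (step t U) \<and> countable (step t U) \<and> U \<subseteq> step t U \<and>
      (\<forall>a. t = Inl a \<longrightarrow> a \<in> Domain (step t U)) \<and> (\<forall>b. t = Inr b \<longrightarrow> b \<in> Range (step t U))"
      unfolding step_def .
    have U: "base \<union> (\<Union>s\<in>underS r t. F s) = U" by (simp add: U_def)
    have "F t = step t U" using F[of t] unfolding U .
    then show ?case unfolding U using * by metis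
  qed
  define R where "R = \<Union>(insert base (F ` T))"
  have iso: "partial_clopen_iso X Y R" unfolding R_def
  proof (rule partial_clopen_iso_Union)
    show "partial_clopen_iso X Y R" if "R \<in> insert base (F ` T)" for R
      using that base main by blast
    fix R S assume R: "R \<in> insert base (F ` T)" and S: "S \<in> insert base (F ` T)"
    show "R \<subseteq> S \<or> S \<subseteq> R"
    proof (cases "R = base \<or> S = base")
      case True then show ?thesis using R S main by blast
    next
      case False
      then obtain p q where pq: "p \<in> T" "R = F p" "q \<in> T" "S = F q" using R S by blast
      then show ?thesis using tot[OF pq(1,3)] main by blast
    qed
  qed simp
  have "Domain R = clopens X"
  proof
    show "Domain R \<subseteq> clopens X" using partial_clopen_isoD(1)[OF iso] by blast
    show "clopens X \<subseteq> Domain R"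
    proof
      fix a assume "a \<in> clopens X"
      then have "Inl a \<in> T" unfolding T_def by (rule InlI)
      then have "a \<in> Domain (F (Inl a))" "F (Inl a) \<subseteq> R" using main by (blast, auto simp: R_def)
      then show "a \<in> Domain R" by blast
    qed
  qed
  moreover have "Range R = clopens Y"
  proof
    show "Range R \<subseteq> clopens Y" using partial_clopen_isoD(2)[OF iso] by blast
    show "clopens Y \<subseteq> Range R"
    proof
      fix b assume "b \<in> clopens Y"
      then have "Inr b \<in> T" unfolding T_def by (rule InrI)
      then have "b \<in> Range (F (Inr b))" "F (Inr b) \<subseteq> R" using main by (blast, auto simp: R_def)
      then show "b \<in> Range R" by blast
    qed
  qed
  ultimately show ?thesis using that iso by blast
qed

section \<open>Stone duality for isomorphisms of clopen algebras\<close>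

text \<open>The Stone dual of \<open>R\<close> on points: the clopen sets containing the value are
  to be the images of those containing \<open>x\<close>.\<close>

definition clopen_dual :: "'b topology \<Rightarrow> ('a set \<times> 'b set) set \<Rightarrow> 'a \<Rightarrow> 'b"
  where "clopen_dual Y R x = (SOME y. y \<in> topspace Y \<and> (\<forall>a b. (a, b) \<in> R \<longrightarrow> (x \<in> a \<longleftrightarrow> y \<in> b)))"

text \<open>The images of the clopen sets containing \<open>x\<close> have the finite intersection
  property, since \<open>R\<close> preserves finite intersections and nonemptiness; compactness
  gives a point in all of them. Complements show that it avoids the images of the remaining
  sets.\<close>

lemma clopen_dual:
  assumes R: "partial_clopen_iso X Y R" and Y: "compact_space Y" and x: "x \<in> topspace X"
  shows "clopen_dual Y R x \<in> topspace Y" "(a, b) \<in> R \<Longrightarrow> x \<in> a \<longleftrightarrow> clopen_dual Y R x \<in> b"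
proof -
  note D = partial_clopen_isoD[OF R]
  define \<U> where "\<U> = {b. \<exists>a. (a, b) \<in> R \<and> x \<in> a}"
  have int: "(a \<inter> c, b \<inter> d) \<in> R" if "(a, b) \<in> R" "(c, d) \<in> R" for a b c d
  proof -
    have "(a - (a - c), b - (b - d)) \<in> R" using D(5) that by blast
    moreover have "a - (a - c) = a \<inter> c" "b - (b - d) = b \<inter> d" by blast+
    ultimately show ?thesis by simp
  qed
  have fin: "\<exists>a. (a, topspace Y \<inter> \<Inter>F) \<in> R \<and> x \<in> a" if "finite F" "F \<subseteq> \<U>" for F
    using that
  proof (induction F rule: finite_induct)
    case empty then show ?case using D(3) x by auto
  next
    case (insert b F)
    then obtain a a' where "(a, topspace Y \<inter> \<Inter>F) \<in> R" "x \<in> a" "(a', b) \<in> R" "x \<in> a'" by (auto simp: \<U>_def)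
    then have "(a' \<inter> a, b \<inter> (topspace Y \<inter> \<Inter>F)) \<in> R" "x \<in> a' \<inter> a" using int by auto
    then show ?case by (metis Inter_insert inf_left_commute)
  qed
  have "(\<Inter>\<U>) \<noteq> {}"
  proof -
    have "\<forall>C\<in>\<U>. closedin Y C" using D(2) by (auto simp: \<U>_def clopens_def)
    moreover have "\<forall>F. finite F \<and> F \<subseteq> \<U> \<longrightarrow> \<Inter>F \<noteq> {}"
    proof (intro allI impI, elim conjE)
      fix F assume "finite F" "F \<subseteq> \<U>"
      then obtain a where "(a, topspace Y \<inter> \<Inter>F) \<in> R" "x \<in> a" using fin by blast
      then have "topspace Y \<inter> \<Inter>F \<noteq> {}" using D(7) by (metis empty_iff)
      then show "\<Inter>F \<noteq> {}" by blast
    qed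
    ultimately show ?thesis using Y[unfolded compact_space_fip, THEN spec[of _ \<U>]] by blast
  qed
  then obtain y where y: "\<And>b. b \<in> \<U> \<Longrightarrow> y \<in> b" by blast
  have yY: "y \<in> topspace Y" using y D(3) x by (auto simp: \<U>_def)
  have "x \<in> a \<longleftrightarrow> y \<in> b" if "(a, b) \<in> R" for a b
  proof
    show "x \<in> a \<Longrightarrow> y \<in> b" using y that by (auto simp: \<U>_def)
    assume "y \<in> b"
    show "x \<in> a"
    proof (rule ccontr)
      assume "x \<notin> a"
      moreover have "(topspace X - a, topspace Y - b) \<in> R" using D(5)[OF D(3) that] .
      ultimately have "topspace Y - b \<in> \<U>" using x by (auto simp: \<U>_def)
      then show False using y \<open>y \<in> b\<close> by blast
    qed
  qed
  then have "y \<in> topspace Y \<and> (\<forall>a b. (a, b) \<in> R \<longrightarrow> (x \<in> a \<longleftrightarrow> y \<in> b))" using yY by blast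
  then have "clopen_dual Y R x \<in> topspace Y \<and> (\<forall>a b. (a, b) \<in> R \<longrightarrow> (x \<in> a \<longleftrightarrow> clopen_dual Y R x \<in> b))"
    unfolding clopen_dual_def by (rule someI)
  then show "clopen_dual Y R x \<in> topspace Y" "(a, b) \<in> R \<Longrightarrow> x \<in> a \<longleftrightarrow> clopen_dual Y R x \<in> b" by blast+
qed

lemma clopens_separate_points:
  assumes "Hausdorff_space X" "zero_dimensional X" "x \<in> topspace X" "y \<in> topspace X"
    and "\<And>c. c \<in> clopens X \<Longrightarrow> x \<in> c \<longleftrightarrow> y \<in> c"
  shows "x = y"
proof (rule ccontr)
  assume "x \<noteq> y"
  then obtain U V where UV: "openin X U" "openin X V" "x \<in> U" "y \<in> V" "disjnt U V"
    using assms(1,3,4) unfolding Hausdorff_space_def by metis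
  obtain c where "c \<in> clopens X" "x \<in> c" "c \<subseteq> U" using assms(2) UV unfolding zero_dimensional_iff by blast
  then show False using assms(5) UV(4,5) by (auto simp: disjnt_def)
qed

lemma continuous_map_clopen_dual:
  assumes R: "partial_clopen_iso X Y R" "Range R = clopens Y" and Y: "compact_space Y" "zero_dimensional Y"
  shows "continuous_map X Y (clopen_dual Y R)"
  unfolding continuous_map_def
proof (intro conjI allI impI)
  show "clopen_dual Y R \<in> topspace X \<rightarrow> topspace Y" using clopen_dual(1)[OF R(1) Y(1)] by blast
  fix V assume V: "openin Y V"
  show "openin X {x \<in> topspace X. clopen_dual Y R x \<in> V}"
  proof (subst openin_subopen, intro ballI)
    fix x assume x: "x \<in> {x \<in> topspace X. clopen_dual Y R x \<in> V}"
    then obtain b where b: "b \<in> clopens Y" "clopen_dual Y R x \<in> b" "b \<subseteq> V"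
      using Y(2) V unfolding zero_dimensional_iff by blast
    then obtain a where a: "(a, b) \<in> R" using R(2) by blast
    have "openin X a" "a \<subseteq> topspace X"
      using partial_clopen_isoD(1)[OF R(1) a] clopens_subset by (auto simp: clopens_def)
    then show "\<exists>T. openin X T \<and> x \<in> T \<and> T \<subseteq> {x \<in> topspace X. clopen_dual Y R x \<in> V}"
      using clopen_dual(2)[OF R(1) Y(1) _ a] x b by (intro exI[of _ a]) auto
  qed
qed

lemma clopen_dual_inverse:
  assumes R: "partial_clopen_iso X Y R" "Domain R = clopens X" and X: "compact_space X" "Hausdorff_space X" "zero_dimensional X"
    and Y: "compact_space Y" and x: "x \<in> topspace X"
  shows "clopen_dual X (R\<inverse>) (clopen_dual Y R x) = x"
proof (rule clopens_separate_points[OF X(2,3) _ x])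
  note R' = partial_clopen_iso_converse[OF R(1)]
  note y = clopen_dual(1)[OF R(1) Y x]
  show "clopen_dual X (R\<inverse>) (clopen_dual Y R x) \<in> topspace X" by (rule clopen_dual(1)[OF R' X(1) y])
  fix c assume "c \<in> clopens X"
  then obtain b where b: "(c, b) \<in> R" using R(2) by blast
  then show "clopen_dual X (R\<inverse>) (clopen_dual Y R x) \<in> c \<longleftrightarrow> x \<in> c"
    using clopen_dual(2)[OF R' X(1) y, of b c] clopen_dual(2)[OF R(1) Y x b] by simp
qed

theorem Parovicenko_spaces_homeomorphic:
  assumes CH: "Continuum_Hypothesis" and X: "Parovicenko_space X" and Y: "Parovicenko_space Y"
  shows "X homeomorphic_space Y"
proof -
  have PX: "compact_space X" "Hausdorff_space X" "zero_dimensional X" "countably_separated X" "splits_below X"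
      "|clopens X| =o ctwo ^c natLeq"
    and PY: "compact_space Y" "Hausdorff_space Y" "zero_dimensional Y" "countably_separated Y" "splits_below Y"
      "|clopens Y| =o ctwo ^c natLeq"
    using X Y by (auto simp: Parovicenko_space_iff)
  have ne: "topspace Z \<noteq> {}" if "|clopens Z| =o ctwo ^c natLeq" for Z :: "'z topology"
  proof
    assume "topspace Z = {}"
    then have "clopens Z \<subseteq> {{}}" using clopens_subset by blast
    then have "finite (clopens Z)" using finite_subset by blast
    moreover have "infinite (Field (ctwo ^c natLeq))" using Cinfinite_continuum by (simp add: cinfinite_def)
    ultimately show False using that card_of_ordIso_finite_Field Cinfinite_continuum ordIso_symmetric by blast
  qed
  have le: "|clopens X| \<le>o cardSuc natLeq" "|clopens Y| \<le>o cardSuc natLeq"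
    using PX(6) PY(6) CH ordIso_transitive ordIso_imp_ordLeq unfolding Continuum_Hypothesis_def by blast+
  obtain R where R: "partial_clopen_iso X Y R" "Domain R = clopens X" "Range R = clopens Y"
    using total_clopen_iso[OF PX(5,4) ne[OF PX(6)] PY(5,4) ne[OF PY(6)] le] by blast
  note R' = partial_clopen_iso_converse[OF R(1)]
  have "homeomorphic_maps X Y (clopen_dual Y R) (clopen_dual X (R\<inverse>))"
    unfolding homeomorphic_maps_def
  proof (intro conjI ballI)
    show "continuous_map X Y (clopen_dual Y R)" by (rule continuous_map_clopen_dual[OF R(1,3) PY(1,3)])
    show "continuous_map Y X (clopen_dual X (R\<inverse>))"
      by (rule continuous_map_clopen_dual[OF R' _ PX(1,3)]) (simp add: R)
    show "clopen_dual X (R\<inverse>) (clopen_dual Y R x) = x" if "x \<in> topspace X" for x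
      using clopen_dual_inverse[OF R(1,2) PX(1-3) PY(1) that] .
    show "clopen_dual Y R (clopen_dual X (R\<inverse>) y) = y" if "y \<in> topspace Y" for y
      using clopen_dual_inverse[OF R' _ PY(1-3) PX(1) that] R by simp
  qed
  then show ?thesis unfolding homeomorphic_space_def by blast
qed

section \<open>Commuting conjugates in homeomorphism groups\<close>

text \<open>Equivalently, the normal closures of \<open>a\<close> and \<open>b\<close> are
  nontrivial and commute elementwise. Only the group structure is mentioned, so every abstract
  isomorphism preserves the property.\<close>

definition commuting_conjugates :: "('g, 'm) monoid_scheme \<Rightarrow> 'g \<Rightarrow> 'g \<Rightarrow> bool"
  where "commuting_conjugates G a b \<longleftrightarrow> a \<in> carrier G \<and> b \<in> carrier G \<and> a \<noteq> \<one>\<^bsub>G\<^esub> \<and> b \<noteq> \<one>\<^bsub>G\<^esub> \<and>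
    (\<forall>g\<in>carrier G. a \<otimes>\<^bsub>G\<^esub> (g \<otimes>\<^bsub>G\<^esub> b \<otimes>\<^bsub>G\<^esub> inv\<^bsub>G\<^esub> g) = (g \<otimes>\<^bsub>G\<^esub> b \<otimes>\<^bsub>G\<^esub> inv\<^bsub>G\<^esub> g) \<otimes>\<^bsub>G\<^esub> a)"

lemma commuting_conjugates_iso:
  assumes G: "group G" and H: "group H" and iso: "G \<cong> H" and ab: "commuting_conjugates G a b"
  shows "\<exists>a b. commuting_conjugates H a b"
proof -
  interpret G: group G by fact
  interpret H: group H by fact
  obtain \<phi> where \<phi>: "\<phi> \<in> iso G H" using iso by (auto simp: is_iso_def)
  interpret \<phi>: group_hom G H \<phi>
    using \<phi> by unfold_locales (auto simp: iso_def)
  have inj: "inj_on \<phi> (carrier G)" and im: "\<phi> ` carrier G = carrier H"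
    using \<phi> by (auto simp: iso_def bij_betw_def)
  have a: "a \<in> carrier G" "a \<noteq> \<one>\<^bsub>G\<^esub>" and b: "b \<in> carrier G" "b \<noteq> \<one>\<^bsub>G\<^esub>"
    using ab by (auto simp: commuting_conjugates_def)
  have "commuting_conjugates H (\<phi> a) (\<phi> b)" unfolding commuting_conjugates_def
  proof (intro conjI ballI)
    show "\<phi> a \<noteq> \<one>\<^bsub>H\<^esub>" "\<phi> b \<noteq> \<one>\<^bsub>H\<^esub>"
      using inj_onD[OF inj, of a "\<one>\<^bsub>G\<^esub>"] inj_onD[OF inj, of b "\<one>\<^bsub>G\<^esub>"] a b by auto
    fix h assume "h \<in> carrier H"
    then obtain g where g: "g \<in> carrier G" "h = \<phi> g" using im by blast
    have "\<phi> (a \<otimes>\<^bsub>G\<^esub> (g \<otimes>\<^bsub>G\<^esub> b \<otimes>\<^bsub>G\<^esub> inv\<^bsub>G\<^esub> g)) = \<phi> ((g \<otimes>\<^bsub>G\<^esub> b \<otimes>\<^bsub>G\<^esub> inv\<^bsub>G\<^esub> g) \<otimes>\<^bsub>G\<^esub> a)"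
      using ab g(1) by (simp add: commuting_conjugates_def)
    then show "\<phi> a \<otimes>\<^bsub>H\<^esub> (h \<otimes>\<^bsub>H\<^esub> \<phi> b \<otimes>\<^bsub>H\<^esub> inv\<^bsub>H\<^esub> h) = (h \<otimes>\<^bsub>H\<^esub> \<phi> b \<otimes>\<^bsub>H\<^esub> inv\<^bsub>H\<^esub> h) \<otimes>\<^bsub>H\<^esub> \<phi> a"
      using a b g by simp
  qed (use a b in auto)
  then show ?thesis by blast
qed

context group
begin

lemma commute_mult:
  assumes "x \<in> carrier G" "y \<in> carrier G" "z \<in> carrier G" "x \<otimes> y = y \<otimes> x" "x \<otimes> z = z \<otimes> x"
  shows "x \<otimes> (y \<otimes> z) = (y \<otimes> z) \<otimes> x"
proof -
  have "x \<otimes> (y \<otimes> z) = y \<otimes> x \<otimes> z" using assms by (simp add: m_assoc[symmetric])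
  also have "\<dots> = (y \<otimes> z) \<otimes> x" using assms by (simp add: m_assoc)
  finally show ?thesis .
qed

lemma commute_inv:
  assumes "x \<in> carrier G" "y \<in> carrier G" "x \<otimes> y = y \<otimes> x"
  shows "x \<otimes> inv y = inv y \<otimes> x"
proof -
  have "x \<otimes> inv y = inv y \<otimes> (y \<otimes> x) \<otimes> inv y" using assms by (simp add: m_assoc[symmetric])
  also have "\<dots> = inv y \<otimes> (x \<otimes> y) \<otimes> inv y" using assms by simp
  also have "\<dots> = inv y \<otimes> x" using assms(1,2) by (simp add: m_assoc)
  finally show ?thesis .
qed

lemma commute_conj:
  assumes "x \<in> carrier G" "y \<in> carrier G" "f \<in> carrier G" "x \<otimes> (inv f \<otimes> y \<otimes> f) = (inv f \<otimes> y \<otimes> f) \<otimes> x"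
  shows "(f \<otimes> x \<otimes> inv f) \<otimes> y = y \<otimes> (f \<otimes> x \<otimes> inv f)"
proof -
  have "(f \<otimes> x \<otimes> inv f) \<otimes> y = f \<otimes> (x \<otimes> (inv f \<otimes> y \<otimes> f)) \<otimes> inv f"
    using assms(1-3) by (simp add: m_assoc)
  also have "\<dots> = f \<otimes> ((inv f \<otimes> y \<otimes> f) \<otimes> x) \<otimes> inv f" using assms(4) by simp
  also have "\<dots> = y \<otimes> (f \<otimes> x \<otimes> inv f)"
    using assms(1-3) by (simp add: m_assoc[symmetric])
  finally show ?thesis .
qed

text \<open>The elements commuting with every conjugate of \<open>b\<close> form a normal subgroup,
  which contains \<open>a\<close> and hence the commutator of \<open>a\<close> and \<open>f\<close>.
  So this commutator commutes with \<open>b'\<close> and with the conjugate by \<open>h\<close> of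
  its inverse.\<close>

lemma commutators_commute:
  assumes "commuting_conjugates G a b" and f: "f \<in> carrier G" and g: "g \<in> carrier G" and h: "h \<in> carrier G"
    and b': "b' = g \<otimes> b \<otimes> inv g"
  shows "(a \<otimes> (f \<otimes> inv a \<otimes> inv f)) \<otimes> (b' \<otimes> (h \<otimes> inv b' \<otimes> inv h)) =
    (b' \<otimes> (h \<otimes> inv b' \<otimes> inv h)) \<otimes> (a \<otimes> (f \<otimes> inv a \<otimes> inv f))"
proof -
  have a: "a \<in> carrier G" and b: "b \<in> carrier G"
    and ab: "\<And>k. k \<in> carrier G \<Longrightarrow> a \<otimes> (k \<otimes> b \<otimes> inv k) = (k \<otimes> b \<otimes> inv k) \<otimes> a"
    using assms(1) by (auto simp: commuting_conjugates_def)
  define c where "c = a \<otimes> (f \<otimes> inv a \<otimes> inv f)"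
  have c: "c \<in> carrier G" using a f by (simp add: c_def)
  have cb: "c \<otimes> (k \<otimes> b \<otimes> inv k) = (k \<otimes> b \<otimes> inv k) \<otimes> c" if k: "k \<in> carrier G" for k
  proof -
    let ?y = "k \<otimes> b \<otimes> inv k"
    have y: "?y \<in> carrier G" using k b by simp
    have "inv f \<otimes> ?y \<otimes> f = (inv f \<otimes> k) \<otimes> b \<otimes> inv (inv f \<otimes> k)"
      using k b f by (simp add: m_assoc inv_mult_group)
    then have "a \<otimes> (inv f \<otimes> ?y \<otimes> f) = (inv f \<otimes> ?y \<otimes> f) \<otimes> a" using ab[of "inv f \<otimes> k"] k f by simp
    then have "inv a \<otimes> (inv f \<otimes> ?y \<otimes> f) = (inv f \<otimes> ?y \<otimes> f) \<otimes> inv a"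
      using commute_inv[of "inv f \<otimes> ?y \<otimes> f" a] a f y by simp
    then have "(f \<otimes> inv a \<otimes> inv f) \<otimes> ?y = ?y \<otimes> (f \<otimes> inv a \<otimes> inv f)"
      using commute_conj[of "inv a" ?y f] a f y by simp
    then have "?y \<otimes> c = c \<otimes> ?y"
      unfolding c_def using commute_mult[of ?y a "f \<otimes> inv a \<otimes> inv f"] ab[OF k] a f y by simp
    then show ?thesis by simp
  qed
  have b'c: "b' \<in> carrier G" using b g b' by simp
  have "c \<otimes> (h \<otimes> inv b' \<otimes> inv h) = (h \<otimes> inv b' \<otimes> inv h) \<otimes> c"
  proof -
    have "h \<otimes> inv b' \<otimes> inv h = inv ((h \<otimes> g) \<otimes> b \<otimes> inv (h \<otimes> g))"
      using b g h by (simp add: b' m_assoc inv_mult_group)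
    then show ?thesis using commute_inv[of c "(h \<otimes> g) \<otimes> b \<otimes> inv (h \<otimes> g)"] cb[of "h \<otimes> g"] b g h c by simp
  qed
  moreover have "c \<otimes> b' = b' \<otimes> c" using cb[OF g] b' by simp
  ultimately show ?thesis
    using commute_mult[of c b' "h \<otimes> inv b' \<otimes> inv h"] c b'c h unfolding c_def by simp
qed

end

section \<open>Commuting conjugates and displaced clopen sets\<close>

lemma homeo_group_eval:
  assumes f: "f \<in> carrier (homeo_group X)" and x: "x \<in> topspace X"
  shows "f x \<in> topspace X" "g \<in> carrier (homeo_group X) \<Longrightarrow> (g \<otimes>\<^bsub>homeo_group X\<^esub> f) x = g (f x)"
    "\<one>\<^bsub>homeo_group X\<^esub> x = x" "(inv\<^bsub>homeo_group X\<^esub> f) (f x) = x" "f ((inv\<^bsub>homeo_group X\<^esub> f) x) = x"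
proof -
  interpret group "homeo_group X" by (rule group_homeo_group)
  show "f x \<in> topspace X" using f x by (auto simp: carrier_homeo_group Bij_def bij_betw_def)
  show 1: "\<one>\<^bsub>homeo_group X\<^esub> x = x" using x by (simp add: homeo_group_def BijGroup_def)
  show 2: "(g \<otimes>\<^bsub>homeo_group X\<^esub> f) x = g (f x)" if "g \<in> carrier (homeo_group X)" for g
    using that f x by (simp add: mult_homeo_group compose_def)
  show "(inv\<^bsub>homeo_group X\<^esub> f) (f x) = x" using 2[OF inv_closed[OF f]] f 1 by simp
  have "(f \<otimes>\<^bsub>homeo_group X\<^esub> inv\<^bsub>homeo_group X\<^esub> f) x = f ((inv\<^bsub>homeo_group X\<^esub> f) x)"
    using inv_closed[OF f] f x by (simp add: mult_homeo_group compose_def)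
  then show "f ((inv\<^bsub>homeo_group X\<^esub> f) x) = x" using f 1 by simp
qed

lemma homeo_group_eqI:
  assumes "f \<in> carrier (homeo_group X)" "g \<in> carrier (homeo_group X)" "\<And>x. x \<in> topspace X \<Longrightarrow> f x = g x"
  shows "f = g"
  using assms by (intro extensionalityI[of f "topspace X" g]) (auto simp: carrier_homeo_group Bij_def)

lemma homeo_group_clopens:
  assumes "f \<in> carrier (homeo_group X)" "U \<in> clopens X"
  shows "f ` U \<in> clopens X"
proof -
  have "homeomorphic_map X X f" using assms(1) by (simp add: carrier_homeo_group)
  then obtain g where "homeomorphic_maps X X f g" by (auto simp: homeomorphic_map_maps)
  then show ?thesis using homeomorphic_maps_clopens assms(2) by blast
qed

lemma homeo_moves_clopen:
  assumes X: "Hausdorff_space X" "zero_dimensional X" and f: "f \<in> carrier (homeo_group X)" "f \<noteq> \<one>\<^bsub>homeo_group X\<^esub>"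
  obtains U where "U \<in> clopens X" "U \<noteq> {}" "f ` U \<inter> U = {}"
proof -
  interpret group "homeo_group X" by (rule group_homeo_group)
  obtain x where x: "x \<in> topspace X" "f x \<noteq> x"
    using homeo_group_eqI[OF f(1) one_closed] f(2) homeo_group_eval(3)[OF f(1)] by metis
  obtain c where c: "c \<in> clopens X" "x \<in> c" "f x \<notin> c"
    using clopens_separate_points[OF X x(1) homeo_group_eval(1)[OF f(1) x(1)]] x(2)
    by (metis Diff_iff clopens_Diff clopens_topspace homeo_group_eval(1)[OF f(1) x(1)] x(1))
  \<comment> \<open>The points of \<open>c\<close> that \<open>f\<close> sends out of
    \<open>c\<close>; the moved point \<open>x\<close> is one of them.\<close>
  define U where "U = c \<inter> (inv\<^bsub>homeo_group X\<^esub> f) ` (topspace X - c)"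
  have "U \<in> clopens X" unfolding U_def
    using c(1) f(1) by (intro clopens_Int homeo_group_clopens inv_closed clopens_Diff clopens_topspace)
  moreover have "x \<in> U"
  proof -
    have "x = (inv\<^bsub>homeo_group X\<^esub> f) (f x)" using homeo_group_eval(4)[OF f(1) x(1)] by simp
    moreover have "f x \<in> topspace X - c" using c homeo_group_eval(1)[OF f(1) x(1)] by simp
    ultimately show ?thesis using c(2) unfolding U_def by blast
  qed
  moreover have "f ` U \<inter> U = {}"
    using homeo_group_eval(5)[OF f(1)] unfolding U_def by fastforce
  ultimately show ?thesis using that by blast
qed

lemma homeo_group_support:
  assumes f: "f \<in> carrier (homeo_group X)" and W: "W \<subseteq> topspace X" and off: "\<And>x. x \<in> topspace X - W \<Longrightarrow> f x = x" and x: "x \<in> W"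
  shows "(inv\<^bsub>homeo_group X\<^esub> f) x \<in> W"
proof (rule ccontr)
  interpret group "homeo_group X" by (rule group_homeo_group)
  let ?y = "(inv\<^bsub>homeo_group X\<^esub> f) x"
  assume "?y \<notin> W"
  moreover have "?y \<in> topspace X" using homeo_group_eval(1)[OF inv_closed[OF f]] x W by blast
  ultimately have "f ?y = ?y" using off by simp
  moreover have "f ?y = x" using homeo_group_eval(5)[OF f] x W by blast
  ultimately show False using \<open>?y \<notin> W\<close> x by simp
qed

text \<open>The two hypotheses on homeomorphisms enter separately. \<open>trans\<close> moves a set
  displaced by \<open>b\<close> so that it meets one displaced by \<open>a\<close>, which yields the
  common set \<open>W\<close>; \<open>nonab\<close> contradicts the commutation that the commutators
  force on homeomorphisms supported in \<open>W\<close>.\<close>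

theorem no_commuting_conjugates:
  assumes X: "Hausdorff_space X" "zero_dimensional X"
    and trans: "\<And>U V. U \<in> clopens X \<Longrightarrow> U \<noteq> {} \<Longrightarrow> V \<in> clopens X \<Longrightarrow> V \<noteq> {} \<Longrightarrow>
      \<exists>g\<in>carrier (homeo_group X). g ` V \<inter> U \<noteq> {}"
    and nonab: "\<And>W. W \<in> clopens X \<Longrightarrow> W \<noteq> {} \<Longrightarrow> \<exists>f\<in>carrier (homeo_group X). \<exists>h\<in>carrier (homeo_group X).
      (\<forall>x\<in>topspace X - W. f x = x \<and> h x = x) \<and> (\<exists>x\<in>topspace X. f (h x) \<noteq> h (f x))"
  shows "\<not> commuting_conjugates (homeo_group X) a b"
proof
  let ?G = "homeo_group X"
  interpret group ?G by (rule group_homeo_group)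
  assume ab: "commuting_conjugates ?G a b"
  have a: "a \<in> carrier ?G" "a \<noteq> \<one>\<^bsub>?G\<^esub>" and b: "b \<in> carrier ?G" "b \<noteq> \<one>\<^bsub>?G\<^esub>"
    using ab by (auto simp: commuting_conjugates_def)
  obtain U where U: "U \<in> clopens X" "U \<noteq> {}" "a ` U \<inter> U = {}" using homeo_moves_clopen[OF X a] .
  obtain V where V: "V \<in> clopens X" "V \<noteq> {}" "b ` V \<inter> V = {}" using homeo_moves_clopen[OF X b] .
  obtain g where g: "g \<in> carrier ?G" "g ` V \<inter> U \<noteq> {}" using trans[OF U(1,2) V(1,2)] by (elim bexE)
  define W where "W = g ` V \<inter> U"
  have W: "W \<in> clopens X" "W \<noteq> {}" using g V(1) U(1) by (auto simp: W_def intro!: clopens_Int homeo_group_clopens)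
  have WX: "W \<subseteq> topspace X" using clopens_subset[OF W(1)] .
  define b' where "b' = g \<otimes>\<^bsub>?G\<^esub> b \<otimes>\<^bsub>?G\<^esub> inv\<^bsub>?G\<^esub> g"
  have b': "b' \<in> carrier ?G" using b g by (simp add: b'_def)
  have aW: "a x \<notin> W" if "x \<in> W" for x using that U(3) by (auto simp: W_def)
  have bW: "b' x \<notin> W" if "x \<in> W" for x
  proof
    assume "b' x \<in> W"
    then have "b' x \<in> g ` V" "x \<in> g ` V" using that by (simp_all add: W_def)
    then obtain v w where vw: "v \<in> V" "x = g v" "w \<in> V" "b' x = g w" by (elim imageE)
    have vX: "v \<in> topspace X" "w \<in> topspace X" using vw clopens_subset[OF V(1)] by auto
    have "b' x = g (b v)"
      unfolding b'_def vw(2) using b g vX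
      by (simp add: homeo_group_eval)
    then have "(inv\<^bsub>?G\<^esub> g) (g w) = (inv\<^bsub>?G\<^esub> g) (g (b v))" using vw(4) by simp
    then have "w = b v" using homeo_group_eval(4)[OF g(1)] homeo_group_eval(1)[OF b(1)] vX by simp
    then show False using V(3) vw by blast
  qed
  obtain f h where f: "f \<in> carrier ?G" and h: "h \<in> carrier ?G"
    and off': "\<forall>x\<in>topspace X - W. f x = x \<and> h x = x"
    and ne: "\<exists>x\<in>topspace X. f (h x) \<noteq> h (f x)" using nonab[OF W] by (elim bexE[of "carrier ?G"] conjE)
  have off: "\<And>x. x \<in> topspace X - W \<Longrightarrow> f x = x" "\<And>x. x \<in> topspace X - W \<Longrightarrow> h x = x"
    using off' by simp_all
  let ?f = "inv\<^bsub>?G\<^esub> f" and ?h = "inv\<^bsub>?G\<^esub> h"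
  \<comment> \<open>On \<open>W\<close> the inverse of \<open>k\<close> acts first and stays in
    \<open>W\<close>; the inverse of \<open>d\<close> then leads out of \<open>W\<close>, where
    \<open>k\<close> does nothing, and \<open>d\<close> leads back. Only the inverse of
    \<open>k\<close> remains.\<close>
  have shift: "(d \<otimes>\<^bsub>?G\<^esub> (k \<otimes>\<^bsub>?G\<^esub> inv\<^bsub>?G\<^esub> d \<otimes>\<^bsub>?G\<^esub> inv\<^bsub>?G\<^esub> k)) x = (inv\<^bsub>?G\<^esub> k) x"
    if d: "d \<in> carrier ?G" "\<And>x. x \<in> W \<Longrightarrow> d x \<notin> W"
      and k: "k \<in> carrier ?G" "\<And>x. x \<in> topspace X - W \<Longrightarrow> k x = x" and x: "x \<in> W" for d k x
  proof -
    let ?y = "(inv\<^bsub>?G\<^esub> k) x"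
    have y: "?y \<in> W" "?y \<in> topspace X" using homeo_group_support[OF k(1) WX k(2) x] WX by auto
    let ?z = "(inv\<^bsub>?G\<^esub> d) ?y"
    have z: "?z \<in> topspace X" "d ?z = ?y" using homeo_group_eval y(2) d by (simp_all add: homeo_group_eval)
    have "?z \<notin> W" using d(2)[of ?z] z(2) y(1) by auto
    then have "k ?z = ?z" using k(2) z(1) by simp
    then show ?thesis using d k x z y WX by (simp add: homeo_group_eval subset_iff)
  qed
  have comm: "?f (?h x) = ?h (?f x)" if x: "x \<in> W" for x
  proof -
    let ?c = "a \<otimes>\<^bsub>?G\<^esub> (f \<otimes>\<^bsub>?G\<^esub> inv\<^bsub>?G\<^esub> a \<otimes>\<^bsub>?G\<^esub> inv\<^bsub>?G\<^esub> f)"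
    let ?d = "b' \<otimes>\<^bsub>?G\<^esub> (h \<otimes>\<^bsub>?G\<^esub> inv\<^bsub>?G\<^esub> b' \<otimes>\<^bsub>?G\<^esub> inv\<^bsub>?G\<^esub> h)"
    have cd: "?c \<in> carrier ?G" "?d \<in> carrier ?G" using a b' f h by simp_all
    have xX: "x \<in> topspace X" using x WX by blast
    have "?c \<otimes>\<^bsub>?G\<^esub> ?d = ?d \<otimes>\<^bsub>?G\<^esub> ?c" by (rule commutators_commute[OF ab f g(1) h b'_def])
    then have "?c (?d x) = ?d (?c x)"
      using homeo_group_eval(2)[OF cd(2) xX cd(1)] homeo_group_eval(2)[OF cd(1) xX cd(2)] by simp
    moreover have "?d x = ?h x" "?c x = ?f x"
      using shift[OF b' bW h off(2) x] shift[OF a(1) aW f off(1) x] by simp_all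
    moreover have "?c (?h x) = ?f (?h x)" "?d (?f x) = ?h (?f x)"
      using shift[OF a(1) aW f off(1) homeo_group_support[OF h WX off(2) x]]
        shift[OF b' bW h off(2) homeo_group_support[OF f WX off(1) x]] by simp_all
    ultimately show ?thesis by simp
  qed
  obtain x where x: "x \<in> topspace X" "f (h x) \<noteq> h (f x)" using ne by blast
  have inW: "x \<in> W"
  proof (rule ccontr)
    assume "x \<notin> W"
    then show False using x off by simp
  qed
  have mapsW: "k y \<in> W" if k: "k \<in> carrier ?G" "\<And>x. x \<in> topspace X - W \<Longrightarrow> k x = x" and y: "y \<in> W" for k y
  proof -
    have "inv\<^bsub>?G\<^esub> k \<in> carrier ?G" using k by simp
    moreover have "(inv\<^bsub>?G\<^esub> k) z = z" if "z \<in> topspace X - W" for z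
      using homeo_group_eval(4)[OF k(1), of z] k(2)[OF that] that by simp
    ultimately have "(inv\<^bsub>?G\<^esub> (inv\<^bsub>?G\<^esub> k)) y \<in> W" using homeo_group_support[OF _ WX _ y] by blast
    then show ?thesis using k by simp
  qed
  let ?w = "h (f x)"
  have fx: "f x \<in> W" "?w \<in> W" "h x \<in> W"
    using mapsW[OF f off(1)] mapsW[OF h off(2)] inW by simp_all
  then have X': "f x \<in> topspace X" "?w \<in> topspace X" "h x \<in> topspace X" using WX by auto
  \<comment> \<open>The commutation of the inverses is evaluated at \<open>h (f x)\<close>, where
    one side is \<open>x\<close>; applying \<open>h\<close> and then \<open>f\<close> to the other
    side gives the forbidden equality.\<close>
  have "?f (?h ?w) = x" using homeo_group_eval(4) f h x X' by metis
  then have "?h (?f ?w) = x" using comm[OF fx(2)] by simp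
  then have "f (h (?h (?f ?w))) = f (h x)" by simp
  moreover have fw: "?f ?w \<in> topspace X" using homeo_group_eval(1)[OF inv_closed[OF f]] X' by blast
  ultimately have "?w = f (h x)" using homeo_group_eval(5)[OF h fw] homeo_group_eval(5)[OF f X'(2)] by simp
  then show False using x by simp
qed

text \<open>Disjoint supports: as every \<open>g\<close> and its inverse map \<open>S\<close> into
  itself, each conjugate of \<open>b\<close> fixes \<open>S\<close> pointwise and preserves the
  complement, while \<open>a\<close> acts on \<open>S\<close> only.\<close>

theorem commuting_conjugates_if_invariant_clopen:
  assumes S: "S \<subseteq> topspace X" and inv: "\<And>g x. g \<in> carrier (homeo_group X) \<Longrightarrow> x \<in> S \<Longrightarrow> g x \<in> S"
    and a: "a \<in> carrier (homeo_group X)" "\<And>x. x \<in> topspace X - S \<Longrightarrow> a x = x" "x\<^sub>a \<in> topspace X" "a x\<^sub>a \<noteq> x\<^sub>a"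
    and b: "b \<in> carrier (homeo_group X)" "\<And>x. x \<in> S \<Longrightarrow> b x = x" "x\<^sub>b \<in> topspace X" "b x\<^sub>b \<noteq> x\<^sub>b"
  shows "commuting_conjugates (homeo_group X) a b"
proof -
  let ?G = "homeo_group X"
  interpret group ?G by (rule group_homeo_group)
  show ?thesis unfolding commuting_conjugates_def
  proof (intro conjI ballI a b)
    show "a \<noteq> \<one>\<^bsub>?G\<^esub>" using a homeo_group_eval(3)[OF a(1,3)] by metis
    show "b \<noteq> \<one>\<^bsub>?G\<^esub>" using b homeo_group_eval(3)[OF b(1,3)] by metis
    fix g assume g: "g \<in> carrier ?G"
    define c where "c = g \<otimes>\<^bsub>?G\<^esub> b \<otimes>\<^bsub>?G\<^esub> inv\<^bsub>?G\<^esub> g"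
    have c: "c \<in> carrier ?G" using b g by (simp add: c_def)
    have cx: "c x = x" if x: "x \<in> S" for x
    proof -
      have "(inv\<^bsub>?G\<^esub> g) x \<in> S" using inv[OF inv_closed[OF g] x] .
      then show ?thesis using b(1,2) g x S unfolding c_def by (simp add: homeo_group_eval subset_iff)
    qed
    have cS: "c x \<notin> S" if x: "x \<in> topspace X - S" for x
    proof
      assume "c x \<in> S"
      then have "(inv\<^bsub>?G\<^esub> c) (c x) \<in> S" using inv[OF inv_closed[OF c]] by blast
      then show False using homeo_group_eval(4)[OF c, of x] x by simp
    qed
    have "a \<otimes>\<^bsub>?G\<^esub> c = c \<otimes>\<^bsub>?G\<^esub> a"
    proof (rule homeo_group_eqI)
      fix x assume x: "x \<in> topspace X"
      show "(a \<otimes>\<^bsub>?G\<^esub> c) x = (c \<otimes>\<^bsub>?G\<^esub> a) x"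
      proof (cases "x \<in> S")
        case True
        then show ?thesis using cx inv[OF a(1)] x a(1) c by (simp add: homeo_group_eval)
      next
        case False
        then have "c x \<in> topspace X - S" using cS x homeo_group_eval(1)[OF c x] by simp
        then show ?thesis using a(2) x False a(1) c by (simp add: homeo_group_eval)
      qed
    qed (use a c in simp_all)
    then show "a \<otimes>\<^bsub>?G\<^esub> (g \<otimes>\<^bsub>?G\<^esub> b \<otimes>\<^bsub>?G\<^esub> inv\<^bsub>?G\<^esub> g) = (g \<otimes>\<^bsub>?G\<^esub> b \<otimes>\<^bsub>?G\<^esub> inv\<^bsub>?G\<^esub> g) \<otimes>\<^bsub>?G\<^esub> a" by (simp add: c_def)
  qed
qed

section \<open>Closed subspaces of Cantor cubes\<close>

lemma continuum_nat_set: "ctwo ^c natLeq =o |UNIV :: nat set set|"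
  using ordIso_symmetric[OF card_of_Pow_Func[of "UNIV :: nat set"]]
  by (simp add: cexp_def ctwo_def Field_natLeq Field_card_of)

definition cantor_cube :: "('i \<Rightarrow> bool) topology"
  where "cantor_cube = product_topology (\<lambda>_. discrete_topology UNIV) UNIV"

text \<open>The cylinder sets with support in \<open>J\<close>, taken in the full cube. Recording
  \<open>J\<close> makes it possible to say later on which levels of a tower a clopen set
  depends.\<close>

definition finitely_determined :: "'i set \<Rightarrow> ('i \<Rightarrow> bool) set set"
  where "finitely_determined J = {D. \<exists>F. finite F \<and> F \<subseteq> J \<and> (\<forall>x y. (\<forall>i\<in>F. x i = y i) \<longrightarrow> (x \<in> D \<longleftrightarrow> y \<in> D))}"

lemma finitely_determinedI:
  assumes "finite F" "F \<subseteq> J" "\<And>x y. \<forall>i\<in>F. x i = y i \<Longrightarrow> x \<in> D \<longleftrightarrow> y \<in> D"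
  shows "D \<in> finitely_determined J"
  unfolding finitely_determined_def by (intro CollectI exI[of _ F] conjI allI impI assms)

lemma finitely_determinedE:
  assumes "D \<in> finitely_determined J"
  obtains F where "finite F" "F \<subseteq> J" "\<forall>x y. (\<forall>i\<in>F. x i = y i) \<longrightarrow> (x \<in> D \<longleftrightarrow> y \<in> D)"
proof -
  obtain F where F: "finite F" "F \<subseteq> J" "\<forall>x y. (\<forall>i\<in>F. x i = y i) \<longrightarrow> (x \<in> D \<longleftrightarrow> y \<in> D)"
    using assms unfolding finitely_determined_def by (elim CollectE exE conjE)
  show ?thesis by (rule that[OF F])
qed

lemma finitely_determined_coord: "i \<in> J \<Longrightarrow> {x. x i} \<in> finitely_determined J"
  by (rule finitely_determinedI[of "{i}"]) auto

lemma finitely_determined_Compl: "D \<in> finitely_determined J \<Longrightarrow> - D \<in> finitely_determined J"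
  by (erule finitely_determinedE, rule finitely_determinedI, assumption, assumption) (simp add: Compl_iff)

lemma finitely_determined_Int:
  assumes "D \<in> finitely_determined J" "E \<in> finitely_determined J"
  shows "D \<inter> E \<in> finitely_determined J"
proof -
  obtain F where F: "finite F" "F \<subseteq> J" "\<forall>x y. (\<forall>i\<in>F. x i = y i) \<longrightarrow> (x \<in> D \<longleftrightarrow> y \<in> D)"
    using finitely_determinedE[OF assms(1)] .
  obtain G where G: "finite G" "G \<subseteq> J" "\<forall>x y. (\<forall>i\<in>G. x i = y i) \<longrightarrow> (x \<in> E \<longleftrightarrow> y \<in> E)"
    using finitely_determinedE[OF assms(2)] .
  show ?thesis
  proof (rule finitely_determinedI[of "F \<union> G"])
    fix x y :: "'a \<Rightarrow> bool" assume "\<forall>i\<in>F \<union> G. x i = y i"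
    then show "x \<in> D \<inter> E \<longleftrightarrow> y \<in> D \<inter> E" using F(3)[THEN spec[of _ x], THEN spec[of _ y]] G(3)[THEN spec[of _ x], THEN spec[of _ y]] by simp
  qed (use F G in auto)
qed

lemma finitely_determined_Un:
  "D \<in> finitely_determined J \<Longrightarrow> E \<in> finitely_determined J \<Longrightarrow> D \<union> E \<in> finitely_determined J"
  using finitely_determined_Compl[OF finitely_determined_Int[OF finitely_determined_Compl finitely_determined_Compl]]
  by (metis Compl_Int double_compl)

lemma finitely_determined_empty: "{} \<in> finitely_determined J"
  by (auto intro: finitely_determinedI[of "{}"])

lemma finitely_determined_mono: "J \<subseteq> K \<Longrightarrow> finitely_determined J \<subseteq> finitely_determined K"
  unfolding finitely_determined_def by blast

text \<open>A cylinder set is coded by a finite set of coordinates and a finite set of patterns on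
  it, each pattern being written as a finite subset of \<open>J\<close>.\<close>

lemma card_of_finitely_determined:
  assumes "infinite J"
  shows "|finitely_determined J| \<le>o |J|"
proof -
  let ?f = "\<lambda>(F, P). {x. {i \<in> F. x i} \<in> P}"
  have J: "\<not> finite (Field |J| )" using assms by (simp add: Field_card_of)
  have inf: "infinite (Fpow J)"
  proof
    assume "finite (Fpow J)"
    moreover have "(\<lambda>x. {x}) ` J \<subseteq> Fpow J" by (auto simp: Fpow_def)
    ultimately have "finite ((\<lambda>x. {x}) ` J)" by (rule finite_subset[rotated])
    then show False using assms by (simp add: finite_image_iff)
  qed
  have "finitely_determined J \<subseteq> ?f ` (Fpow J \<times> Fpow (Fpow J))"
  proof
    fix D :: "('a \<Rightarrow> bool) set" assume "D \<in> finitely_determined J"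
    then obtain F where F: "finite F" "F \<subseteq> J" "\<forall>x y. (\<forall>i\<in>F. x i = y i) \<longrightarrow> (x \<in> D \<longleftrightarrow> y \<in> D)"
      by (rule finitely_determinedE)
    define P where "P = (\<lambda>x. {i \<in> F. x i}) ` D"
    have "D = {x. {i \<in> F. x i} \<in> P}"
    proof (intro equalityI subsetI)
      fix x assume "x \<in> {x. {i \<in> F. x i} \<in> P}"
      then obtain y where "y \<in> D" "{i \<in> F. x i} = {i \<in> F. y i}" by (auto simp: P_def)
      moreover have "\<forall>i\<in>F. x i = y i" using calculation(2) by blast
      ultimately show "x \<in> D" using F(3)[THEN spec[of _ x], THEN spec[of _ y]] by simp
    qed (auto simp: P_def)
    moreover have "P \<in> Fpow (Fpow J)"
    proof -
      have "P \<subseteq> Pow F" by (auto simp: P_def)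
      then have "finite P" using F(1) finite_subset by blast
      then show ?thesis using F(1,2) by (auto simp: P_def Fpow_def)
    qed
    ultimately show "D \<in> ?f ` (Fpow J \<times> Fpow (Fpow J))"
      using F(1,2) by (intro image_eqI[of _ _ "(F, P)"]) (auto simp: Fpow_def)
  qed
  then have "|finitely_determined J| \<le>o |Fpow J \<times> Fpow (Fpow J)|" by (rule surj_imp_ordLeq)
  also have "|Fpow J \<times> Fpow (Fpow J)| \<le>o |J|"
    by (rule card_of_Times_ordLeq_infinite_Field[OF J card_of_Fpow_infinite[OF assms]
        ordLeq_transitive[OF card_of_Fpow_infinite[OF inf] card_of_Fpow_infinite[OF assms]] card_of_Card_order])
  finally show ?thesis .
qed

lemma topspace_cantor_cube [simp]: "topspace cantor_cube = UNIV"
  by (simp add: cantor_cube_def)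

lemma openin_cantor_cube:
  "openin cantor_cube U \<longleftrightarrow> (\<forall>x\<in>U. \<exists>D\<in>finitely_determined UNIV. x \<in> D \<and> D \<subseteq> U)"
proof -
  have "(\<exists>V. finite {i. V i \<noteq> UNIV} \<and> x \<in> Pi\<^sub>E UNIV V \<and> Pi\<^sub>E UNIV V \<subseteq> U) \<longleftrightarrow>
      (\<exists>D\<in>finitely_determined UNIV. x \<in> D \<and> D \<subseteq> U)" (is "?L \<longleftrightarrow> ?R") for x
  proof
    assume ?L
    then obtain V where V: "finite {i. V i \<noteq> UNIV}" "x \<in> Pi\<^sub>E UNIV V" "Pi\<^sub>E UNIV V \<subseteq> U" by blast
    have "Pi\<^sub>E UNIV V \<in> finitely_determined UNIV"
    proof (rule finitely_determinedI[OF V(1)])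
      fix y z :: "'a \<Rightarrow> bool" assume eq: "\<forall>i\<in>{i. V i \<noteq> UNIV}. y i = z i"
      have "y i \<in> V i \<longleftrightarrow> z i \<in> V i" for i using eq by (cases "V i = UNIV") auto
      then show "y \<in> Pi\<^sub>E UNIV V \<longleftrightarrow> z \<in> Pi\<^sub>E UNIV V" by (simp add: PiE_UNIV_domain Pi_iff)
    qed simp
    then show ?R using V by blast
  next
    assume ?R
    then obtain D where D: "D \<in> finitely_determined UNIV" "x \<in> D" "D \<subseteq> U" by blast
    obtain F where F: "finite F" "F \<subseteq> UNIV" "\<forall>y z. (\<forall>i\<in>F. y i = z i) \<longrightarrow> (y \<in> D \<longleftrightarrow> z \<in> D)"
      using finitely_determinedE[OF D(1)] .
    let ?V = "\<lambda>i. if i \<in> F then {x i} else UNIV"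
    have h1: "finite {i. ?V i \<noteq> UNIV}" by (rule finite_subset[OF _ F(1)]) auto
    have h2: "x \<in> Pi\<^sub>E UNIV ?V" by auto
    have h3: "Pi\<^sub>E UNIV ?V \<subseteq> D"
    proof
      fix y assume "y \<in> Pi\<^sub>E UNIV ?V"
      then have "y i = x i" if "i \<in> F" for i using that by (auto simp: PiE_UNIV_domain Pi_iff split: if_splits)
      then show "y \<in> D" using F(3)[THEN spec[of _ y], THEN spec[of _ x]] D(2) by simp
    qed
    show ?L by (rule exI[of _ ?V], intro conjI h1 h2 order_trans[OF h3 D(3)])
  qed
  then show ?thesis
    unfolding cantor_cube_def openin_product_topology_alt by simp
qed

lemma compact_space_cantor_cube: "compact_space cantor_cube"
  unfolding cantor_cube_def by (simp add: compact_space_product_topology compact_space_discrete_topology)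

lemma Hausdorff_space_cantor_cube: "Hausdorff_space cantor_cube"
  unfolding cantor_cube_def by (simp add: Hausdorff_space_product_topology)

lemma openin_finitely_determined: "D \<in> finitely_determined J \<Longrightarrow> openin cantor_cube D"
  using finitely_determined_mono[of J UNIV] by (auto simp: openin_cantor_cube)

lemma closedin_finitely_determined: "D \<in> finitely_determined J \<Longrightarrow> closedin cantor_cube D"
  using openin_finitely_determined[OF finitely_determined_Compl] by (simp add: closedin_def Compl_eq_Diff_UNIV)

lemma finitely_determined_clopens: "D \<in> finitely_determined J \<Longrightarrow> D \<inter> S \<in> clopens (subtopology cantor_cube S)"
  unfolding clopens_def
  by (auto intro: openin_subtopology_Int closedin_subtopology_Int_closedin openin_finitely_determined closedin_finitely_determined
      simp: closedin_subtopology)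

lemma is_base_cantor_cube: "is_base (subtopology cantor_cube S) ((\<lambda>D. D \<inter> S) ` finitely_determined UNIV)"
  unfolding is_base_iff
proof (intro conjI ballI allI impI)
  show "openin (subtopology cantor_cube S) U" if "U \<in> (\<lambda>D. D \<inter> S) ` finitely_determined UNIV" for U
    using that finitely_determined_clopens by (auto simp: clopens_def)
  fix U x assume "openin (subtopology cantor_cube S) U \<and> x \<in> U"
  then obtain V where V: "openin cantor_cube V" "U = V \<inter> S" "x \<in> V" "x \<in> S" by (auto simp: openin_subtopology)
  then obtain D where "D \<in> finitely_determined UNIV" "x \<in> D" "D \<subseteq> V" unfolding openin_cantor_cube by blast
  then show "\<exists>B\<in>(\<lambda>D. D \<inter> S) ` finitely_determined UNIV. x \<in> B \<and> B \<subseteq> U" using V by (intro bexI[of _ "D \<inter> S"]) auto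
qed

text \<open>The traces of cylinder sets form a base closed under finite unions, so by compactness
  every clopen set is such a trace.\<close>

lemma closed_subspace_cantor_cube:
  assumes "closedin cantor_cube S"
  shows "compact_space (subtopology cantor_cube S)" "Hausdorff_space (subtopology cantor_cube S)"
    "zero_dimensional (subtopology cantor_cube S)" "topspace (subtopology cantor_cube S) = S"
    "clopens (subtopology cantor_cube S) = (\<lambda>D. D \<inter> S) ` finitely_determined UNIV"
proof -
  let ?T = "subtopology cantor_cube S"
  show c: "compact_space ?T"
    using closedin_compact_space[OF compact_space_cantor_cube assms] compact_space_subtopology by blast
  show "Hausdorff_space ?T" by (rule Hausdorff_space_subtopology[OF Hausdorff_space_cantor_cube])
  show "zero_dimensional ?T" unfolding zero_dimensional_def
    using is_base_cantor_cube[of S] finitely_determined_clopens[where S=S]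
    by (intro exI[of _ "(\<lambda>D. D \<inter> S) ` finitely_determined UNIV"]) (auto simp: clopens_def)
  show "topspace ?T = S" by simp
  show "clopens ?T = (\<lambda>D. D \<inter> S) ` finitely_determined UNIV"
  proof
    show "(\<lambda>D. D \<inter> S) ` finitely_determined UNIV \<subseteq> clopens ?T" using finitely_determined_clopens by blast
    show "clopens ?T \<subseteq> (\<lambda>D. D \<inter> S) ` finitely_determined UNIV"
    proof
      fix C assume "C \<in> clopens ?T"
      then obtain F where F: "F \<in> Fpow ((\<lambda>D. D \<inter> S) ` finitely_determined UNIV)" "C = \<Union>F"
        using clopens_le_base[OF c is_base_cantor_cube] by blast
      then have "finite F" "F \<subseteq> (\<lambda>D. D \<inter> S) ` finitely_determined UNIV" by (auto simp: Fpow_def)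
      then have "\<Union>F \<in> (\<lambda>D. D \<inter> S) ` finitely_determined UNIV"
      proof (induction F rule: finite_induct)
        case empty
        then show ?case using finitely_determined_empty by (intro image_eqI[of _ _ "{}"]) auto
      next
        case (insert B F)
        then obtain D E where "D \<in> finitely_determined UNIV" "B = D \<inter> S" "E \<in> finitely_determined UNIV" "\<Union>F = E \<inter> S"
          by auto
        then show ?case using finitely_determined_Un[of D UNIV E] by (intro image_eqI[of _ _ "D \<union> E"]) auto
      qed
      then show "C \<in> (\<lambda>D. D \<inter> S) ` finitely_determined UNIV" using F(2) by simp
    qed
  qed
qed

section \<open>The remainder of the discrete space of natural numbers\<close>

text \<open>Ultrafilters as points of a Cantor cube. The first two clauses describe Boolean
  homomorphisms to two elements, the last excludes the principal ones; each instance concerns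
  finitely many coordinates, which makes the set closed.\<close>

definition free_ultrafilters :: "(nat set \<Rightarrow> bool) set"
  where "free_ultrafilters = {x. (\<forall>A B. x (A \<inter> B) \<longleftrightarrow> x A \<and> x B) \<and> (\<forall>A. x (- A) \<longleftrightarrow> \<not> x A) \<and> (\<forall>A. finite A \<longrightarrow> \<not> x A)}"

definition omega_star :: "(nat set \<Rightarrow> bool) topology"
  where "omega_star = subtopology cantor_cube free_ultrafilters"

text \<open>The trace on the remainder of the closure of \<open>A\<close> in the Stone-Cech
  compactification. Relations between such sets are relations modulo finite sets.\<close>

definition star :: "nat set \<Rightarrow> (nat set \<Rightarrow> bool) set"
  where "star A = {x \<in> free_ultrafilters. x A}"

lemma free_ultrafiltersD:
  assumes "x \<in> free_ultrafilters"
  shows "x (A \<inter> B) \<longleftrightarrow> x A \<and> x B" "x (- A) \<longleftrightarrow> \<not> x A" "finite A \<Longrightarrow> \<not> x A" "A \<subseteq> B \<Longrightarrow> x A \<Longrightarrow> x B"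
    "x (A - B) \<longleftrightarrow> x A \<and> \<not> x B" "x UNIV"
proof -
  have I: "x (A \<inter> B) \<longleftrightarrow> x A \<and> x B" for A B using assms unfolding free_ultrafilters_def by blast
  have C: "x (- A) \<longleftrightarrow> \<not> x A" for A using assms unfolding free_ultrafilters_def by blast
  have F: "finite A \<Longrightarrow> \<not> x A" for A using assms unfolding free_ultrafilters_def by blast
  show "x (A \<inter> B) \<longleftrightarrow> x A \<and> x B" "x (- A) \<longleftrightarrow> \<not> x A" "finite A \<Longrightarrow> \<not> x A" by (fact I C F)+
  show "A \<subseteq> B \<Longrightarrow> x A \<Longrightarrow> x B" using I[of A B] by (simp add: Int_absorb2)
  show "x (A - B) \<longleftrightarrow> x A \<and> \<not> x B" using I C by (simp add: Diff_eq)
  show "x UNIV" using C[of "{}"] F[of "{}"] by simp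
qed

lemma closedin_free_ultrafilters: "closedin cantor_cube free_ultrafilters"
proof -
  have "{x :: nat set \<Rightarrow> bool. x (fst p \<inter> snd p) \<longleftrightarrow> x (fst p) \<and> x (snd p)} \<in> finitely_determined UNIV" for p
    by (rule finitely_determinedI[of "{fst p, snd p, fst p \<inter> snd p}"]) auto
  then have 1: "closedin cantor_cube (\<Inter>p. {x :: nat set \<Rightarrow> bool. x (fst p \<inter> snd p) \<longleftrightarrow> x (fst p) \<and> x (snd p)})"
    by (intro closedin_INT closedin_finitely_determined) auto
  have "{x :: nat set \<Rightarrow> bool. x (- A) \<longleftrightarrow> \<not> x A} \<in> finitely_determined UNIV" for A
    by (rule finitely_determinedI[of "{A, - A}"]) auto
  then have 2: "closedin cantor_cube (\<Inter>A. {x :: nat set \<Rightarrow> bool. x (- A) \<longleftrightarrow> \<not> x A})"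
    by (intro closedin_INT closedin_finitely_determined) auto
  have "{x :: nat set \<Rightarrow> bool. \<not> x A} \<in> finitely_determined UNIV" for A
    by (rule finitely_determinedI[of "{A}"]) auto
  then have 3: "closedin cantor_cube (\<Inter>A\<in>Collect finite. {x :: nat set \<Rightarrow> bool. \<not> x A})"
    by (intro closedin_INT closedin_finitely_determined) auto
  have "free_ultrafilters = (\<Inter>p. {x. x (fst p \<inter> snd p) \<longleftrightarrow> x (fst p) \<and> x (snd p)}) \<inter>
      (\<Inter>A. {x. x (- A) \<longleftrightarrow> \<not> x A}) \<inter> (\<Inter>A\<in>Collect finite. {x. \<not> x A})"
    unfolding free_ultrafilters_def by (rule Set.set_eqI) simp
  then show ?thesis using closedin_Int[OF closedin_Int[OF 1 2] 3] by simp
qed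

lemmas omega_star_basics = closed_subspace_cantor_cube[OF closedin_free_ultrafilters, folded omega_star_def]

text \<open>A free ultrafilter containing an infinite set is an accumulation point, in the Cantor cube,
  of the principal ultrafilters of its elements.\<close>

lemma free_ultrafilter_exists:
  assumes "infinite A"
  shows "star A \<noteq> {}"
proof -
  define \<epsilon> where "\<epsilon> n = (\<lambda>B. n \<in> B)" for n :: nat
  define K where "K m = cantor_cube closure_of (\<epsilon> ` {n \<in> A. m \<le> n})" for m
  have "(\<Inter>m. K m) \<noteq> {}"
  proof (rule compact_space_imp_nest[OF compact_space_cantor_cube])
    show "closedin cantor_cube (K m)" for m by (simp add: K_def)
    show "K m \<noteq> {}" for m
    proof -
      obtain n where "n \<ge> m" "n \<in> A" using assms infinite_nat_iff_unbounded_le by blast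
      then have "\<epsilon> n \<in> K m" unfolding K_def by (intro closure_of_subset[THEN subsetD]) auto
      then show ?thesis by blast
    qed
    show "decseq K" unfolding decseq_def K_def by (intro allI impI closure_of_mono image_mono) auto
  qed
  then obtain x where x: "\<And>m. x \<in> K m" by blast
  have appr: "\<exists>n\<in>A. m \<le> n \<and> \<epsilon> n \<in> D" if "D \<in> finitely_determined UNIV" "x \<in> D" for D m
    using x[of m] openin_finitely_determined[OF that(1)] that(2) unfolding K_def in_closure_of by fastforce
  have "x \<in> free_ultrafilters" unfolding free_ultrafilters_def
  proof (intro CollectI conjI allI impI)
    fix B C
    show "x (B \<inter> C) \<longleftrightarrow> x B \<and> x C"
    proof (rule ccontr)
      assume "(x (B \<inter> C)) \<noteq> (x B \<and> x C)"
      moreover have "{x :: nat set \<Rightarrow> bool. x (B \<inter> C) \<noteq> (x B \<and> x C)} \<in> finitely_determined UNIV"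
        by (rule finitely_determinedI[of "{B, C, B \<inter> C}"]) auto
      ultimately show False using appr by (fastforce simp: \<epsilon>_def)
    qed
    show "x (- B) \<longleftrightarrow> \<not> x B"
    proof (rule ccontr)
      assume "(x (- B)) \<noteq> (\<not> x B)"
      moreover have "{x :: nat set \<Rightarrow> bool. x (- B) \<noteq> (\<not> x B)} \<in> finitely_determined UNIV"
        by (rule finitely_determinedI[of "{B, - B}"]) auto
      ultimately show False using appr by (fastforce simp: \<epsilon>_def)
    qed
    assume "finite B"
    then obtain m where m: "\<And>n. n \<in> B \<Longrightarrow> n < m" by (auto simp: finite_nat_set_iff_bounded)
    show "\<not> x B"
    proof
      assume "x B"
      then obtain n where "m \<le> n" "n \<in> B" using appr[OF finitely_determined_coord, of B m] by (auto simp: \<epsilon>_def)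
      then show False using m by fastforce
    qed
  qed
  moreover have "x A"
  proof (rule ccontr)
    assume "\<not> x A"
    moreover have "{x :: nat set \<Rightarrow> bool. \<not> x A} \<in> finitely_determined UNIV"
      by (rule finitely_determinedI[of "{A}"]) auto
    ultimately show False using appr by (fastforce simp: \<epsilon>_def)
  qed
  ultimately show ?thesis by (auto simp: star_def)
qed

lemma star_empty_iff: "star A = {} \<longleftrightarrow> finite A"
  using free_ultrafilter_exists[of A] free_ultrafiltersD(3) by (auto simp: star_def)

lemma star_Int: "star A \<inter> star B = star (A \<inter> B)"
  and star_Diff: "star A - star B = star (A - B)"
  by (auto simp: star_def free_ultrafiltersD)

lemma star_mono: "A \<subseteq> B \<Longrightarrow> star A \<subseteq> star B"
  by (auto simp: star_def intro: free_ultrafiltersD(4))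

lemma star_subset_iff: "star A \<subseteq> star B \<longleftrightarrow> finite (A - B)"
  using star_Diff[of A B] star_empty_iff[of "A - B"] by blast

text \<open>The set of all \<open>n\<close> agreeing with \<open>x\<close> on the members of
  \<open>F\<close> belongs to \<open>x\<close> and is therefore nonempty. Principal ultrafilters can
  thus stand in for \<open>x\<close> wherever finitely many coordinates matter.\<close>

lemma ultrafilter_principal_on_finite:
  assumes x: "x \<in> free_ultrafilters" and F: "finite F"
  shows "\<exists>n. \<forall>B\<in>F. x B \<longleftrightarrow> n \<in> B"
proof -
  define c where "c B = (if x B then B else - B)" for B
  define E where "E = \<Inter>(c ` F)"
  have cx: "x (c B)" for B by (simp add: c_def free_ultrafiltersD[OF x])
  have "x E" unfolding E_def using F
    by (induction F rule: finite_induct) (simp_all add: cx free_ultrafiltersD[OF x])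
  then have "E \<noteq> {}" using free_ultrafiltersD(3)[OF x, of "{}"] by auto
  then obtain n where n: "n \<in> E" by blast
  have "x B \<longleftrightarrow> n \<in> B" if "B \<in> F" for B
    using n that unfolding E_def c_def by (cases "x B") force+
  then show ?thesis by blast
qed

lemma clopens_omega_star: "clopens omega_star = range star"
proof
  show "range star \<subseteq> clopens omega_star"
  proof
    fix U assume "U \<in> range star"
    then obtain A where "U = {x. x A} \<inter> free_ultrafilters" by (auto simp: star_def)
    then show "U \<in> clopens omega_star"
      unfolding omega_star_basics(5) by (intro image_eqI[of _ _ "{x. x A}"] finitely_determined_coord) simp_all
  qed
  show "clopens omega_star \<subseteq> range star"
  proof
    fix U assume "U \<in> clopens omega_star"
    then obtain D where D: "D \<in> finitely_determined UNIV" "U = D \<inter> free_ultrafilters"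
      unfolding omega_star_basics(5) by blast
    obtain F where F: "finite F" "F \<subseteq> UNIV" "\<forall>x y. (\<forall>i\<in>F. x i = y i) \<longrightarrow> (x \<in> D \<longleftrightarrow> y \<in> D)"
      using finitely_determinedE[OF D(1)] .
    \<comment> \<open>The set of \<open>n\<close> whose principal ultrafilter lies in
      \<open>D\<close>. A principal ultrafilter that agrees with \<open>x\<close> on the support of
      \<open>D\<close> and also at the coordinate \<open>A\<close> itself shows that
      \<open>x\<close> lies in \<open>D\<close> exactly when it contains \<open>A\<close>.\<close>
    define A where "A = {n. (\<lambda>B. n \<in> B) \<in> D}"
    have "x \<in> D \<longleftrightarrow> x A" if "x \<in> free_ultrafilters" for x
    proof -
      have "finite (insert A F)" using F(1) by simp
      from ultrafilter_principal_on_finite[OF that this] obtain n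
        where n: "\<forall>B\<in>insert A F. x B \<longleftrightarrow> n \<in> B" by (elim exE)
      then have "x \<in> D \<longleftrightarrow> (\<lambda>B. n \<in> B) \<in> D" using F(3)[THEN spec[of _ x], THEN spec[of _ "\<lambda>B. n \<in> B"]] by simp
      then show ?thesis using n by (simp add: A_def)
    qed
    then have "U = star A" using D(2) by (auto simp: star_def)
    then show "U \<in> range star" by blast
  qed
qed

lemma countably_separated_omega_star: "countably_separated omega_star"
  unfolding countably_separated_def
proof (intro allI impI, elim conjE)
  fix a b :: "nat \<Rightarrow> (nat set \<Rightarrow> bool) set"
  assume "range a \<subseteq> clopens omega_star" "range b \<subseteq> clopens omega_star" and ab: "\<forall>m n. a m \<inter> b n = {}"
  then have "a n \<in> range star" "b n \<in> range star" for n by (auto simp: clopens_omega_star)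
  then have "\<forall>n. \<exists>A. a n = star A" "\<forall>n. \<exists>A. b n = star A" by (simp_all add: image_iff)
  then obtain A B where A: "\<And>n. a n = star (A n)" and B: "\<And>n. b n = star (B n)" by metis
  have fin: "finite (A m \<inter> B n)" for m n using ab star_Int star_empty_iff A B by metis
  \<comment> \<open>An element of \<open>A n\<close> is kept if it avoids \<open>B 0\<close> up to
    \<open>B n\<close>. So \<open>A n\<close> loses finitely many elements, and \<open>B n\<close>
    can meet only what comes from \<open>A i\<close> with \<open>i < n\<close>, each time in a
    finite set.\<close>
  define C where "C = (\<Union>n. A n - (\<Union>i\<le>n. B i))"
  show "\<exists>c\<in>clopens omega_star. \<forall>n. a n \<subseteq> c \<and> b n \<inter> c = {}"
  proof (intro bexI[of _ "star C"] allI conjI)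
    fix n
    have "A n - C \<subseteq> (\<Union>i\<le>n. A n \<inter> B i)" by (auto simp: C_def)
    moreover have "finite (\<Union>i\<le>n. A n \<inter> B i)" using fin by blast
    ultimately show "a n \<subseteq> star C" unfolding A star_subset_iff using finite_subset by blast
    have "B n \<inter> C \<subseteq> (\<Union>i<n. A i \<inter> B n)"
    proof
      fix k assume k: "k \<in> B n \<inter> C"
      then obtain m where m: "k \<in> A m" "\<forall>i\<le>m. k \<notin> B i" by (auto simp: C_def)
      then have "m < n" using k by (metis IntD1 not_le_imp_less)
      then show "k \<in> (\<Union>i<n. A i \<inter> B n)" using m k by blast
    qed
    moreover have "finite (\<Union>i<n. A i \<inter> B n)" using fin by blast
    ultimately have "finite (B n \<inter> C)" using finite_subset by blast
    then show "b n \<inter> star C = {}" unfolding B star_Int star_empty_iff .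
  qed (auto simp: clopens_omega_star)
qed

lemma splits_below_omega_star: "splits_below omega_star"
  unfolding splits_below_def
proof (intro allI impI, elim conjE)
  fix a :: "nat \<Rightarrow> (nat set \<Rightarrow> bool) set"
  assume "range a \<subseteq> clopens omega_star" and a: "decseq a" "\<forall>n. a n \<noteq> {}"
  then have "a n \<in> range star" for n by (auto simp: clopens_omega_star)
  then have "\<forall>n. \<exists>A. a n = star A" by (simp add: image_iff)
  then obtain A where A: "\<And>n. a n = star (A n)" by metis
  \<comment> \<open>The sets \<open>A n\<close> decrease only modulo finite sets; their finite
    intersections decrease outright and define the same clopen sets.\<close>
  define P where "P n = (\<Inter>i\<le>n. A i)" for n
  have "star (P n) = a n" for n
  proof (induction n)
    case 0 then show ?case by (simp add: P_def A)
  next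
    case (Suc n)
    have "P (Suc n) = P n \<inter> A (Suc n)" by (simp add: P_def atMost_Suc Int_commute)
    then have "star (P (Suc n)) = a n \<inter> a (Suc n)" using Suc by (simp add: star_Int[symmetric] A)
    then show ?case using a(1) by (auto simp: decseq_Suc_iff)
  qed
  then have inf: "infinite (P n)" for n using a(2) star_empty_iff by metis
  \<comment> \<open>A strictly increasing sequence with \<open>k n\<close> in \<open>P n\<close>
    enumerates an infinite pseudo-intersection; its even and odd terms give the two disjoint lower
    bounds.\<close>
  have "\<exists>k. \<forall>n. k n \<in> P n \<and> k n < k (Suc n)"
  proof (rule dependent_nat_choice)
    show "\<exists>k. k \<in> P 0" using inf[of 0] by (metis finite.emptyI ex_in_conv)
    show "\<exists>l. l \<in> P (Suc n) \<and> k < l" if "k \<in> P n" for k n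
      using inf[of "Suc n"] unfolding infinite_nat_iff_unbounded by blast
  qed
  then obtain k where k: "\<And>n. k n \<in> P n" "\<And>n. k n < k (Suc n)" by blast
  have sm: "strict_mono k" using k(2) by (simp add: strict_mono_Suc_iff)
  then have inj: "inj k" by (rule strict_mono_imp_inj_on)
  have below: "star (k ` E) \<subseteq> a n" for E n
  proof -
    have "k ` E - A n \<subseteq> k ` {..<n}"
    proof
      fix l assume l: "l \<in> k ` E - A n"
      then obtain m where m: "l = k m" by blast
      have "m < n"
      proof (rule ccontr)
        assume "\<not> m < n"
        then have "k m \<in> A n" using k(1)[of m] by (auto simp: P_def)
        then show False using l m by simp
      qed
      then show "l \<in> k ` {..<n}" using m by simp
    qed
    then have "finite (k ` E - A n)" by (rule finite_subset) simp
    then show ?thesis unfolding A star_subset_iff .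
  qed
  have infE: "infinite {n::nat. even n}" "infinite {n::nat. odd n}"
  proof -
    have "\<exists>n>m. n \<in> {n::nat. even n}" for m by (intro exI[of _ "2 * m + 2"]) simp
    moreover have "\<exists>n>m. n \<in> {n::nat. odd n}" for m by (intro exI[of _ "2 * m + 1"]) simp
    ultimately show "infinite {n::nat. even n}" "infinite {n::nat. odd n}"
      unfolding infinite_nat_iff_unbounded by simp_all
  qed
  show "\<exists>c\<in>clopens omega_star. \<exists>d\<in>clopens omega_star. c \<noteq> {} \<and> d \<noteq> {} \<and> c \<inter> d = {} \<and> (\<forall>n. c \<subseteq> a n \<and> d \<subseteq> a n)"
  proof (rule bexI[of _ "star (k ` {n. even n})"], rule bexI[of _ "star (k ` {n. odd n})"], intro conjI allI below)
    show "star (k ` {n. even n}) \<noteq> {}" "star (k ` {n. odd n}) \<noteq> {}"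
      unfolding star_empty_iff using infE finite_imageD inj_on_subset[OF inj subset_UNIV] by blast+
    have "k ` {n. even n} \<inter> k ` {n. odd n} = {}" using inj by (auto dest: injD)
    then show "star (k ` {n. even n}) \<inter> star (k ` {n. odd n}) = {}" unfolding star_Int star_empty_iff by simp
  qed (auto simp: clopens_omega_star)
qed

text \<open>The lower bound comes from an almost disjoint family: \<open>br A\<close> is the branch
  of initial segments of \<open>A\<close> in the binary tree, and different branches share only
  finitely many nodes. The length \<open>n\<close> is coded as well, which makes every branch
  infinite.\<close>

lemma card_clopens_omega_star: "|clopens omega_star| =o ctwo ^c natLeq"
proof -
  define br where "br A = range (\<lambda>n. prod_encode (n, set_encode (A \<inter> {..<n})))" for A
  have inf: "infinite (br A)" for A
  proof -
    have "inj (\<lambda>n. prod_encode (n, set_encode (A \<inter> {..<n})))" by (rule injI) simp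
    then show ?thesis unfolding br_def by (rule range_inj_infinite)
  qed
  have "A = B" if "star (br A) = star (br B)" for A B
  proof (rule ccontr)
    assume "A \<noteq> B"
    then obtain m where m: "m \<in> A \<longleftrightarrow> m \<notin> B" by blast
    have "br A \<inter> br B \<subseteq> (\<lambda>n. prod_encode (n, set_encode (A \<inter> {..<n}))) ` {..m}"
    proof
      fix k assume "k \<in> br A \<inter> br B"
      then obtain n where n: "k = prod_encode (n, set_encode (A \<inter> {..<n}))" "set_encode (A \<inter> {..<n}) = set_encode (B \<inter> {..<n})"
        by (auto simp: br_def)
      then have "A \<inter> {..<n} = B \<inter> {..<n}" by (simp add: set_encode_eq)
      then have "n \<le> m" using m by (metis IntI Int_iff lessThan_iff not_le_imp_less)
      then show "k \<in> (\<lambda>n. prod_encode (n, set_encode (A \<inter> {..<n}))) ` {..m}" using n by blast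
    qed
    then have "finite (br A \<inter> br B)" by (rule finite_subset) simp
    then have "star (br A) = {}" using that star_Int[of "br A" "br B"] star_empty_iff by simp
    then show False using inf star_empty_iff by blast
  qed
  then have "inj (\<lambda>A. star (br A))" by (rule injI)
  then have "|UNIV :: nat set set| \<le>o |clopens omega_star|"
    unfolding clopens_omega_star by (intro card_of_ordLeq[THEN iffD1] exI[of _ "\<lambda>A. star (br A)"]) auto
  moreover have "|clopens omega_star| \<le>o |UNIV :: nat set set|"
    unfolding clopens_omega_star by (rule card_of_image)
  ultimately have "|clopens omega_star| =o |UNIV :: nat set set|" by (simp add: ordIso_iff_ordLeq)
  then show ?thesis using ordIso_symmetric[OF continuum_nat_set] ordIso_transitive by blast
qed

theorem Parovicenko_space_omega_star: "Parovicenko_space omega_star"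
  unfolding Parovicenko_space_iff
  using omega_star_basics countably_separated_omega_star splits_below_omega_star card_clopens_omega_star by blast

section \<open>Homeomorphisms of the remainder induced by involutions of the natural numbers\<close>

definition push :: "(nat \<Rightarrow> nat) \<Rightarrow> (nat set \<Rightarrow> bool) \<Rightarrow> nat set \<Rightarrow> bool"
  where "push \<pi> x A = x (\<pi> -` A)"

lemma push_free_ultrafilters: "inj \<pi> \<Longrightarrow> x \<in> free_ultrafilters \<Longrightarrow> push \<pi> x \<in> free_ultrafilters"
  unfolding free_ultrafilters_def push_def by (auto simp: vimage_Int vimage_Compl finite_vimageI)

text \<open>The preimage of \<open>star A\<close> is the clopen set given by the preimage of
  \<open>A\<close>, whence continuity. For an involution \<open>push \<pi>\<close> is its own
  inverse, so one direction is enough.\<close>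

lemma push_involution:
  assumes "\<And>n. \<pi> (\<pi> n) = n"
  shows "restrict (push \<pi>) free_ultrafilters \<in> carrier (homeo_group omega_star)"
proof -
  have inj: "inj \<pi>" using assms by (metis injI)
  have "continuous_map omega_star omega_star (push \<pi>)" unfolding continuous_map_def
  proof (intro conjI allI impI)
    show "push \<pi> \<in> topspace omega_star \<rightarrow> topspace omega_star"
      using push_free_ultrafilters[OF inj] by (simp add: omega_star_basics)
    fix U assume U: "openin omega_star U"
    show "openin omega_star {x \<in> topspace omega_star. push \<pi> x \<in> U}"
    proof (subst openin_subopen, intro ballI)
      fix x assume x: "x \<in> {x \<in> topspace omega_star. push \<pi> x \<in> U}"
      then obtain C where C: "C \<in> clopens omega_star" "push \<pi> x \<in> C" "C \<subseteq> U"
        using U omega_star_basics(3) unfolding zero_dimensional_iff by blast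
      then obtain A where A: "C = star A" unfolding clopens_omega_star by blast
      have "star (\<pi> -` A) \<in> clopens omega_star" unfolding clopens_omega_star by blast
      then have "openin omega_star (star (\<pi> -` A))" by (simp add: clopens_def)
      moreover have "x \<in> star (\<pi> -` A)" using C(2) x unfolding A by (simp add: star_def push_def omega_star_basics)
      moreover have "star (\<pi> -` A) \<subseteq> {x \<in> topspace omega_star. push \<pi> x \<in> U}"
      proof
        fix y assume y: "y \<in> star (\<pi> -` A)"
        then have "push \<pi> y \<in> star A" using push_free_ultrafilters[OF inj] by (simp add: star_def push_def[of _ _ A])
        then show "y \<in> {x \<in> topspace omega_star. push \<pi> x \<in> U}" using y C(3) A by (auto simp: star_def omega_star_basics)
      qed
      ultimately show "\<exists>T. openin omega_star T \<and> x \<in> T \<and> T \<subseteq> {x \<in> topspace omega_star. push \<pi> x \<in> U}" by blast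
    qed
  qed
  moreover have "push \<pi> (push \<pi> x) = x" for x
    unfolding push_def using assms by (simp add: vimage_def)
  ultimately have "homeomorphic_maps omega_star omega_star (push \<pi>) (push \<pi>)" by (simp add: homeomorphic_maps_def)
  then have "homeomorphic_map omega_star omega_star (push \<pi>)" by (rule homeomorphic_maps_imp_map)
  from restrict_in_homeo_group[OF this] show ?thesis by (simp add: omega_star_basics)
qed

lemma exchange_involution:
  fixes P Q :: "nat set"
  assumes "infinite P" "infinite Q" "P \<inter> Q = {}"
  obtains \<pi> where "\<And>n. \<pi> (\<pi> n) = n" "\<And>n. n \<in> P \<longleftrightarrow> \<pi> n \<in> Q" "\<And>n. n \<notin> P \<union> Q \<Longrightarrow> \<pi> n = n"
proof -
  obtain \<beta> where \<beta>: "bij_betw \<beta> P Q"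
  proof -
    have "bij_betw (from_nat_into Q \<circ> to_nat_on P) P Q"
      using to_nat_on_infinite[OF _ assms(1)] bij_betw_from_nat_into[OF _ assms(2)] by (auto intro: bij_betw_trans)
    then show ?thesis using that by blast
  qed
  define \<gamma> where "\<gamma> = inv_into P \<beta>"
  have \<gamma>: "\<gamma> (\<beta> n) = n" "\<beta> n \<in> Q" if "n \<in> P" for n
    using that \<beta> by (auto simp: \<gamma>_def bij_betw_inv_into_left bij_betwE)
  have \<gamma>': "\<beta> (\<gamma> n) = n" "\<gamma> n \<in> P" if "n \<in> Q" for n
    using that \<beta> bij_betw_inv_into[OF \<beta>] by (auto simp: \<gamma>_def bij_betw_inv_into_right bij_betwE)
  define \<pi> where "\<pi> n = (if n \<in> P then \<beta> n else if n \<in> Q then \<gamma> n else n)" for n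
  have disj: "n \<in> P \<Longrightarrow> n \<notin> Q" for n using assms(3) by blast
  show ?thesis
  proof
    show "\<pi> (\<pi> n) = n" for n
      using \<gamma>[of n] \<gamma>'[of n] disj[of "\<beta> n"] by (auto simp: \<pi>_def)
    show "n \<in> P \<longleftrightarrow> \<pi> n \<in> Q" for n using \<gamma>[of n] \<gamma>'[of n] disj[of "\<gamma> n"] by (auto simp: \<pi>_def)
    show "n \<notin> P \<union> Q \<Longrightarrow> \<pi> n = n" for n by (simp add: \<pi>_def)
  qed
qed

text \<open>Membership in an ultrafilter is decided inside any one of its members, here the set of
  fixed points.\<close>

lemma push_id_on_fixed:
  assumes x: "x \<in> free_ultrafilters" "x {n. \<pi> n = n}"
  shows "push \<pi> x = x"
proof
  fix A
  have "x (\<pi> -` A) \<longleftrightarrow> x (\<pi> -` A \<inter> {n. \<pi> n = n})" using x by (simp add: free_ultrafiltersD(1))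
  also have "\<pi> -` A \<inter> {n. \<pi> n = n} = A \<inter> {n. \<pi> n = n}" by auto
  also have "x (A \<inter> {n. \<pi> n = n}) \<longleftrightarrow> x A" using x by (simp add: free_ultrafiltersD(1))
  finally show "push \<pi> x A = x A" by (simp add: push_def)
qed

text \<open>If \<open>A\<close> and \<open>B\<close> are almost disjoint, exchanging
  \<open>A - B\<close> with \<open>B - A\<close> carries a point of \<open>star B\<close> into
  \<open>star A\<close>; otherwise the identity does. Noncommuting homeomorphisms supported in
  \<open>star A\<close> are modelled on two transpositions of three letters.\<close>

theorem no_commuting_conjugates_omega_star: "\<not> commuting_conjugates (homeo_group omega_star) a b"
proof (rule no_commuting_conjugates[OF omega_star_basics(2,3)])
  fix U V assume "U \<in> clopens omega_star" "U \<noteq> {}" "V \<in> clopens omega_star" "V \<noteq> {}"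
  then obtain A B where AB: "U = star A" "V = star B" "star A \<noteq> {}" "star B \<noteq> {}"
    unfolding clopens_omega_star by blast
  then have A: "U = star A" "infinite A" and B: "V = star B" "infinite B" by (simp_all add: star_empty_iff)
  show "\<exists>g\<in>carrier (homeo_group omega_star). g ` V \<inter> U \<noteq> {}"
  proof (cases "finite (A \<inter> B)")
    case False
    then have "star A \<inter> star B \<noteq> {}" by (simp add: star_Int star_empty_iff)
    then obtain x where x: "x \<in> star A" "x \<in> star B" by blast
    have "push (\<lambda>n. n) x = x" by (simp add: push_def fun_eq_iff vimage_def)
    then have "restrict (push (\<lambda>n. n)) free_ultrafilters x = x" using x by (simp add: star_def)
    then show ?thesis using push_involution[of "\<lambda>n. n"] x unfolding A B by (metis IntI empty_iff image_eqI)
  next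
    case True
    have inf: "infinite (B - A)" "infinite (A - B)"
      using True A(2) B(2) Diff_infinite_finite[of "A \<inter> B"] by (metis Diff_Int2 Diff_Int_distrib Diff_cancel Diff_Int finite_Un Int_commute Un_Diff_Int finite_Diff2 Int_Diff_Un)+
    obtain \<pi> where \<pi>: "\<And>n. \<pi> (\<pi> n) = n" "\<And>n. n \<in> B - A \<longleftrightarrow> \<pi> n \<in> A - B" "\<And>n. n \<notin> (B - A) \<union> (A - B) \<Longrightarrow> \<pi> n = n"
      using exchange_involution[OF inf] by blast
    obtain x where x: "x \<in> star (B - A)" using inf star_empty_iff by blast
    have xf: "x \<in> free_ultrafilters" using x by (simp add: star_def)
    have "\<pi> -` (A - B) = B - A" using \<pi>(2) by blast
    then have "push \<pi> x \<in> star (A - B)"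
      using x push_free_ultrafilters[OF _ xf, of \<pi>] \<pi>(1) by (simp add: star_def push_def) (metis injI)
    then have "restrict (push \<pi>) free_ultrafilters x \<in> star A" using star_mono[of "A - B" A] xf by auto
    moreover have "x \<in> star B" using x star_mono[of "B - A" B] by auto
    ultimately show ?thesis using push_involution[of \<pi>, OF \<pi>(1)] unfolding A B by blast
  qed
next
  fix W assume "W \<in> clopens omega_star" "W \<noteq> {}"
  then obtain A where "W = star A" "star A \<noteq> {}" unfolding clopens_omega_star by blast
  then have A: "W = star A" "infinite A" by (simp_all add: star_empty_iff)
  obtain e :: "nat \<Rightarrow> nat" where e: "inj e" "range e \<subseteq> A" using A(2) infinite_countable_subset by blast
  \<comment> \<open>Three disjoint infinite subsets of \<open>A\<close>; \<open>\<pi>\<close> will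
    exchange parts 0 and 1, and \<open>\<rho>\<close> parts 1 and 2.\<close>
  define P where "P i = e ` {n. n mod 3 = i}" for i
  have inf: "infinite (P i)" if "i < 3" for i
  proof -
    have "(\<lambda>n. 3 * n + i) ` UNIV \<subseteq> {n. n mod 3 = i}" using that by auto
    moreover have "infinite ((\<lambda>n. 3 * n + i) ` UNIV)" by (rule range_inj_infinite) (auto intro: injI)
    ultimately have "infinite {n. n mod 3 = i}" using finite_subset by blast
    then show ?thesis unfolding P_def using e(1) by (metis finite_imageD inj_on_subset subset_UNIV)
  qed
  have disj: "P i \<inter> P j = {}" if "i \<noteq> j" for i j using that e(1) by (auto simp: P_def dest: injD)
  have PA: "P i \<subseteq> A" for i using e(2) by (auto simp: P_def)
  obtain \<pi> where \<pi>: "\<And>n. \<pi> (\<pi> n) = n" "\<And>n. n \<in> P 0 \<longleftrightarrow> \<pi> n \<in> P 1" "\<And>n. n \<notin> P 0 \<union> P 1 \<Longrightarrow> \<pi> n = n"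
    using exchange_involution[OF inf inf disj, of 0 1] by auto
  obtain \<rho> where \<rho>: "\<And>n. \<rho> (\<rho> n) = n" "\<And>n. n \<in> P 1 \<longleftrightarrow> \<rho> n \<in> P 2" "\<And>n. n \<notin> P 1 \<union> P 2 \<Longrightarrow> \<rho> n = n"
    using exchange_involution[OF inf inf disj, of 1 2] by auto
  let ?f = "restrict (push \<pi>) free_ultrafilters" and ?h = "restrict (push \<rho>) free_ultrafilters"
  have inj: "inj \<pi>" "inj \<rho>" using \<pi>(1) \<rho>(1) by (metis injI)+
  have off: "push \<sigma> x = x" if "\<And>n. n \<notin> A \<Longrightarrow> \<sigma> n = n" "x \<in> free_ultrafilters - star A" for \<sigma> x
  proof (rule push_id_on_fixed)
    have "x (- A)" using that(2) by (auto simp: star_def free_ultrafiltersD)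
    then show "x {n. \<sigma> n = n}" using free_ultrafiltersD(4)[of x "- A" "{n. \<sigma> n = n}"] that by auto
  qed (use that in simp)
  show "\<exists>f\<in>carrier (homeo_group omega_star). \<exists>h\<in>carrier (homeo_group omega_star).
      (\<forall>x\<in>topspace omega_star - W. f x = x \<and> h x = x) \<and> (\<exists>x\<in>topspace omega_star. f (h x) \<noteq> h (f x))"
  proof (rule bexI[of _ ?f], rule bexI[of _ ?h], intro conjI ballI)
    show "?f \<in> carrier (homeo_group omega_star)" using push_involution[of \<pi>, OF \<pi>(1)] .
    show "?h \<in> carrier (homeo_group omega_star)" using push_involution[of \<rho>, OF \<rho>(1)] .
    fix x assume "x \<in> topspace omega_star - W"
    then have x: "x \<in> free_ultrafilters - star A" by (simp add: A omega_star_basics)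
    have "\<pi> n = n" "\<rho> n = n" if "n \<notin> A" for n using \<pi>(3)[of n] \<rho>(3)[of n] that PA by blast+
    then show "?f x = x" "?h x = x" using off[OF _ x] x by auto
  next
    \<comment> \<open>A point on part 0 is fixed by \<open>\<rho>\<close> and sent to part 1 by
      \<open>\<pi>\<close>. In one order of composition it ends on part 1, in the other on part
      2.\<close>
    obtain x where x: "x \<in> star (P 0)" using star_empty_iff inf[of 0] by auto
    then have xf: "x \<in> free_ultrafilters" "x (P 0)" by (auto simp: star_def)
    have v: "\<pi> -` P 1 = P 0" "\<rho> -` P 2 = P 1" using \<pi>(2) \<rho>(2) by blast+
    have p: "push \<pi> x \<in> free_ultrafilters" "push \<rho> (push \<pi> x) \<in> free_ultrafilters"
      using push_free_ultrafilters inj xf by auto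
    have "push \<rho> x = x"
    proof (rule push_id_on_fixed[OF xf(1)])
      have "P 0 \<subseteq> {n. \<rho> n = n}" using \<rho>(3) disj[of 0 1] disj[of 0 2] by auto
      then show "x {n. \<rho> n = n}" using free_ultrafiltersD(4)[OF xf(1)] xf(2) by blast
    qed
    then have 1: "?f (?h x) = push \<pi> x" using xf p by simp
    have 2: "?h (?f x) = push \<rho> (push \<pi> x)" using xf p by simp
    have "push \<pi> x (P 1)" using v xf by (simp add: push_def)
    then have "push \<rho> (push \<pi> x) (P 2)" using v by (simp add: push_def[of \<rho>])
    moreover have "\<not> push \<pi> x (P 2)"
    proof
      assume "push \<pi> x (P 2)"
      then have "push \<pi> x (P 1 \<inter> P 2)" using \<open>push \<pi> x (P 1)\<close> p(1) by (simp add: free_ultrafiltersD(1))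
      then show False using disj[of 1 2] free_ultrafiltersD(3)[OF p(1), of "{}"] by simp
    qed
    ultimately have "push \<pi> x \<noteq> push \<rho> (push \<pi> x)" by metis
    then show "\<exists>x\<in>topspace omega_star. ?f (?h x) \<noteq> ?h (?f x)"
      unfolding omega_star_basics(4) using xf(1) 1 2 by (intro bexI[of _ x]) simp_all
  qed
qed

section \<open>Towers of clopen algebras\<close>

text \<open>Pairing lets one \<open>nat set\<close> code a sequence of them. A gap between countable
  families is thus named by a single index, and continuum many indices on each level suffice for all
  gaps.\<close>

definition decode_seq :: "nat set \<Rightarrow> nat \<Rightarrow> nat set"
  where "decode_seq j n = {m. prod_encode (n, m) \<in> j}"

lemma decode_seq_surj: "\<exists>j. decode_seq j = s"
proof
  show "decode_seq {k. snd (prod_decode k) \<in> s (fst (prod_decode k))} = s"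
    by (simp add: decode_seq_def fun_eq_iff)
qed

text \<open>\<open>bounded\<close> is regularity in the form used: fewer than r levels lie strictly
  below one level. \<open>e\<close> lets a \<open>nat set\<close> name any cylinder set over
  \<open>J\<close>, of which there are at most continuum many.\<close>

locale tower =
  fixes r :: "'k rel" and e :: "nat set \<Rightarrow> ('k \<times> nat set \<Rightarrow> bool) set"
  assumes wo: "Well_order r"
    and bounded: "\<And>S. S \<subseteq> Field r \<Longrightarrow> |S| <o r \<Longrightarrow> \<exists>k\<in>Field r. S \<subseteq> underS r k"
    and uncountable: "natLeq <o r"
    and card_le: "r \<le>o |UNIV :: nat set set|"
    and range_e: "range e = finitely_determined (Field r \<times> UNIV)"
begin

abbreviation J :: "('k \<times> nat set) set" where "J \<equiv> Field r \<times> UNIV"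

text \<open>The projection to the levels below \<open>\<alpha>\<close>, realized inside the same
  cube by making all other coordinates false.\<close>

definition cut_at :: "'k \<Rightarrow> ('k \<times> nat set \<Rightarrow> bool) \<Rightarrow> 'k \<times> nat set \<Rightarrow> bool"
  where "cut_at \<alpha> x = (\<lambda>i. fst i \<in> underS r \<alpha> \<and> x i)"

text \<open>The constraint assignment is a parameter because the constraints on a level depend on
  the points that obey those on lower levels; well-founded recursion fixes it later.\<close>

definition obeys :: "('k \<Rightarrow> nat set \<Rightarrow> ('k \<times> nat set \<Rightarrow> bool) set \<times> ('k \<times> nat set \<Rightarrow> bool) set) \<Rightarrow>
    'k \<Rightarrow> ('k \<times> nat set \<Rightarrow> bool) \<Rightarrow> bool"
  where "obeys f \<alpha> x \<longleftrightarrow> (\<forall>j. (cut_at \<alpha> x \<in> fst (f \<alpha> j) \<longrightarrow> x (\<alpha>, j)) \<and> (cut_at \<alpha> x \<in> snd (f \<alpha> j) \<longrightarrow> \<not> x (\<alpha>, j)))"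

definition obeys_below :: "('k \<Rightarrow> nat set \<Rightarrow> ('k \<times> nat set \<Rightarrow> bool) set \<times> ('k \<times> nat set \<Rightarrow> bool) set) \<Rightarrow>
    'k \<Rightarrow> ('k \<times> nat set \<Rightarrow> bool) set"
  where "obeys_below f \<alpha> = {x. \<forall>\<beta>\<in>underS r \<alpha>. obeys f \<beta> x}"

text \<open>Position 0 of the code is reserved, odd positions list one family and positive even
  positions the other. If the two unions meet at the projection of an admissible point, the code
  names no gap and the variable stays unconstrained, so that no contradictory demand arises.\<close>

definition gap :: "('k \<times> nat set \<Rightarrow> bool) set \<Rightarrow> 'k \<Rightarrow> (nat \<Rightarrow> nat set) \<Rightarrow>
    ('k \<times> nat set \<Rightarrow> bool) set \<times> ('k \<times> nat set \<Rightarrow> bool) set"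
  where "gap A \<alpha> s = (if \<exists>x\<in>A. cut_at \<alpha> x \<in> (\<Union>n. e (s (2 * n + 1))) \<inter> (\<Union>n. e (s (2 * n + 2))) then ({}, {})
    else (\<Union>n. e (s (2 * n + 1)), \<Union>n. e (s (2 * n + 2))))"

definition point :: "('k \<times> nat set \<Rightarrow> bool) set \<Rightarrow> 'k \<Rightarrow> (nat \<Rightarrow> nat set) \<Rightarrow>
    ('k \<times> nat set \<Rightarrow> bool) set \<times> ('k \<times> nat set \<Rightarrow> bool) set"
  where "point A \<alpha> s = (if \<exists>x\<in>A. cut_at \<alpha> x \<in> e (s 1)
    then ({}, - {cut_at \<alpha> (SOME x. x \<in> A \<and> cut_at \<alpha> x \<in> e (s 1))}) else ({}, {}))"

text \<open>The coordinate \<^term>\<open>(\<alpha>, j)\<close> of a point is forced to be true on the first set and false on the second,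
  and is unconstrained elsewhere. A gap variable separates two countable families of clopen sets of the levels
  below \<^term>\<open>\<alpha>\<close>; a point variable can be true at a single point of these levels only, so the clopen set it
  defines decides all clopen sets below \<^term>\<open>\<alpha>\<close>. Entry 0 of the sequence coded by \<^term>\<open>j\<close> selects the kind
  of variable; entry 2 of the code of a point variable is a dummy, so codes of the empty clopen set supply
  continuum many unconstrained variables on each level.\<close>

definition constraint :: "'k \<Rightarrow> nat set \<Rightarrow> ('k \<times> nat set \<Rightarrow> bool) set \<times> ('k \<times> nat set \<Rightarrow> bool) set"
  where "constraint = wfrec (r - Id) (\<lambda>f \<alpha> j. let s = decode_seq j in
    if s 0 = {} then gap (obeys_below f \<alpha>) \<alpha> s else point (obeys_below f \<alpha>) \<alpha> s)"

abbreviation Lft where "Lft \<alpha> j \<equiv> fst (constraint \<alpha> j)"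
abbreviation Rgt where "Rgt \<alpha> j \<equiv> snd (constraint \<alpha> j)"
abbreviation Ob where "Ob \<equiv> obeys_below constraint"

text \<open>The limit of the tower. The second condition pins the coordinates outside
  \<open>J\<close>, so that clopen sets depend on coordinates in \<open>J\<close> alone.\<close>

definition carr :: "('k \<times> nat set \<Rightarrow> bool) set"
  where "carr = {x. (\<forall>\<alpha>\<in>Field r. obeys constraint \<alpha> x) \<and> (\<forall>i. i \<notin> J \<longrightarrow> \<not> x i)}"

definition space :: "('k \<times> nat set \<Rightarrow> bool) topology"
  where "space = subtopology cantor_cube carr"

definition below :: "'k \<Rightarrow> ('k \<times> nat set \<Rightarrow> bool) set \<Rightarrow> bool"
  where "below \<alpha> D \<longleftrightarrow> (\<forall>x. cut_at \<alpha> x \<in> D \<longleftrightarrow> x \<in> D)"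

section \<open>Consistency of the constraints and extension of points\<close>

lemma wf_r: "wf (r - Id)"
  using wo by (simp add: well_order_on_def)

lemma underS_Field: "\<beta> \<in> underS r \<alpha> \<Longrightarrow> \<beta> \<in> Field r" "\<beta> \<in> underS r \<alpha> \<Longrightarrow> \<alpha> \<in> Field r"
  by (auto simp: underS_def Field_def)

lemma underS_iff: "\<beta> \<in> underS r \<alpha> \<longleftrightarrow> (\<beta>, \<alpha>) \<in> r - Id"
  by (auto simp: underS_def)

lemma underS_trans: "\<gamma> \<in> underS r \<beta> \<Longrightarrow> \<beta> \<in> underS r \<alpha> \<Longrightarrow> \<gamma> \<in> underS r \<alpha>"
  using wo unfolding well_order_on_def linear_order_on_def partial_order_on_def preorder_on_def
  by (auto simp: underS_def dest: transD antisymD)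

lemma obeys_below_cong:
  assumes "\<And>\<beta>. \<beta> \<in> underS r \<alpha> \<Longrightarrow> f \<beta> = g \<beta>"
  shows "obeys_below f \<alpha> = obeys_below g \<alpha>"
  using assms by (simp add: obeys_below_def obeys_def)

lemma constraint_eq:
  "constraint \<alpha> j = (if decode_seq j 0 = {} then gap (Ob \<alpha>) \<alpha> (decode_seq j) else point (Ob \<alpha>) \<alpha> (decode_seq j))"
proof -
  have "obeys_below (cut constraint (r - Id) \<alpha>) \<alpha> = Ob \<alpha>"
    by (rule obeys_below_cong) (simp add: cut_def underS_iff)
  then show ?thesis
    unfolding constraint_def by (subst wfrec[OF wf_r]) (simp add: constraint_def Let_def)
qed

text \<open>The guard in \<open>gap\<close> excludes a conflict at admissible points, and point
  variables are never forced to be true.\<close>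

lemma constraint_disjoint: "x \<in> Ob \<alpha> \<Longrightarrow> cut_at \<alpha> x \<in> Lft \<alpha> j \<Longrightarrow> cut_at \<alpha> x \<notin> Rgt \<alpha> j"
proof -
  assume x: "x \<in> Ob \<alpha>" and L: "cut_at \<alpha> x \<in> Lft \<alpha> j"
  have g: "z \<notin> snd (gap A \<alpha> s)" if "x \<in> A" "z = cut_at \<alpha> x" "z \<in> fst (gap A \<alpha> s)" for A s z
    using that unfolding gap_def by (auto split: if_splits)
  have p: "z \<notin> fst (point A \<alpha> s)" for A s z by (simp add: point_def)
  show "cut_at \<alpha> x \<notin> Rgt \<alpha> j"
    using constraint_eq[of \<alpha> j] g[OF x refl] p L by metis
qed

text \<open>Makes \<open>carr\<close> closed: a violated constraint is violated on an open set. Each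
  side is empty, a union of cylinder sets or the complement of a point, pulled back along the
  continuous projection.\<close>

lemma constraint_open:
  assumes "U = Lft \<alpha> j \<or> U = Rgt \<alpha> j"
  shows "openin cantor_cube {x. cut_at \<alpha> x \<in> U}"
proof -
  have fd: "{x. cut_at \<alpha> x \<in> D} \<in> finitely_determined UNIV" if D: "D \<in> finitely_determined K" for D K
  proof -
    obtain F where F: "finite F" "F \<subseteq> K" "\<forall>x y. (\<forall>i\<in>F. x i = y i) \<longrightarrow> (x \<in> D \<longleftrightarrow> y \<in> D)"
      by (rule finitely_determinedE[OF D])
    show ?thesis
    proof (rule finitely_determinedI[OF F(1)])
      fix x y :: "'k \<times> nat set \<Rightarrow> bool" assume "\<forall>i\<in>F. x i = y i"
      then have "\<forall>i\<in>F. cut_at \<alpha> x i = cut_at \<alpha> y i" by (simp add: cut_at_def)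
      then show "x \<in> {x. cut_at \<alpha> x \<in> D} \<longleftrightarrow> y \<in> {x. cut_at \<alpha> x \<in> D}" using F(3) by blast
    qed simp
  qed
  have un: "openin cantor_cube {x. cut_at \<alpha> x \<in> (\<Union>n. e (s n))}" for s :: "nat \<Rightarrow> nat set"
  proof -
    have "openin cantor_cube (\<Union>n. {x. cut_at \<alpha> x \<in> e (s n)})"
      using fd range_e by (intro openin_Union) (blast intro: openin_finitely_determined)
    moreover have "{x. cut_at \<alpha> x \<in> (\<Union>n. e (s n))} = (\<Union>n. {x. cut_at \<alpha> x \<in> e (s n)})" by auto
    ultimately show ?thesis by simp
  qed
  have pt: "openin cantor_cube {x. cut_at \<alpha> x \<in> - {p}}" for p
  proof -
    have "{x. cut_at \<alpha> x i \<noteq> p i} \<in> finitely_determined UNIV" for i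
      by (rule finitely_determinedI[of "{i}"]) (auto simp: cut_at_def)
    then have "openin cantor_cube (\<Union>i. {x. cut_at \<alpha> x i \<noteq> p i})"
      by (intro openin_Union) (blast intro: openin_finitely_determined)
    moreover have "{x. cut_at \<alpha> x \<in> - {p}} = (\<Union>i. {x. cut_at \<alpha> x i \<noteq> p i})" by (auto simp: fun_eq_iff)
    ultimately show ?thesis by simp
  qed
  have em: "openin cantor_cube {x. cut_at \<alpha> x \<in> {}}" by simp
  have g: "openin cantor_cube {x. cut_at \<alpha> x \<in> fst (gap A \<alpha> s)}" "openin cantor_cube {x. cut_at \<alpha> x \<in> snd (gap A \<alpha> s)}" for A s
    unfolding gap_def
    using un[of "\<lambda>n. s (2 * n + 1)"] un[of "\<lambda>n. s (2 * n + 2)"] em by (simp_all split: if_split)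
  have p: "openin cantor_cube {x. cut_at \<alpha> x \<in> fst (point A \<alpha> s)}" "openin cantor_cube {x. cut_at \<alpha> x \<in> snd (point A \<alpha> s)}" for A s
    unfolding point_def using pt em by (simp_all split: if_split)
  show ?thesis using constraint_eq[of \<alpha> j] g p assms by metis
qed

lemma closedin_carr: "closedin cantor_cube carr"
proof -
  have "openin cantor_cube (- carr)"
  proof (subst openin_subopen, intro ballI)
    fix x assume "x \<in> - carr"
    then consider \<alpha> j where "\<alpha> \<in> Field r" "cut_at \<alpha> x \<in> Lft \<alpha> j" "\<not> x (\<alpha>, j)"
      | \<alpha> j where "\<alpha> \<in> Field r" "cut_at \<alpha> x \<in> Rgt \<alpha> j" "x (\<alpha>, j)"
      | i where "i \<notin> J" "x i" unfolding carr_def obeys_def by blast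
    then show "\<exists>T. openin cantor_cube T \<and> x \<in> T \<and> T \<subseteq> - carr"
    proof cases
      case 1
      have "openin cantor_cube ({x. cut_at \<alpha> x \<in> Lft \<alpha> j} \<inter> - {x. x (\<alpha>, j)})"
        by (rule openin_Int[OF constraint_open[OF disjI1[OF refl]]
            openin_finitely_determined[OF finitely_determined_Compl[OF finitely_determined_coord[OF UNIV_I]]]])
      then show ?thesis using 1 by (intro exI[of _ "{x. cut_at \<alpha> x \<in> Lft \<alpha> j} \<inter> - {x. x (\<alpha>, j)}"]) (auto simp: carr_def obeys_def)
    next
      case 2
      have "openin cantor_cube ({x. cut_at \<alpha> x \<in> Rgt \<alpha> j} \<inter> {x. x (\<alpha>, j)})"
        by (rule openin_Int[OF constraint_open[OF disjI2[OF refl]]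
            openin_finitely_determined[OF finitely_determined_coord[OF UNIV_I]]])
      then show ?thesis using 2 by (intro exI[of _ "{x. cut_at \<alpha> x \<in> Rgt \<alpha> j} \<inter> {x. x (\<alpha>, j)}"]) (auto simp: carr_def obeys_def)
    next
      case 3
      have "openin cantor_cube {x. x i}" by (rule openin_finitely_determined[OF finitely_determined_coord[OF UNIV_I]])
      then show ?thesis using 3 by (intro exI[of _ "{x. x i}"], cases i) (auto simp: carr_def)
    qed
  qed
  then show ?thesis by (simp add: closedin_def Compl_eq_Diff_UNIV)
qed

lemmas space_basics = closed_subspace_cantor_cube[OF closedin_carr, folded space_def]

lemma carr_Ob: "x \<in> carr \<Longrightarrow> x \<in> Ob \<alpha>"
  using underS_Field by (auto simp: carr_def obeys_below_def)

lemma carr_obeys: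
  assumes "x \<in> carr" "\<alpha> \<in> Field r"
  shows "cut_at \<alpha> x \<in> Lft \<alpha> j \<Longrightarrow> x (\<alpha>, j)" "cut_at \<alpha> x \<in> Rgt \<alpha> j \<Longrightarrow> \<not> x (\<alpha>, j)"
  using assms by (auto simp: carr_def obeys_def)

text \<open>Projections to lower levels are onto, with free prescription of unconstrained values.
  The point is built by recursion on levels: it copies \<open>y\<close> below
  \<open>\<alpha>\<close>, obeys the constraints from \<open>\<alpha>\<close> on, and takes the
  default \<open>d\<close> where none applies. As the part already built is admissible, it is never
  forced both ways.\<close>

lemma extension:
  assumes y: "y \<in> Ob \<alpha>"
  obtains x where "x \<in> carr" "cut_at \<alpha> x = cut_at \<alpha> y"
    "\<And>\<beta> j. \<beta> \<in> Field r \<Longrightarrow> \<beta> \<notin> underS r \<alpha> \<Longrightarrow> cut_at \<beta> x \<notin> Lft \<beta> j \<Longrightarrow> cut_at \<beta> x \<notin> Rgt \<beta> j \<Longrightarrow> x (\<beta>, j) = d (\<beta>, j)"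
proof -
  define H where "H = (\<lambda>f \<beta> j. \<beta> \<in> Field r \<and> (if \<beta> \<in> underS r \<alpha> then y (\<beta>, j)
    else let z = cut_at \<beta> (case_prod f) in if z \<in> Lft \<beta> j then True else if z \<in> Rgt \<beta> j then False else d (\<beta>, j)))"
  define v where "v = wfrec (r - Id) H"
  define x where "x = case_prod v"
  have cut: "cut_at \<beta> (case_prod (cut v (r - Id) \<beta>)) = cut_at \<beta> x" for \<beta>
    by (auto simp: cut_at_def x_def fun_eq_iff cut_def underS_iff)
  have v: "v \<beta> = H (cut v (r - Id) \<beta>) \<beta>" for \<beta> unfolding v_def by (rule wfrec[OF wf_r])
  have x: "x (\<beta>, j) \<longleftrightarrow> \<beta> \<in> Field r \<and> (if \<beta> \<in> underS r \<alpha> then y (\<beta>, j)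
    else if cut_at \<beta> x \<in> Lft \<beta> j then True else if cut_at \<beta> x \<in> Rgt \<beta> j then False else d (\<beta>, j))" for \<beta> j
    using fun_cong[OF v[of \<beta>], of j] unfolding H_def Let_def cut by (simp add: x_def)
  have eq: "cut_at \<beta> x = cut_at \<beta> y" if "\<beta> = \<alpha> \<or> \<beta> \<in> underS r \<alpha>" for \<beta>
  proof
    fix i :: "'k \<times> nat set"
    obtain \<gamma> j where i: "i = (\<gamma>, j)" by (cases i)
    have "x (\<gamma>, j) = y (\<gamma>, j)" if "\<gamma> \<in> underS r \<alpha>" using x[of \<gamma> j] that underS_Field(1)[OF that] by simp
    moreover have "\<gamma> \<in> underS r \<alpha>" if "\<gamma> \<in> underS r \<beta>" using that \<open>\<beta> = \<alpha> \<or> \<beta> \<in> underS r \<alpha>\<close> underS_trans by blast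
    ultimately show "cut_at \<beta> x i = cut_at \<beta> y i" unfolding cut_at_def i by auto
  qed
  have ob: "\<beta> \<in> Field r \<Longrightarrow> obeys constraint \<beta> x" for \<beta>
  proof (induction \<beta> rule: wf_induct_rule[OF wf_r])
    case (1 \<beta>)
    show ?case
    proof (cases "\<beta> \<in> underS r \<alpha>")
      case True
      then have "obeys constraint \<beta> y" using y by (simp add: obeys_below_def)
      moreover have "x (\<beta>, j) = y (\<beta>, j)" for j using x[of \<beta> j] True 1(2) by simp
      ultimately show ?thesis using eq[of \<beta>] True by (simp add: obeys_def)
    next
      case False
      have "x \<in> Ob \<beta>" using 1(1) underS_Field by (auto simp: obeys_below_def underS_iff)
      then have "cut_at \<beta> x \<in> Lft \<beta> j \<Longrightarrow> cut_at \<beta> x \<notin> Rgt \<beta> j" for j by (rule constraint_disjoint)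
      moreover have "x (\<beta>, j) \<longleftrightarrow> (if cut_at \<beta> x \<in> Lft \<beta> j then True else if cut_at \<beta> x \<in> Rgt \<beta> j then False else d (\<beta>, j))" for j
        using x[of \<beta> j] False 1(2) by simp
      ultimately show ?thesis unfolding obeys_def by metis
    qed
  qed
  show ?thesis
  proof
    have "\<not> x i" if "i \<notin> J" for i using x[of "fst i" "snd i"] that by (cases i) simp
    then show "x \<in> carr" using ob unfolding carr_def by blast
    show "cut_at \<alpha> x = cut_at \<alpha> y" using eq by blast
    show "x (\<beta>, j) = d (\<beta>, j)" if "\<beta> \<in> Field r" "\<beta> \<notin> underS r \<alpha>" "cut_at \<beta> x \<notin> Lft \<beta> j" "cut_at \<beta> x \<notin> Rgt \<beta> j" for \<beta> j
      using x[of \<beta> j] that by simp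
  qed
qed

section \<open>Levels of clopen sets and the kinds of variables\<close>

text \<open>Each cylinder set uses finitely many levels. Infinitely many sets use no more levels
  than there are sets; finitely many use finitely many, which is fewer than r as r is
  uncountable.\<close>

lemma below_ex:
  assumes "\<D> \<subseteq> finitely_determined J" "|\<D>| <o r"
  obtains \<alpha> where "\<alpha> \<in> Field r" "\<And>D. D \<in> \<D> \<Longrightarrow> below \<alpha> D"
proof -
  have "\<forall>D. \<exists>F. D \<in> \<D> \<longrightarrow> finite F \<and> F \<subseteq> J \<and> (\<forall>x y. (\<forall>i\<in>F. x i = y i) \<longrightarrow> (x \<in> D \<longleftrightarrow> y \<in> D))"
  proof
    fix D
    show "\<exists>F. D \<in> \<D> \<longrightarrow> finite F \<and> F \<subseteq> J \<and> (\<forall>x y. (\<forall>i\<in>F. x i = y i) \<longrightarrow> (x \<in> D \<longleftrightarrow> y \<in> D))"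
      using assms(1) unfolding finitely_determined_def by (cases "D \<in> \<D>") auto
  qed
  from choice[OF this] obtain F where F0: "\<forall>D. D \<in> \<D> \<longrightarrow> finite (F D) \<and> F D \<subseteq> J \<and>
      (\<forall>x y. (\<forall>i\<in>F D. x i = y i) \<longrightarrow> (x \<in> D \<longleftrightarrow> y \<in> D))" by (elim exE)
  have F: "\<And>D. D \<in> \<D> \<Longrightarrow> finite (F D)" "\<And>D. D \<in> \<D> \<Longrightarrow> F D \<subseteq> J"
    "\<And>D. D \<in> \<D> \<Longrightarrow> \<forall>x y. (\<forall>i\<in>F D. x i = y i) \<longrightarrow> (x \<in> D \<longleftrightarrow> y \<in> D)"
    using F0 by simp_all
  define S where "S = (\<Union>D\<in>\<D>. fst ` F D)"
  have "|S| <o r"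
  proof (cases "finite \<D>")
    case True
    then have "finite S" using F(1) by (simp add: S_def)
    then have "|S| \<le>o natLeq" using countable_card_le_natLeq[of S] by (simp add: countable_finite)
    then show ?thesis using uncountable ordLeq_ordLess_trans by blast
  next
    case False
    have "|fst ` F D| \<le>o |\<D>|" if "D \<in> \<D>" for D
    proof -
      have "|fst ` F D| \<le>o |UNIV :: nat set|"
        using countable_card_of_nat[of "fst ` F D"] F(1)[OF that] by (simp add: countable_finite)
      then show ?thesis using False infinite_iff_card_of_nat ordLeq_transitive by blast
    qed
    then have "|S| \<le>o |\<D>|" unfolding S_def using False card_of_mono1[OF subset_refl]
      by (intro card_of_UNION_ordLeq_infinite) auto
    then show ?thesis using assms(2) ordLeq_ordLess_trans by blast
  qed
  moreover have "S \<subseteq> Field r" using F(2) by (force simp: S_def)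
  ultimately obtain \<alpha> where \<alpha>: "\<alpha> \<in> Field r" "S \<subseteq> underS r \<alpha>" using bounded by blast
  have "below \<alpha> D" if "D \<in> \<D>" for D unfolding below_def
  proof
    fix x
    have "fst i \<in> underS r \<alpha>" if "i \<in> F D" for i using \<alpha>(2) \<open>D \<in> \<D>\<close> that by (auto simp: S_def)
    then have "\<forall>i\<in>F D. cut_at \<alpha> x i = x i" by (auto simp: cut_at_def)
    then show "cut_at \<alpha> x \<in> D \<longleftrightarrow> x \<in> D" using F(3)[OF that] by blast
  qed
  then show ?thesis using that \<alpha>(1) by blast
qed

lemma below_countable:
  assumes "countable \<D>" "\<D> \<subseteq> finitely_determined J"
  obtains \<alpha> where "\<alpha> \<in> Field r" "\<And>D. D \<in> \<D> \<Longrightarrow> below \<alpha> D"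
proof -
  have "|\<D>| \<le>o natLeq" using assms(1) by (simp add: countable_card_le_natLeq)
  then have "|\<D>| <o r" using uncountable ordLeq_ordLess_trans by blast
  from below_ex[OF assms(2) this] show ?thesis using that by blast
qed

lemma clopens_space: "clopens space = (\<lambda>D. D \<inter> carr) ` finitely_determined J"
proof
  show "(\<lambda>D. D \<inter> carr) ` finitely_determined J \<subseteq> clopens space"
    unfolding space_basics(5) using finitely_determined_mono[of J UNIV] by blast
  show "clopens space \<subseteq> (\<lambda>D. D \<inter> carr) ` finitely_determined J"
  proof
    fix C assume "C \<in> clopens space"
    then obtain D where D: "D \<in> finitely_determined UNIV" "C = D \<inter> carr" unfolding space_basics(5) by blast
    obtain F where F: "finite F" "F \<subseteq> UNIV" "\<forall>x y. (\<forall>i\<in>F. x i = y i) \<longrightarrow> (x \<in> D \<longleftrightarrow> y \<in> D)"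
      using finitely_determinedE[OF D(1)] .
    \<comment> \<open>Coordinates outside \<open>J\<close> are false on \<open>carr\<close>;
      substituting false for them gives a cylinder set over \<open>J\<close> with the same
      trace.\<close>
    define D' where "D' = {x. (\<lambda>i. i \<in> J \<and> x i) \<in> D}"
    have "D' \<in> finitely_determined J"
    proof (rule finitely_determinedI[of "F \<inter> J"])
      fix x y :: "'k \<times> nat set \<Rightarrow> bool" assume "\<forall>i\<in>F \<inter> J. x i = y i"
      then have "\<forall>i\<in>F. (i \<in> J \<and> x i) = (i \<in> J \<and> y i)" by blast
      then show "x \<in> D' \<longleftrightarrow> y \<in> D'"
        using F(3)[THEN spec[of _ "\<lambda>i. i \<in> J \<and> x i"], THEN spec[of _ "\<lambda>i. i \<in> J \<and> y i"]] by (simp add: D'_def)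
    qed (use F(1) in auto)
    moreover have "D' \<inter> carr = C"
    proof -
      have "(\<lambda>i. i \<in> J \<and> x i) = x" if "x \<in> carr" for x using that unfolding carr_def by blast
      then show ?thesis unfolding D(2) D'_def by auto
    qed
    ultimately show "C \<in> (\<lambda>D. D \<inter> carr) ` finitely_determined J" by blast
  qed
qed

lemma coord_clopen: "\<alpha> \<in> Field r \<Longrightarrow> {x \<in> carr. x (\<alpha>, j)} \<in> clopens space"
  unfolding clopens_space by (intro image_eqI[of _ _ "{x. x (\<alpha>, j)}"] finitely_determined_coord) auto

lemma gap_variable:
  fixes A B :: "nat \<Rightarrow> ('k \<times> nat set \<Rightarrow> bool) set"
  assumes A: "\<And>n. A n \<in> finitely_determined J" "\<And>n. below \<alpha> (A n)"
    and B: "\<And>n. B n \<in> finitely_determined J" "\<And>n. below \<alpha> (B n)"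
    and disj: "\<And>m n. A m \<inter> B n \<inter> carr = {}"
  obtains j where "Lft \<alpha> j = (\<Union>n. A n)" "Rgt \<alpha> j = (\<Union>n. B n)"
proof -
  have "\<forall>n. \<exists>s. A n = e s" "\<forall>n. \<exists>s. B n = e s" using A(1) B(1) range_e by (metis imageE)+
  then obtain cA cB where c: "\<And>n. A n = e (cA n)" "\<And>n. B n = e (cB n)" by metis
  \<comment> \<open>The empty entry 0 selects a gap; the divisions match the positions 2n+1 and 2n+2
    read by \<open>gap\<close>.\<close>
  obtain j where j: "decode_seq j = (\<lambda>k. if k = 0 then {} else if odd k then cA (k div 2) else cB (k div 2 - 1))"
    using decode_seq_surj by blast
  have L: "(\<Union>n. e (decode_seq j (2 * n + 1))) = (\<Union>n. A n)" and R: "(\<Union>n. e (decode_seq j (2 * n + 2))) = (\<Union>n. B n)"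
    unfolding j c by simp_all
  \<comment> \<open>Disjointness is known on \<open>carr\<close>, whereas the guard of
    \<open>gap\<close> concerns \<open>Ob \<alpha>\<close>; extending a point of the latter bridges
    the difference.\<close>
  have "\<not> (\<exists>x\<in>Ob \<alpha>. cut_at \<alpha> x \<in> (\<Union>n. A n) \<inter> (\<Union>n. B n))"
  proof
    assume "\<exists>x\<in>Ob \<alpha>. cut_at \<alpha> x \<in> (\<Union>n. A n) \<inter> (\<Union>n. B n)"
    then obtain y m n where y: "y \<in> Ob \<alpha>" "cut_at \<alpha> y \<in> A m" "cut_at \<alpha> y \<in> B n" by blast
    obtain x where x: "x \<in> carr" "cut_at \<alpha> x = cut_at \<alpha> y" using extension[OF y(1)] by metis
    then have "x \<in> A m" "x \<in> B n" using A(2) B(2) y unfolding below_def by metis+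
    then show False using disj x by blast
  qed
  then have "gap (Ob \<alpha>) \<alpha> (decode_seq j) = (\<Union>n. A n, \<Union>n. B n)" unfolding gap_def L R by (rule if_not_P)
  moreover have "constraint \<alpha> j = gap (Ob \<alpha>) \<alpha> (decode_seq j)" using constraint_eq[of \<alpha> j] j by simp
  ultimately have "Lft \<alpha> j = (\<Union>n. A n)" "Rgt \<alpha> j = (\<Union>n. B n)" by simp_all
  then show ?thesis by (rule that)
qed

lemma free_variable: "\<exists>j. Lft \<alpha> j = {} \<and> Rgt \<alpha> j = {} \<and> decode_seq j 2 = c"
proof -
  obtain s where s: "e s = {}" using range_e finitely_determined_empty by (metis imageE)
  \<comment> \<open>A nonempty entry 0 selects a point variable. As entry 1 names the empty set,
    there is no point to choose and nothing is forced; entry 2 carries the label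
    \<open>c\<close>.\<close>
  obtain j where j: "decode_seq j = (\<lambda>k. if k = 0 then {0} else if k = 1 then s else c)"
    using decode_seq_surj by blast
  have "point (Ob \<alpha>) \<alpha> (decode_seq j) = ({}, {})" unfolding point_def j by (simp add: s)
  moreover have "constraint \<alpha> j = point (Ob \<alpha>) \<alpha> (decode_seq j)" using constraint_eq[of \<alpha> j] j by simp
  ultimately have "constraint \<alpha> j = ({}, {})" by simp
  then show ?thesis using j by (intro exI[of _ j]) simp
qed

lemma point_variable:
  assumes D: "D \<in> finitely_determined J" "below \<alpha> D" "D \<inter> carr \<noteq> {}"
  obtains j p where "p \<in> Ob \<alpha>" "p \<in> D" "Lft \<alpha> j = {}" "Rgt \<alpha> j = - {cut_at \<alpha> p}"
proof -
  obtain s where s: "e s = D" using D(1) range_e by (metis imageE)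
  obtain j where j: "decode_seq j = (\<lambda>k. if k = 0 then {0} else s)"
    using decode_seq_surj by blast
  define p where "p = (SOME x. x \<in> Ob \<alpha> \<and> cut_at \<alpha> x \<in> D)"
  have ex: "\<exists>x. x \<in> Ob \<alpha> \<and> cut_at \<alpha> x \<in> D" using D(2,3) carr_Ob unfolding below_def by blast
  then have p: "p \<in> Ob \<alpha>" "cut_at \<alpha> p \<in> D" unfolding p_def by (metis (mono_tags, lifting) someI_ex)+
  have "decode_seq j 1 = s" using j by simp
  then have "point (Ob \<alpha>) \<alpha> (decode_seq j) = ({}, - {cut_at \<alpha> p})"
    unfolding point_def p_def using ex by (simp add: s Bex_def)
  moreover have "constraint \<alpha> j = point (Ob \<alpha>) \<alpha> (decode_seq j)" using constraint_eq[of \<alpha> j] j by simp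
  ultimately have "Lft \<alpha> j = {}" "Rgt \<alpha> j = - {cut_at \<alpha> p}" by simp_all
  moreover have "p \<in> D" using p(2) D(2) by (simp add: below_def)
  ultimately show ?thesis using that[OF p(1)] by simp
qed

text \<open>Extending from level \<open>\<alpha>\<close> with default \<open>b\<close> keeps the
  projection, hence membership in \<open>D\<close>, and gives the free coordinate the value
  \<open>b\<close>.\<close>

lemma free_variable_splits:
  assumes D: "below \<alpha> D" "D \<inter> carr \<noteq> {}" and \<alpha>: "\<alpha> \<in> Field r" and j: "Lft \<alpha> j = {}" "Rgt \<alpha> j = {}"
  shows "\<exists>x\<in>D \<inter> carr. x (\<alpha>, j) = b"
proof -
  obtain y where y: "y \<in> D" "y \<in> carr" using D(2) by blast
  obtain x where x: "x \<in> carr" "cut_at \<alpha> x = cut_at \<alpha> y" "\<And>\<beta> j. \<beta> \<in> Field r \<Longrightarrow> \<beta> \<notin> underS r \<alpha> \<Longrightarrow>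
      cut_at \<beta> x \<notin> Lft \<beta> j \<Longrightarrow> cut_at \<beta> x \<notin> Rgt \<beta> j \<Longrightarrow> x (\<beta>, j) = (\<lambda>_. b) (\<beta>, j)"
    using extension[OF carr_Ob[OF y(2), of \<alpha>], of "\<lambda>_. b"] by blast
  have "\<alpha> \<notin> underS r \<alpha>" by (simp add: underS_def)
  then have "x (\<alpha>, j) = b" using x(3)[OF \<alpha>] j by simp
  moreover have "x \<in> D" using D(1) x(2) y(1) unfolding below_def by metis
  ultimately show ?thesis using x(1) by blast
qed

lemma Field_nonempty: "Field r \<noteq> {}"
proof -
  have "|{} :: 'k set| <o r"
    using uncountable countable_card_le_natLeq[of "{} :: 'k set"] ordLeq_ordLess_trans by blast
  then show ?thesis using bounded[of "{}"] by blast
qed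

text \<open>On the least level nothing is required from below, so any point can be extended.\<close>

lemma carr_nonempty: "carr \<noteq> {}"
proof -
  obtain \<alpha> where \<alpha>: "\<alpha> \<in> Field r" "\<And>\<beta>. (\<beta>, \<alpha>) \<in> r - Id \<Longrightarrow> \<beta> \<notin> Field r"
    using wf_r Field_nonempty unfolding wf_eq_minimal by blast
  have "False" if "\<beta> \<in> underS r \<alpha>" for \<beta>
    using \<alpha>(2)[of \<beta>] underS_Field(1)[OF that] that by (simp add: underS_iff)
  then have "underS r \<alpha> = {}" by blast
  then have "(\<lambda>_. False) \<in> Ob \<alpha>" by (simp add: obeys_below_def)
  from extension[OF this] show ?thesis by blast
qed

text \<open>Regularity puts all members under one level, and a free variable on that level takes
  both values inside each of them.\<close>

lemma small_family_split:
  assumes W: "W \<subseteq> clopens space" "{} \<notin> W" "|W| <o r"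
  shows "\<exists>c\<in>clopens space. \<forall>w\<in>W. \<not> w \<subseteq> c \<and> w \<inter> c \<noteq> {}"
proof -
  have "\<forall>w\<in>W. \<exists>D. D \<in> finitely_determined J \<and> w = D \<inter> carr" using W(1) unfolding clopens_space by blast
  from bchoice[OF this] obtain D where D: "\<forall>w\<in>W. D w \<in> finitely_determined J \<and> w = D w \<inter> carr" by (elim exE)
  have "D ` W \<subseteq> finitely_determined J" using D by blast
  moreover have "|D ` W| <o r" using card_of_image W(3) ordLeq_ordLess_trans by blast
  ultimately obtain \<alpha> where \<alpha>: "\<alpha> \<in> Field r" "\<And>E. E \<in> D ` W \<Longrightarrow> below \<alpha> E" using below_ex by blast
  obtain j where j: "Lft \<alpha> j = {}" "Rgt \<alpha> j = {}" using free_variable by blast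
  have "\<not> w \<subseteq> {x \<in> carr. x (\<alpha>, j)} \<and> w \<inter> {x \<in> carr. x (\<alpha>, j)} \<noteq> {}" if w: "w \<in> W" for w
  proof -
    have wD: "w = D w \<inter> carr" "below \<alpha> (D w)" "D w \<inter> carr \<noteq> {}" using D \<alpha>(2) w W(2) by auto
    obtain x y where "x \<in> D w \<inter> carr" "x (\<alpha>, j) = True" "y \<in> D w \<inter> carr" "y (\<alpha>, j) = False"
      using free_variable_splits[OF wD(2,3) \<alpha>(1) j] by meson
    then have "x \<in> w \<inter> {x \<in> carr. x (\<alpha>, j)}" "y \<in> w - {x \<in> carr. x (\<alpha>, j)}" using wD(1) by auto
    then show ?thesis by blast
  qed
  then show ?thesis using coord_clopen[OF \<alpha>(1)] by blast
qed

text \<open>On every level \<open>\<alpha>\<close> above that of \<open>U\<close>, take a point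
  variable whose point lies in \<open>D\<close>. The clopen set \<open>w \<alpha>\<close> where it
  is true is nonempty, and its points share one projection below \<open>\<alpha>\<close>; so it lies
  in \<open>U\<close> and no clopen set from lower levels splits it. There are at most r levels, and
  every clopen set comes below some of them.\<close>

lemma deciding_family:
  assumes U: "U \<in> clopens space" "U \<noteq> {}"
  shows "\<exists>W\<subseteq>clopens space. |W| \<le>o r \<and> (\<forall>w\<in>W. w \<noteq> {} \<and> w \<subseteq> U) \<and>
    (\<forall>c\<in>clopens space. \<exists>w\<in>W. w \<subseteq> c \<or> w \<inter> c = {})"
proof -
  obtain D where D: "D \<in> finitely_determined J" "U = D \<inter> carr" using U(1) unfolding clopens_space by blast
  define I where "I = {\<alpha> \<in> Field r. below \<alpha> D}"
  have ex: "\<exists>j p. p \<in> Ob \<alpha> \<and> p \<in> D \<and> Lft \<alpha> j = {} \<and> Rgt \<alpha> j = - {cut_at \<alpha> p}" if "\<alpha> \<in> I" for \<alpha>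
  proof -
    have b: "below \<alpha> D" "D \<inter> carr \<noteq> {}" using that U(2) D(2) by (simp_all add: I_def)
    obtain j p where "p \<in> Ob \<alpha>" "p \<in> D" "Lft \<alpha> j = {}" "Rgt \<alpha> j = - {cut_at \<alpha> p}"
      by (rule point_variable[OF D(1) b])
    then show ?thesis by (intro exI conjI)
  qed
  define w where "w \<alpha> = {x \<in> carr. x (\<alpha>, SOME j. \<exists>p. p \<in> Ob \<alpha> \<and> p \<in> D \<and> Lft \<alpha> j = {} \<and> Rgt \<alpha> j = - {cut_at \<alpha> p})}" for \<alpha>
  have w: "w \<alpha> \<noteq> {} \<and> w \<alpha> \<subseteq> U \<and> (\<forall>E. below \<alpha> E \<longrightarrow> w \<alpha> \<subseteq> E \<or> w \<alpha> \<inter> E = {})" if \<alpha>: "\<alpha> \<in> I" for \<alpha>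
  proof -
    define j where "j = (SOME j. \<exists>p. p \<in> Ob \<alpha> \<and> p \<in> D \<and> Lft \<alpha> j = {} \<and> Rgt \<alpha> j = - {cut_at \<alpha> p})"
    have "\<exists>p. p \<in> Ob \<alpha> \<and> p \<in> D \<and> Lft \<alpha> j = {} \<and> Rgt \<alpha> j = - {cut_at \<alpha> p}"
      unfolding j_def by (rule someI_ex[OF ex[OF \<alpha>]])
    then obtain p where p: "p \<in> Ob \<alpha>" "p \<in> D" "Lft \<alpha> j = {}" "Rgt \<alpha> j = - {cut_at \<alpha> p}" by (elim exE conjE)
    have wj: "w \<alpha> = {x \<in> carr. x (\<alpha>, j)}" by (simp add: w_def j_def)
    have aF: "\<alpha> \<in> Field r" "below \<alpha> D" using \<alpha> by (auto simp: I_def)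
    have cut: "cut_at \<alpha> x = cut_at \<alpha> p" if "x \<in> w \<alpha>" for x
      using carr_obeys(2)[of x \<alpha> j] that aF(1) p(4) unfolding wj by auto
    have dec: "x \<in> E \<longleftrightarrow> p \<in> E" if "below \<alpha> E" "x \<in> w \<alpha>" for x E
      using that(1) cut[OF that(2)] unfolding below_def by metis
    obtain x where x: "x \<in> carr" "cut_at \<alpha> x = cut_at \<alpha> p" "\<And>\<beta> j. \<beta> \<in> Field r \<Longrightarrow> \<beta> \<notin> underS r \<alpha> \<Longrightarrow>
      cut_at \<beta> x \<notin> Lft \<beta> j \<Longrightarrow> cut_at \<beta> x \<notin> Rgt \<beta> j \<Longrightarrow> x (\<beta>, j) = (\<lambda>_. True) (\<beta>, j)"
      using extension[OF p(1), of "\<lambda>_. True"] by blast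
    have "\<alpha> \<notin> underS r \<alpha>" by (simp add: underS_def)
    then have "x (\<alpha>, j)" using x(3)[OF aF(1), of j] p(3,4) x(2) by simp
    then have "x \<in> w \<alpha>" using x(1) by (simp add: wj)
    moreover have "w \<alpha> \<subseteq> U" using dec[OF aF(2)] p(2) D(2) by (auto simp: wj)
    moreover have "w \<alpha> \<subseteq> E \<or> w \<alpha> \<inter> E = {}" if "below \<alpha> E" for E using dec[OF that] by blast
    ultimately show ?thesis by blast
  qed
  show ?thesis
  proof (intro exI[of _ "w ` I"] conjI)
    show "w ` I \<subseteq> clopens space" using coord_clopen by (auto simp: w_def I_def)
    have "|w ` I| \<le>o |Field r|"
      using card_of_image[of w I] card_of_mono1[of I "Field r"] ordLeq_transitive unfolding I_def by blast
    moreover have "|Field r| \<le>o r" using wo by (rule card_of_least)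
    ultimately show "|w ` I| \<le>o r" by (rule ordLeq_transitive)
    show "\<forall>v\<in>w ` I. v \<noteq> {} \<and> v \<subseteq> U" using w by blast
    show "\<forall>c\<in>clopens space. \<exists>v\<in>w ` I. v \<subseteq> c \<or> v \<inter> c = {}"
    proof
      fix c assume "c \<in> clopens space"
      then obtain E where E: "E \<in> finitely_determined J" "c = E \<inter> carr" unfolding clopens_space by blast
      \<comment> \<open>\<open>D\<close> is included so that the level found belongs to
        \<open>I\<close>.\<close>
      have "countable {D, E}" "{D, E} \<subseteq> finitely_determined J" using D(1) E(1) by auto
      then obtain \<alpha> where \<alpha>: "\<alpha> \<in> Field r" "\<And>F. F \<in> {D, E} \<Longrightarrow> below \<alpha> F" using below_countable by blast
      have "\<alpha> \<in> I" using \<alpha> by (simp add: I_def)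
      moreover have "w \<alpha> \<subseteq> E \<or> w \<alpha> \<inter> E = {}" using w[OF \<open>\<alpha> \<in> I\<close>] \<alpha>(2)[of E] by simp
      moreover have "w \<alpha> \<subseteq> carr" by (auto simp: w_def)
      ultimately show "\<exists>v\<in>w ` I. v \<subseteq> c \<or> v \<inter> c = {}" unfolding E(2) by blast
    qed
  qed
qed

lemma clopen_rep:
  assumes "range a \<subseteq> clopens space"
  obtains A where "\<And>n. A n \<in> finitely_determined J" "\<And>n. a n = A n \<inter> carr"
proof -
  have "\<forall>n. \<exists>D. D \<in> finitely_determined J \<and> a n = D \<inter> carr" using assms unfolding clopens_space by blast
  from choice[OF this] obtain A where "\<forall>n. A n \<in> finitely_determined J \<and> a n = A n \<inter> carr" by (elim exE)
  then show ?thesis using that[of A] by simp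
qed

section \<open>The tower as a Parovicenko space\<close>

text \<open>Regularity places both sequences under one level, where the gap variable for them
  defines the separator.\<close>

lemma countably_separated_space: "countably_separated space"
  unfolding countably_separated_def
proof (intro allI impI, elim conjE)
  fix a b :: "nat \<Rightarrow> ('k \<times> nat set \<Rightarrow> bool) set"
  assume a: "range a \<subseteq> clopens space" and b: "range b \<subseteq> clopens space" and ab: "\<forall>m n. a m \<inter> b n = {}"
  obtain A where A: "\<And>n. A n \<in> finitely_determined J" "\<And>n. a n = A n \<inter> carr" using clopen_rep[OF a] by blast
  obtain B where B: "\<And>n. B n \<in> finitely_determined J" "\<And>n. b n = B n \<inter> carr" using clopen_rep[OF b] by blast
  have "countable (range A \<union> range B)" "range A \<union> range B \<subseteq> finitely_determined J" using A B by auto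
  then obtain \<alpha> where \<alpha>: "\<alpha> \<in> Field r" "\<And>D. D \<in> range A \<union> range B \<Longrightarrow> below \<alpha> D" using below_countable by blast
  have bel: "below \<alpha> (A n)" "below \<alpha> (B n)" for n using \<alpha>(2) by simp_all
  have "A m \<inter> B n \<inter> carr = {}" for m n using ab A(2) B(2) by blast
  then obtain j where j: "Lft \<alpha> j = (\<Union>n. A n)" "Rgt \<alpha> j = (\<Union>n. B n)"
    using gap_variable[of A \<alpha> B] A(1) B(1) bel by metis
  show "\<exists>c\<in>clopens space. \<forall>n. a n \<subseteq> c \<and> b n \<inter> c = {}"
  proof (intro bexI[OF _ coord_clopen[OF \<alpha>(1), of j]] allI conjI)
    fix n
    show "a n \<subseteq> {x \<in> carr. x (\<alpha>, j)}"
    proof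
      fix x assume "x \<in> a n"
      then have x: "x \<in> carr" "cut_at \<alpha> x \<in> A n" using A(2) bel(1)[of n] by (auto simp: below_def)
      then have "cut_at \<alpha> x \<in> Lft \<alpha> j" unfolding j by blast
      then show "x \<in> {x \<in> carr. x (\<alpha>, j)}" using carr_obeys(1)[OF x(1) \<alpha>(1)] x(1) by simp
    qed
    show "b n \<inter> {x \<in> carr. x (\<alpha>, j)} = {}"
    proof (rule ccontr)
      assume "b n \<inter> {x \<in> carr. x (\<alpha>, j)} \<noteq> {}"
      then obtain x where "x \<in> b n" "x (\<alpha>, j)" by blast
      then have x: "x \<in> carr" "cut_at \<alpha> x \<in> B n" using B(2) bel(2)[of n] by (auto simp: below_def)
      then have "cut_at \<alpha> x \<in> Rgt \<alpha> j" unfolding j by blast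
      then show False using carr_obeys(2)[OF x(1) \<alpha>(1)] \<open>x (\<alpha>, j)\<close> by simp
    qed
  qed
qed

lemma splits_below_space: "splits_below space"
  unfolding splits_below_def
proof (intro allI impI, elim conjE)
  fix a :: "nat \<Rightarrow> ('k \<times> nat set \<Rightarrow> bool) set"
  assume a: "range a \<subseteq> clopens space" "decseq a" "\<forall>n. a n \<noteq> {}"
  obtain A where A: "\<And>n. A n \<in> finitely_determined J" "\<And>n. a n = A n \<inter> carr" using clopen_rep[OF a(1)] by blast
  have "countable (range A)" "range A \<subseteq> finitely_determined J" using A by auto
  then obtain \<alpha> where \<alpha>: "\<alpha> \<in> Field r" "\<And>D. D \<in> range A \<Longrightarrow> below \<alpha> D" using below_countable by blast
  have bel: "below \<alpha> (A n)" for n using \<alpha>(2) by simp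
  have belC: "below \<alpha> (- A n)" for n using bel[of n] by (simp add: below_def)
  have emp: "below \<alpha> {}" by (simp add: below_def)
  \<comment> \<open>With nothing on the left and the complements on the right, the coordinate can be
    true only in the intersection of all \<open>a n\<close>.\<close>
  obtain j where j: "Lft \<alpha> j = (\<Union>n::nat. {})" "Rgt \<alpha> j = (\<Union>n. - A n)"
    using gap_variable[of "\<lambda>_. {}" \<alpha> "\<lambda>n. - A n"] finitely_determined_empty emp
      finitely_determined_Compl[OF A(1)] belC by (metis inf_bot_left)
  define c where "c = {x \<in> carr. x (\<alpha>, j)}"
  have ca: "c \<subseteq> a n" for n
  proof
    fix x assume x: "x \<in> c"
    then have "cut_at \<alpha> x \<notin> Rgt \<alpha> j" using carr_obeys(2)[of x \<alpha> j] \<alpha>(1) by (auto simp: c_def)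
    then have "cut_at \<alpha> x \<in> A n" unfolding j by blast
    then show "x \<in> a n" using bel[of n] x A(2) by (simp add: below_def c_def)
  qed
  have "\<And>n. closedin space (a n)" using a(1) by (auto simp: clopens_def)
  \<comment> \<open>Compactness supplies a point in all \<open>a n\<close>, where this variable is
    unconstrained; making it true there shows that \<open>c\<close> is nonempty.\<close>
  then have "(\<Inter>n. a n) \<noteq> {}" using compact_space_imp_nest[OF space_basics(1)] a(2,3) by blast
  then obtain y where y: "\<And>n. y \<in> a n" by blast
  have yc: "y \<in> carr" using y[of 0] A(2) by blast
  obtain x where x: "x \<in> carr" "cut_at \<alpha> x = cut_at \<alpha> y" "\<And>\<beta> j. \<beta> \<in> Field r \<Longrightarrow> \<beta> \<notin> underS r \<alpha> \<Longrightarrow>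
      cut_at \<beta> x \<notin> Lft \<beta> j \<Longrightarrow> cut_at \<beta> x \<notin> Rgt \<beta> j \<Longrightarrow> x (\<beta>, j) = (\<lambda>_. True) (\<beta>, j)"
    using extension[OF carr_Ob[OF yc, of \<alpha>], of "\<lambda>_. True"] by blast
  have "y \<in> A n" for n using y[of n] A(2)[of n] by blast
  then have "cut_at \<alpha> y \<in> A n" for n using bel[of n] by (simp add: below_def)
  then have "cut_at \<alpha> x \<notin> Lft \<alpha> j" "cut_at \<alpha> x \<notin> Rgt \<alpha> j" unfolding x(2) j by blast+
  moreover have "\<alpha> \<notin> underS r \<alpha>" by (simp add: underS_def)
  ultimately have "x (\<alpha>, j)" using x(3)[OF \<alpha>(1)] by blast
  then have "c \<noteq> {}" using x(1) by (auto simp: c_def)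
  moreover have c: "c \<in> clopens space" using coord_clopen[OF \<alpha>(1)] by (simp add: c_def)
  moreover have "|{c}| <o r"
    using uncountable countable_card_le_natLeq[of "{c}"] ordLeq_ordLess_trans by blast
  ultimately obtain d where d: "d \<in> clopens space" "\<not> c \<subseteq> d" "c \<inter> d \<noteq> {}"
    using small_family_split[of "{c}"] by auto
  show "\<exists>c\<in>clopens space. \<exists>d\<in>clopens space. c \<noteq> {} \<and> d \<noteq> {} \<and> c \<inter> d = {} \<and> (\<forall>n. c \<subseteq> a n \<and> d \<subseteq> a n)"
  proof (rule bexI[of _ "c \<inter> d"], rule bexI[of _ "c - d"], intro conjI allI)
    show "c \<inter> d \<subseteq> a n" "c - d \<subseteq> a n" for n using ca[of n] by blast+
  qed (use c d in \<open>auto intro: clopens_Int clopens_Diff\<close>)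
qed

text \<open>The upper bound counts cylinder sets over \<open>J\<close>. For the lower bound, labels
  name continuum many free variables on one level, and a point at which exactly one of them is true
  tells its clopen set from the others.\<close>

lemma card_clopens_space: "|clopens space| =o ctwo ^c natLeq"
proof -
  obtain \<alpha> where \<alpha>: "\<alpha> \<in> Field r" using Field_nonempty by blast
  obtain y where y: "y \<in> carr" using carr_nonempty by blast
  have inf: "infinite (UNIV :: nat set set)" by (simp add: Finite_Set.finite_set)
  have "infinite J" using \<alpha> inf by (auto simp: finite_cartesian_product_iff)
  have "|J| \<le>o |UNIV :: nat set set|"
  proof (rule card_of_Times_ordLeq_infinite_Field)
    show "|Field r| \<le>o |UNIV :: nat set set|" using card_of_least[OF wo] card_le ordLeq_transitive by blast
    show "|UNIV :: nat set set| \<le>o |UNIV :: nat set set|" by (rule card_of_mono1) simp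
    show "Card_order |UNIV :: nat set set|" by (rule card_of_Card_order)
  qed (simp add: Field_card_of inf)
  from ordLeq_transitive[OF card_of_finitely_determined[OF \<open>infinite J\<close>] this]
  have le: "|clopens space| \<le>o |UNIV :: nat set set|"
    unfolding clopens_space by (rule ordLeq_transitive[OF card_of_image])
  obtain v where v: "\<And>c. Lft \<alpha> (v c) = {}" "\<And>c. Rgt \<alpha> (v c) = {}" "\<And>c. decode_seq (v c) 2 = c"
    using free_variable[of \<alpha>] by metis
  have "inj (\<lambda>c. {x \<in> carr. x (\<alpha>, v c)})"
  proof (rule injI)
    fix c c' assume eq: "{x \<in> carr. x (\<alpha>, v c)} = {x \<in> carr. x (\<alpha>, v c')}"
    obtain x where x: "x \<in> carr" "cut_at \<alpha> x = cut_at \<alpha> y" "\<And>\<beta> j. \<beta> \<in> Field r \<Longrightarrow> \<beta> \<notin> underS r \<alpha> \<Longrightarrow>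
      cut_at \<beta> x \<notin> Lft \<beta> j \<Longrightarrow> cut_at \<beta> x \<notin> Rgt \<beta> j \<Longrightarrow> x (\<beta>, j) = (\<lambda>i. i = (\<alpha>, v c)) (\<beta>, j)"
      using extension[OF carr_Ob[OF y, of \<alpha>], of "\<lambda>i. i = (\<alpha>, v c)"] by blast
    have "\<alpha> \<notin> underS r \<alpha>" by (simp add: underS_def)
    then have "x (\<alpha>, v d) \<longleftrightarrow> v d = v c" for d using x(3)[OF \<alpha>, of "v d"] v(1,2) by simp
    then have "v c' = v c" using eq x(1) by blast
    then show "c = c'" using v(3) by metis
  qed
  then have "|UNIV :: nat set set| \<le>o |clopens space|"
    using coord_clopen[OF \<alpha>] by (intro card_of_ordLeq[THEN iffD1] exI[of _ "\<lambda>c. {x \<in> carr. x (\<alpha>, v c)}"]) auto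
  then have "|clopens space| =o |UNIV :: nat set set|" using le by (simp add: ordIso_iff_ordLeq)
  then show ?thesis using ordIso_symmetric[OF continuum_nat_set] ordIso_transitive by blast
qed

theorem Parovicenko_space_tower: "Parovicenko_space space"
  unfolding Parovicenko_space_iff
  using space_basics(1-3) countably_separated_space splits_below_space card_clopens_space by blast

end

section \<open>Sums of towers\<close>

lemma tower_exists:
  fixes r :: "'k rel"
  assumes r: "Card_order r" "regularCard r" "natLeq <o r" "r \<le>o |UNIV :: nat set set|"
  obtains e where "tower r e"
proof -
  have wo: "Well_order r" using r(1) by (simp add: card_order_on_def)
  have "natLeq \<le>o |Field r|"
    using ordLess_ordIso_trans[OF r(3) ordIso_symmetric[OF card_of_Field_ordIso[OF r(1)]]] ordLess_imp_ordLeq by blast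
  then have inf: "infinite (Field r)"
    using infinite_iff_card_of_nat[of "Field r"] card_of_nat ordIso_ordLeq_trans by blast
  have bounded: "\<exists>k\<in>Field r. S \<subseteq> underS r k" if S: "S \<subseteq> Field r" "|S| <o r" for S
  proof -
    have "\<not> cofinal S r"
      using r(2) S not_ordLess_ordIso unfolding regularCard_def by blast
    then obtain k where k: "k \<in> Field r" "\<And>b. b \<in> S \<Longrightarrow> k = b \<or> (k, b) \<notin> r" unfolding cofinal_def by blast
    \<comment> \<open>A set of smaller size is not cofinal, which gives a weak upper bound
      \<open>k\<close>; an infinite cardinal has no last element, so some \<open>l\<close> beyond
      \<open>k\<close> is a strict one.\<close>
    obtain l where l: "l \<in> Field r" "k \<noteq> l" "(k, l) \<in> r"
      using infinite_Card_order_limit[OF r(1) inf k(1)] by blast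
    have "b \<in> underS r l" if b: "b \<in> S" for b
    proof -
      have "(b, k) \<in> r"
        using k b S(1) wo unfolding well_order_on_def linear_order_on_def partial_order_on_def preorder_on_def total_on_def refl_on_def
        by (metis subsetD)
      then show ?thesis
        using l wo unfolding underS_def well_order_on_def linear_order_on_def partial_order_on_def preorder_on_def trans_def antisym_def
        by blast
    qed
    then show ?thesis using l(1) by blast
  qed
  have inf': "infinite (UNIV :: nat set set)" by (simp add: Finite_Set.finite_set)
  let ?J = "Field r \<times> (UNIV :: nat set set)"
  have "Field r \<noteq> {}" using inf by auto
  then have "infinite ?J" using inf' by (auto simp: finite_cartesian_product_iff)
  have "|?J| \<le>o |UNIV :: nat set set|"
  proof (rule card_of_Times_ordLeq_infinite_Field)
    show "|Field r| \<le>o |UNIV :: nat set set|" using card_of_least[OF wo] r(4) ordLeq_transitive by blast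
    show "|UNIV :: nat set set| \<le>o |UNIV :: nat set set|" by (rule card_of_mono1) simp
    show "Card_order |UNIV :: nat set set|" by (rule card_of_Card_order)
  qed (simp add: Field_card_of inf')
  from ordLeq_transitive[OF card_of_finitely_determined[OF \<open>infinite ?J\<close>] this]
  have "|finitely_determined ?J| \<le>o |UNIV :: nat set set|" .
  moreover have "finitely_determined ?J \<noteq> {}" using finitely_determined_empty by blast
  ultimately obtain e :: "nat set \<Rightarrow> ('k \<times> nat set \<Rightarrow> bool) set" where "range e = finitely_determined ?J"
    using card_of_ordLeq2[of "finitely_determined ?J" "UNIV :: nat set set"] by blast
  then have "tower r e" using wo bounded r(3,4) by unfold_locales
  then show ?thesis by (rule that)
qed

section \<open>Reaping families and finite sums\<close>

text \<open>\<open>W\<close> is a reaping family: no clopen set splits all its members. The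
  condition says that the reaping number of \<open>U\<close> is at most omega_1, which will hold for
  every nonempty clopen set of the tower of length omega_1 and for none of the tower of length
  omega_2.\<close>

definition finely_decided :: "'a topology \<Rightarrow> 'a set \<Rightarrow> bool"
  where "finely_decided X U \<longleftrightarrow> (\<exists>W\<subseteq>clopens X. |W| \<le>o cardSuc natLeq \<and> (\<forall>w\<in>W. w \<noteq> {} \<and> w \<subseteq> U) \<and>
    (\<forall>c\<in>clopens X. \<exists>w\<in>W. w \<subseteq> c \<or> w \<inter> c = {}))"

lemma finely_decided_homeo:
  assumes g: "g \<in> carrier (homeo_group X)" and U: "U \<subseteq> topspace X" "finely_decided X U"
  shows "finely_decided X (g ` U)"
proof -
  interpret group "homeo_group X" by (rule group_homeo_group)
  let ?g = "inv\<^bsub>homeo_group X\<^esub> g"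
  obtain W where W: "W \<subseteq> clopens X" "|W| \<le>o cardSuc natLeq" "\<forall>w\<in>W. w \<noteq> {} \<and> w \<subseteq> U"
    "\<forall>c\<in>clopens X. \<exists>w\<in>W. w \<subseteq> c \<or> w \<inter> c = {}" using U(2) unfolding finely_decided_def by (elim exE conjE)
  show ?thesis unfolding finely_decided_def
  proof (intro exI[of _ "image g ` W"] conjI)
    show "image g ` W \<subseteq> clopens X" using W(1) homeo_group_clopens[OF g] by blast
    show "|image g ` W| \<le>o cardSuc natLeq" using card_of_image W(2) ordLeq_transitive by blast
    show "\<forall>w\<in>image g ` W. w \<noteq> {} \<and> w \<subseteq> g ` U" using W(3) by blast
    show "\<forall>c\<in>clopens X. \<exists>w\<in>image g ` W. w \<subseteq> c \<or> w \<inter> c = {}"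
    proof
      fix c assume c: "c \<in> clopens X"
      then obtain w where w: "w \<in> W" "w \<subseteq> ?g ` c \<or> w \<inter> ?g ` c = {}"
        using W(4) homeo_group_clopens[OF inv_closed[OF g]] by blast
      have gc: "g x \<in> c \<longleftrightarrow> x \<in> ?g ` c" if "x \<in> topspace X" for x
      proof
        assume "g x \<in> c"
        moreover have "x = ?g (g x)" using homeo_group_eval(4)[OF g that] by simp
        ultimately show "x \<in> ?g ` c" by blast
      next
        assume "x \<in> ?g ` c"
        then obtain y where y: "y \<in> c" "x = ?g y" by blast
        then show "g x \<in> c" using homeo_group_eval(5)[OF g, of y] clopens_subset[OF c] by auto
      qed
      have wX: "w \<subseteq> topspace X" using W(1) w(1) clopens_subset by blast
      have "g ` w \<subseteq> c \<or> g ` w \<inter> c = {}" using w(2) gc wX by blast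
      then show "\<exists>w\<in>image g ` W. w \<subseteq> c \<or> w \<inter> c = {}" using w(1) by blast
    qed
  qed
qed

definition slice :: "'i \<Rightarrow> ('i \<times> 'a) set \<Rightarrow> 'a set"
  where "slice i U = {x. (i, x) \<in> U}"

lemma clopens_sum_topology:
  "U \<in> clopens (sum_topology X I) \<longleftrightarrow> U \<subseteq> Sigma I (topspace \<circ> X) \<and> (\<forall>i\<in>I. slice i U \<in> clopens (X i))"
  by (auto simp: clopens_def openin_sum_topology closedin_sum_topology slice_def)

lemma slice_mono: "U \<subseteq> V \<Longrightarrow> slice i U \<subseteq> slice i V"
  by (auto simp: slice_def)

lemma clopens_sum_piece:
  assumes "i \<in> I" "U \<in> clopens (X i)"
  shows "{i} \<times> U \<in> clopens (sum_topology X I)"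
proof -
  have "slice j ({i} \<times> U) = (if j = i then U else {})" for j by (auto simp: slice_def)
  then show ?thesis using assms clopens_subset[OF assms(2)] by (auto simp: clopens_sum_topology clopens_empty)
qed

lemma clopens_sum_glue:
  assumes "\<And>i. i \<in> I \<Longrightarrow> c i \<in> clopens (X i)"
  shows "Sigma I c \<in> clopens (sum_topology X I)"
proof -
  have "slice i (Sigma I c) = c i" if "i \<in> I" for i using that by (auto simp: slice_def)
  then show ?thesis using assms clopens_subset by (fastforce simp: clopens_sum_topology)
qed

text \<open>Finiteness of the index set gives compactness, a summand in which a decreasing sequence
  of nonempty sets never dies out, and a description of clopen sets by finitely many pieces.\<close>

theorem Parovicenko_space_sum:
  assumes I: "finite I" "I \<noteq> {}" and X: "\<And>i. i \<in> I \<Longrightarrow> Parovicenko_space (X i)"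
  shows "Parovicenko_space (sum_topology X I)"
proof -
  let ?S = "sum_topology X I"
  have P: "compact_space (X i)" "Hausdorff_space (X i)" "zero_dimensional (X i)" "countably_separated (X i)"
    "splits_below (X i)" "|clopens (X i)| =o ctwo ^c natLeq" if "i \<in> I" for i
    using X[OF that] unfolding Parovicenko_space_iff by blast+
  have "compact_space ?S"
  proof -
    have "compactin ?S (Pair i ` topspace (X i))" if "i \<in> I" for i
      using P(1)[OF that] continuous_map_component_injection[OF that] image_compactin unfolding compact_space_def by blast
    then have "compactin ?S (\<Union>((\<lambda>i. Pair i ` topspace (X i)) ` I))" using I(1) by (intro compactin_Union) auto
    moreover have "\<Union>((\<lambda>i. Pair i ` topspace (X i)) ` I) = topspace ?S" by auto
    ultimately show ?thesis by (simp add: compact_space_def)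
  qed
  moreover have "Hausdorff_space ?S" unfolding Hausdorff_space_def
  proof (intro allI impI, elim conjE)
    fix p q assume pq: "p \<in> topspace ?S" "q \<in> topspace ?S" "p \<noteq> q"
    obtain i x where p: "p = (i, x)" "i \<in> I" "x \<in> topspace (X i)" using pq(1) by auto
    obtain j y where q: "q = (j, y)" "j \<in> I" "y \<in> topspace (X j)" using pq(2) by auto
    have piece: "openin ?S ({k} \<times> U)" if "k \<in> I" "openin (X k) U" for k U
    proof -
      have "{x. (i, x) \<in> {k} \<times> U} = (if i = k then U else {})" for i by auto
      then show ?thesis using that openin_subset[OF that(2)] by (auto simp: openin_sum_topology)
    qed
    show "\<exists>U V. openin ?S U \<and> openin ?S V \<and> p \<in> U \<and> q \<in> V \<and> disjnt U V"
    proof (cases "i = j")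
      case True
      then have "x \<noteq> y" using pq(3) p q by simp
      then obtain U V where "openin (X i) U" "openin (X i) V" "x \<in> U" "y \<in> V" "disjnt U V"
        using P(2)[OF p(2)] p q True unfolding Hausdorff_space_def by metis
      then show ?thesis using piece[OF p(2)] p q True
        by (intro exI[of _ "{i} \<times> U"] exI[of _ "{i} \<times> V"]) (auto simp: disjnt_iff)
    next
      case False
      then show ?thesis using piece[OF p(2) openin_topspace] piece[OF q(2) openin_topspace] p q
        by (intro exI[of _ "{i} \<times> topspace (X i)"] exI[of _ "{j} \<times> topspace (X j)"]) (auto simp: disjnt_iff)
    qed
  qed
  moreover have "zero_dimensional ?S" unfolding zero_dimensional_iff
  proof (intro allI impI, elim conjE)
    fix U p assume U: "openin ?S U" "p \<in> U"
    then have "p \<in> topspace ?S" using openin_subset by blast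
    then obtain i x where p: "p = (i, x)" "i \<in> I" by auto
    have "openin (X i) {x. (i, x) \<in> U}" using U(1) p(2) by (simp add: openin_sum_topology)
    then obtain C where C: "C \<in> clopens (X i)" "x \<in> C" "C \<subseteq> {x. (i, x) \<in> U}"
      using P(3)[OF p(2)] U(2) p(1) unfolding zero_dimensional_iff by blast
    then show "\<exists>C\<in>clopens ?S. p \<in> C \<and> C \<subseteq> U"
      using clopens_sum_piece[where X = X, OF p(2) C(1)] p(1) by (intro bexI[of _ "{i} \<times> C"]) auto
  qed
  moreover have "countably_separated ?S" unfolding countably_separated_def
  proof (intro allI impI, elim conjE)
    fix a b :: "nat \<Rightarrow> ('a \<times> 'b) set"
    assume a: "range a \<subseteq> clopens ?S" and b: "range b \<subseteq> clopens ?S" and ab: "\<forall>m n. a m \<inter> b n = {}"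
    have "\<exists>c. c \<in> clopens (X i) \<and> (\<forall>n. slice i (a n) \<subseteq> c \<and> slice i (b n) \<inter> c = {})" if i: "i \<in> I" for i
    proof -
      have "range (\<lambda>n. slice i (a n)) \<subseteq> clopens (X i)" "range (\<lambda>n. slice i (b n)) \<subseteq> clopens (X i)"
        using a b i unfolding image_subset_iff clopens_sum_topology by blast+
      moreover have "\<forall>m n. slice i (a m) \<inter> slice i (b n) = {}" using ab unfolding slice_def by blast
      ultimately have "\<exists>c\<in>clopens (X i). \<forall>n. slice i (a n) \<subseteq> c \<and> slice i (b n) \<inter> c = {}"
        by (intro P(4)[OF i, unfolded countably_separated_def, THEN spec, THEN spec, THEN mp] conjI)
      then show ?thesis by (simp only: Bex_def)
    qed
    then have "\<forall>i\<in>I. \<exists>c. c \<in> clopens (X i) \<and> (\<forall>n. slice i (a n) \<subseteq> c \<and> slice i (b n) \<inter> c = {})" by blast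
    from bchoice[OF this] obtain c where c: "\<forall>i\<in>I. c i \<in> clopens (X i) \<and> (\<forall>n. slice i (a n) \<subseteq> c i \<and> slice i (b n) \<inter> c i = {})"
      by (elim exE)
    have sub: "a n \<subseteq> Sigma I (topspace \<circ> X)" for n using a unfolding image_subset_iff clopens_sum_topology by blast
    show "\<exists>c\<in>clopens ?S. \<forall>n. a n \<subseteq> c \<and> b n \<inter> c = {}"
    proof (intro bexI[of _ "Sigma I c"] allI conjI)
      show "Sigma I c \<in> clopens ?S" using c by (intro clopens_sum_glue) blast
      fix n
      show "a n \<subseteq> Sigma I c"
      proof
        fix p assume p: "p \<in> a n"
        then obtain i x where ix: "p = (i, x)" "i \<in> I" using sub by blast
        then have "x \<in> slice i (a n)" using p by (simp add: slice_def)
        then show "p \<in> Sigma I c" using c ix by blast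
      qed
      show "b n \<inter> Sigma I c = {}"
      proof (rule ccontr)
        assume "b n \<inter> Sigma I c \<noteq> {}"
        then obtain i x where "(i, x) \<in> b n" "i \<in> I" "x \<in> c i" by blast
        then have "x \<in> slice i (b n) \<inter> c i" by (simp add: slice_def)
        then show False using c \<open>i \<in> I\<close> by blast
      qed
    qed
  qed
  moreover have "splits_below ?S" unfolding splits_below_def
  proof (intro allI impI, elim conjE)
    fix a :: "nat \<Rightarrow> ('a \<times> 'b) set"
    assume a: "range a \<subseteq> clopens ?S" "decseq a" "\<forall>n. a n \<noteq> {}"
    have sub: "a n \<subseteq> Sigma I (topspace \<circ> X)" for n using a unfolding image_subset_iff clopens_sum_topology by blast
    have "\<exists>i\<in>I. \<forall>n. slice i (a n) \<noteq> {}"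
    proof (rule ccontr)
      assume "\<not> (\<exists>i\<in>I. \<forall>n. slice i (a n) \<noteq> {})"
      then obtain k where k: "\<And>i. i \<in> I \<Longrightarrow> slice i (a (k i)) = {}" by metis
      define m where "m = Max (k ` I)"
      obtain i x where ix: "(i, x) \<in> a m" "i \<in> I" using a(3) sub by (metis ex_in_conv mem_Sigma_iff prod.collapse subsetD)
      have "k i \<le> m" using I(1) ix(2) by (simp add: m_def)
      then have "a m \<subseteq> a (k i)" using a(2) by (simp add: decseq_def)
      then show False using k[OF ix(2)] ix(1) by (auto simp: slice_def)
    qed
    then obtain i where i: "i \<in> I" "\<forall>n. slice i (a n) \<noteq> {}" by blast
    have "range (\<lambda>n. slice i (a n)) \<subseteq> clopens (X i)"
      using a(1) i(1) unfolding image_subset_iff clopens_sum_topology by blast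
    moreover have "decseq (\<lambda>n. slice i (a n))" using a(2) by (simp add: decseq_def slice_mono)
    ultimately have "\<exists>c d. c \<in> clopens (X i) \<and> d \<in> clopens (X i) \<and> c \<noteq> {} \<and> d \<noteq> {} \<and> c \<inter> d = {} \<and>
        (\<forall>n. c \<subseteq> slice i (a n)) \<and> (\<forall>n. d \<subseteq> slice i (a n))"
      by (rule splits_belowD[OF P(5)[OF i(1)] _ _ i(2)])
    then obtain c d where cd: "c \<in> clopens (X i)" "d \<in> clopens (X i)" "c \<noteq> {}" "d \<noteq> {}" "c \<inter> d = {}"
        "\<forall>n. c \<subseteq> slice i (a n)" "\<forall>n. d \<subseteq> slice i (a n)"
      by (elim exE conjE)
    show "\<exists>c\<in>clopens ?S. \<exists>d\<in>clopens ?S. c \<noteq> {} \<and> d \<noteq> {} \<and> c \<inter> d = {} \<and> (\<forall>n. c \<subseteq> a n \<and> d \<subseteq> a n)"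
    proof (rule bexI[OF _ clopens_sum_piece[where X = X, OF i(1) cd(1)]], rule bexI[OF _ clopens_sum_piece[where X = X, OF i(1) cd(2)]], intro conjI allI)
      show "{i} \<times> c \<noteq> {}" "{i} \<times> d \<noteq> {}" "({i} \<times> c) \<inter> ({i} \<times> d) = {}" using cd(3-5) by auto
      show "{i} \<times> c \<subseteq> a n" "{i} \<times> d \<subseteq> a n" for n using cd(6,7) unfolding slice_def by blast+
    qed
  qed
  moreover have "|clopens ?S| =o ctwo ^c natLeq"
  proof -
    obtain k where k: "k \<in> I" using I(2) by blast
    have "inj_on (\<lambda>U. {k} \<times> U) (clopens (X k))" by (auto intro!: inj_onI)
    then have "|clopens (X k)| \<le>o |clopens ?S|"
      using clopens_sum_piece[where X = X, OF k] by (intro card_of_ordLeq[THEN iffD1] exI[of _ "\<lambda>U. {k} \<times> U"]) auto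
    then have ge: "ctwo ^c natLeq \<le>o |clopens ?S|" using ordIso_symmetric[OF P(6)[OF k]] ordIso_ordLeq_trans by blast
    define B where "B = (\<Union>i\<in>I. (\<lambda>U. {i} \<times> U) ` clopens (X i))"
    have "clopens ?S \<subseteq> Union ` Fpow B"
    proof
      fix U assume U: "U \<in> clopens ?S"
      then have sl: "U \<subseteq> Sigma I (topspace \<circ> X)" "\<And>i. i \<in> I \<Longrightarrow> slice i U \<in> clopens (X i)"
        by (simp_all add: clopens_sum_topology)
      have "U = \<Union>((\<lambda>i. {i} \<times> slice i U) ` I)" using sl(1) by (auto simp: slice_def)
      moreover have "(\<lambda>i. {i} \<times> slice i U) ` I \<in> Fpow B" using I(1) sl(2) by (auto simp: Fpow_def B_def)
      ultimately show "U \<in> Union ` Fpow B" by blast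
    qed
    then have "|clopens ?S| \<le>o |Fpow B|" by (rule surj_imp_ordLeq)
    also have "|Fpow B| \<le>o |B|"
    proof (rule card_of_Fpow_infinite)
      have "infinite (clopens (X k))"
        using Cinfinite_cong[OF ordIso_symmetric[OF P(6)[OF k]] Cinfinite_continuum] by (simp add: cinfinite_def Field_card_of)
      then have "infinite ((\<lambda>U. {k} \<times> U) ` clopens (X k))" using \<open>inj_on (\<lambda>U. {k} \<times> U) (clopens (X k))\<close> finite_image_iff by blast
      moreover have "(\<lambda>U. {k} \<times> U) ` clopens (X k) \<subseteq> B" unfolding B_def by (rule UN_upper[OF k])
      ultimately show "infinite B" using infinite_super by blast
    qed
    also have "|B| \<le>o ctwo ^c natLeq" unfolding B_def
    proof (rule card_of_UNION_ordLeq_infinite_Field)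
      show "infinite (Field (ctwo ^c natLeq))" "Card_order (ctwo ^c natLeq)"
        using Cinfinite_continuum by (auto simp: cinfinite_def)
      have "|I| \<le>o natLeq" using I(1) countable_card_le_natLeq[of I] countable_finite by blast
      moreover have "natLeq \<le>o ctwo ^c natLeq" using ordLess_ctwo_cexp[OF natLeq_Card_order] by (rule ordLess_imp_ordLeq)
      ultimately show "|I| \<le>o ctwo ^c natLeq" by (rule ordLeq_transitive)
      show "\<forall>i\<in>I. |(\<lambda>U. {i} \<times> U) ` clopens (X i)| \<le>o ctwo ^c natLeq"
        using ordLeq_ordIso_trans[OF card_of_image P(6)] by blast
    qed
    finally show ?thesis using ge by (simp add: ordIso_iff_ordLeq)
  qed
  ultimately show ?thesis unfolding Parovicenko_space_iff by blast
qed

lemma sum_permutation_homeo: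
  assumes \<pi>: "\<And>i. i \<in> I \<Longrightarrow> \<pi> i \<in> I" "\<And>i. i \<in> I \<Longrightarrow> \<pi> (\<pi> i) = i" "\<And>i. i \<in> I \<Longrightarrow> X (\<pi> i) = X i"
  shows "restrict (\<lambda>(i, x). (\<pi> i, x)) (Sigma I (topspace \<circ> X)) \<in> carrier (homeo_group (sum_topology X I))"
proof -
  let ?S = "sum_topology X I" and ?f = "\<lambda>(i, x). (\<pi> i, x)"
  have "continuous_map ?S ?S ?f" unfolding continuous_map_def
  proof (intro conjI allI impI)
    show "?f \<in> topspace ?S \<rightarrow> topspace ?S" using \<pi> by auto
    fix U assume U: "openin ?S U"
    have "{x. (i, x) \<in> {p \<in> topspace ?S. ?f p \<in> U}} = {x. (\<pi> i, x) \<in> U}" if i: "i \<in> I" for i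
      using i openin_subset[OF U] \<pi>(3)[OF i] by auto
    moreover have "openin (X i) {x. (\<pi> i, x) \<in> U}" if "i \<in> I" for i
      using U \<pi>(1)[OF that] \<pi>(3)[OF that] unfolding openin_sum_topology by metis
    ultimately show "openin ?S {p \<in> topspace ?S. ?f p \<in> U}"
      unfolding openin_sum_topology[of _ _ "{p \<in> topspace ?S. ?f p \<in> U}"] by auto
  qed
  then have "homeomorphic_maps ?S ?S ?f ?f" using \<pi>(2) by (auto simp: homeomorphic_maps_def)
  then have "homeomorphic_map ?S ?S ?f" by (rule homeomorphic_maps_imp_map)
  from restrict_in_homeo_group[OF this] show ?thesis by simp
qed

text \<open>The first index of a summand is its kind, the second tells two equal copies apart. No
  homeomorphism moves part of \<open>A\<close> out of \<open>A\<close>: the part moved would inherit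
  \<open>finely_decided\<close>, which fails for every set outside \<open>A\<close>. With
  \<open>A\<close> invariant, the exchanges of the two copies of each kind have disjoint supports,
  and they are nontrivial because the summands are nonempty.\<close>

lemma commuting_conjugates_double_sum:
  fixes T :: "bool \<Rightarrow> 'a topology"
  assumes fine: "\<And>U. U \<in> clopens (T True) \<Longrightarrow> U \<noteq> {} \<Longrightarrow> finely_decided (T True) U"
    and coarse: "\<And>W. W \<subseteq> clopens (T False) \<Longrightarrow> {} \<notin> W \<Longrightarrow> |W| \<le>o cardSuc natLeq \<Longrightarrow>
      \<exists>c\<in>clopens (T False). \<forall>w\<in>W. \<not> w \<subseteq> c \<and> w \<inter> c \<noteq> {}"
    and ne: "\<And>b. topspace (T b) \<noteq> {}"
  shows "\<exists>a b. commuting_conjugates (homeo_group (sum_topology (\<lambda>(i, j :: bool). T i) UNIV)) a b"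
proof -
  define X where "X = (\<lambda>(i, j :: bool). T i)"
  let ?S = "sum_topology X UNIV" and ?G = "homeo_group (sum_topology X UNIV)"
  interpret group ?G by (rule group_homeo_group)
  define A where "A = {p \<in> topspace ?S. fst (fst p)}"
  have "slice k A = (if fst k then topspace (X k) else {})" for k by (auto simp: slice_def A_def)
  then have A: "A \<in> clopens ?S" by (auto simp: clopens_sum_topology clopens_empty clopens_topspace A_def)
  have decided: "finely_decided ?S U" if U: "U \<in> clopens ?S" "U \<noteq> {}" "U \<subseteq> A" for U
  proof -
    obtain k x where kx: "(k, x) \<in> U" using U(2) by auto
    then have Tk: "X k = T True" using U(3) by (auto simp: A_def X_def split: prod.split)
    have slk: "slice k V \<in> clopens (T True)" if "V \<in> clopens ?S" for V
    proof -
      have "slice k V \<in> clopens (X k)" using that unfolding clopens_sum_topology by blast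
      then show ?thesis unfolding Tk .
    qed
    have "slice k U \<noteq> {}" using kx by (auto simp: slice_def)
    from fine[OF slk[OF U(1)] this] obtain W where W: "W \<subseteq> clopens (T True)" "|W| \<le>o cardSuc natLeq" "\<forall>w\<in>W. w \<noteq> {} \<and> w \<subseteq> slice k U"
      "\<forall>c\<in>clopens (T True). \<exists>w\<in>W. w \<subseteq> c \<or> w \<inter> c = {}" unfolding finely_decided_def by (elim exE conjE)
    show ?thesis unfolding finely_decided_def
    proof (intro exI[of _ "(\<lambda>w. {k} \<times> w) ` W"] conjI)
      show "(\<lambda>w. {k} \<times> w) ` W \<subseteq> clopens ?S" using clopens_sum_piece[of k UNIV _ X] W(1) Tk by auto
      show "|(\<lambda>w. {k} \<times> w) ` W| \<le>o cardSuc natLeq" using card_of_image W(2) ordLeq_transitive by blast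
      show "\<forall>v\<in>(\<lambda>w. {k} \<times> w) ` W. v \<noteq> {} \<and> v \<subseteq> U" using W(3) by (fastforce simp: slice_def)
      show "\<forall>c\<in>clopens ?S. \<exists>v\<in>(\<lambda>w. {k} \<times> w) ` W. v \<subseteq> c \<or> v \<inter> c = {}"
      proof
        fix c assume "c \<in> clopens ?S"
        then have "slice k c \<in> clopens (T True)" by (rule slk)
        then obtain w where "w \<in> W" "w \<subseteq> slice k c \<or> w \<inter> slice k c = {}" using W(4) by blast
        then show "\<exists>v\<in>(\<lambda>w. {k} \<times> w) ` W. v \<subseteq> c \<or> v \<inter> c = {}"
          by (intro bexI[of _ "{k} \<times> w"]) (auto simp: slice_def)
      qed
    qed
  qed
  have undecided: "\<not> finely_decided ?S U" if U: "U \<subseteq> topspace ?S - A" for U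
  proof
    assume "finely_decided ?S U"
    then obtain W where W: "W \<subseteq> clopens ?S" "|W| \<le>o cardSuc natLeq" "\<forall>w\<in>W. w \<noteq> {} \<and> w \<subseteq> U"
      "\<forall>c\<in>clopens ?S. \<exists>w\<in>W. w \<subseteq> c \<or> w \<inter> c = {}" unfolding finely_decided_def by (elim exE conjE)
    have "\<exists>c\<in>clopens (T False). \<forall>w\<in>slice (False, j) ` W - {{}}. \<not> w \<subseteq> c \<and> w \<inter> c \<noteq> {}" for j
    proof (rule coarse)
      have "slice (False, j) w \<in> clopens (X (False, j))" if "w \<in> W" for w
        using W(1) that unfolding clopens_sum_topology subset_iff by blast
      then show "slice (False, j) ` W - {{}} \<subseteq> clopens (T False)" by (auto simp: X_def)
      show "|slice (False, j) ` W - {{}}| \<le>o cardSuc natLeq"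
        using ordLeq_transitive[OF card_of_mono1[OF Diff_subset] ordLeq_transitive[OF card_of_image W(2)]] .
    qed simp
    then obtain c where c: "\<And>j. c j \<in> clopens (T False)"
      "\<And>j w. w \<in> slice (False, j) ` W - {{}} \<Longrightarrow> \<not> w \<subseteq> c j \<and> w \<inter> c j \<noteq> {}" by metis
    \<comment> \<open>\<open>coarse\<close>, applied on each of the two copies, splits all nonempty
      slices of members of \<open>W\<close>. Joined, the two sets split every member of
      \<open>W\<close>, as each has a nonempty slice on one of the copies.\<close>
    define C where "C = Sigma UNIV (\<lambda>k. if fst k then {} else c (snd k))"
    have "C \<in> clopens ?S" unfolding C_def
      by (rule clopens_sum_glue) (auto simp: X_def clopens_empty c(1) split: prod.split)
    then obtain w where w: "w \<in> W" "w \<subseteq> C \<or> w \<inter> C = {}" using W(4) by blast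
    have "w \<noteq> {}" using W(3) w(1) by blast
    then obtain k x where kx: "(k, x) \<in> w" by auto
    have "(k, x) \<in> topspace ?S - A" using kx w(1) W(3) U by blast
    then obtain j where k: "k = (False, j)" by (cases k) (auto simp: A_def)
    have "slice (False, j) w \<in> slice (False, j) ` W - {{}}" using w(1) kx k by (auto simp: slice_def)
    from c(2)[OF this] obtain y z where "(k, y) \<in> w" "y \<notin> c j" "(k, z) \<in> w" "z \<in> c j"
      unfolding k slice_def by blast
    then show False using w(2) k by (auto simp: C_def)
  qed
  have inv: "g p \<in> A" if g: "g \<in> carrier ?G" and p: "p \<in> A" for g p
  proof (rule ccontr)
    assume "g p \<notin> A"
    let ?g = "inv\<^bsub>?G\<^esub> g"
    have pS: "p \<in> topspace ?S" using p by (simp add: A_def)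
    \<comment> \<open>The part of the image of \<open>A\<close> that leaves \<open>A\<close>; pulled
      back by \<open>g\<close> it is a nonempty clopen subset of \<open>A\<close>.\<close>
    define V where "V = g ` A - A"
    have V: "V \<in> clopens ?S" "V \<subseteq> topspace ?S - A" "g p \<in> V"
      using homeo_group_clopens[OF g A] A p \<open>g p \<notin> A\<close> clopens_subset[OF homeo_group_clopens[OF g A]]
      by (auto simp: V_def intro: clopens_Diff)
    have "?g ` V \<in> clopens ?S" by (rule homeo_group_clopens[OF inv_closed[OF g] V(1)])
    moreover have "?g ` V \<noteq> {}" using V(3) by blast
    moreover have "?g ` V \<subseteq> A"
    proof
      fix q assume "q \<in> ?g ` V"
      then obtain s where s: "s \<in> A" "q = ?g (g s)" by (auto simp: V_def)
      then show "q \<in> A" using homeo_group_eval(4)[OF g, of s] by (simp add: A_def)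
    qed
    ultimately have "finely_decided ?S (?g ` V)" by (rule decided)
    then have "finely_decided ?S (g ` ?g ` V)"
      using finely_decided_homeo[OF g clopens_subset[OF \<open>?g ` V \<in> clopens ?S\<close>]] by blast
    moreover have "g ` ?g ` V = V" using homeo_group_eval(5)[OF g] V(2) by (force simp: image_image)
    ultimately show False using undecided[OF V(2)] by simp
  qed
  define \<sigma> where "\<sigma> b = (\<lambda>(i, j). if i = b then (i, \<not> j) else (i, j))" for b :: bool
  define s where "s b = restrict (\<lambda>(k, x). (\<sigma> b k, x)) (Sigma UNIV (topspace \<circ> X))" for b
  have s: "s b \<in> carrier ?G" for b
    unfolding s_def by (rule sum_permutation_homeo) (auto simp: \<sigma>_def X_def)
  have sx: "s b (k, x) = (\<sigma> b k, x)" if "x \<in> topspace (X k)" for b k x using that by (simp add: s_def)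
  obtain x where x: "x \<in> topspace (T True)" using ne by blast
  obtain y where y: "y \<in> topspace (T False)" using ne by blast
  have "commuting_conjugates ?G (s True) (s False)"
  proof (rule commuting_conjugates_if_invariant_clopen[where S = A])
    show "s True p = p" if "p \<in> topspace ?S - A" for p
    proof -
      obtain i j z where p: "p = ((i, j), z)" by (metis prod.exhaust)
      then have "z \<in> topspace (X (i, j))" "\<not> i" using that by (auto simp: A_def)
      then show ?thesis using sx[of z "(i, j)" True] p by (simp add: \<sigma>_def)
    qed
    show "s False p = p" if "p \<in> A" for p
    proof -
      obtain i j z where p: "p = ((i, j), z)" by (metis prod.exhaust)
      then have "z \<in> topspace (X (i, j))" "i" using that by (auto simp: A_def)
      then show ?thesis using sx[of z "(i, j)" False] p by (simp add: \<sigma>_def)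
    qed
    show "((True, True), x) \<in> topspace ?S" using x by (simp add: X_def)
    show "((False, True), y) \<in> topspace ?S" using y by (simp add: X_def)
    show "s True ((True, True), x) \<noteq> ((True, True), x)" using sx[of x "(True, True)" True] x by (simp add: X_def \<sigma>_def)
    show "s False ((False, True), y) \<noteq> ((False, True), y)" using sx[of y "(False, True)" False] y by (simp add: X_def \<sigma>_def)
  qed (use s inv in \<open>auto simp: A_def\<close>)
  then show ?thesis unfolding X_def by blast
qed

section \<open>The two comparison spaces and the equivalence\<close>

lemma not_CH_commuting_conjugates:
  assumes "\<not> Continuum_Hypothesis"
  obtains S :: "((bool \<times> bool) \<times> (nat set set \<times> nat set \<Rightarrow> bool)) topology" and a b
  where "Parovicenko_space S" "commuting_conjugates (homeo_group S) a b"
proof -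
  let ?w1 = "cardSuc natLeq"
  have C0: "Card_order ?w1" "Cinfinite ?w1"
    using cardSuc_Card_order[OF natLeq_Card_order] Cinfinite_cardSuc[OF natLeq_Cinfinite] by auto
  define r2 where "r2 = cardSuc ?w1"
  \<comment> \<open>A copy of omega_1 on singletons: each \<open>cardSuc\<close> passes to sets, so
    omega_2 lives on \<open>nat set set\<close>, and both towers must have the same type to be
    summands.\<close>
  define r1 where "r1 = |(\<lambda>x. {x}) ` Field ?w1|"
  have C2: "Card_order r2" using cardSuc_Card_order[OF C0(1)] by (simp add: r2_def)
  have reg2: "regularCard r2" using regularCard_cardSuc[OF C0(2)] by (simp add: r2_def)
  have "bij_betw (\<lambda>x. {x}) (Field ?w1) ((\<lambda>x. {x}) ` Field ?w1)" by (auto simp: bij_betw_def inj_on_def)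
  then have "|Field ?w1| =o r1" unfolding r1_def using card_of_ordIso by blast
  then have r1: "?w1 =o r1" using ordIso_transitive[OF ordIso_symmetric[OF card_of_Field_ordIso[OF C0(1)]]] by blast
  have C1: "Card_order r1" unfolding r1_def by (rule card_of_Card_order)
  have reg1: "regularCard r1"
    using regularCard_ordIso[OF r1 C0(2) regularCard_cardSuc[OF natLeq_Cinfinite]] .
  have w1: "natLeq <o ?w1" by (rule cardSuc_greater[OF natLeq_Card_order])
  have w12: "?w1 <o r2" unfolding r2_def by (rule cardSuc_greater[OF C0(1)])
  have "?w1 \<le>o ctwo ^c natLeq"
    by (rule cardSuc_least[OF natLeq_Card_order Card_order_cexp ordLess_ctwo_cexp[OF natLeq_Card_order]])
  moreover have "\<not> ?w1 =o ctwo ^c natLeq" using assms ordIso_symmetric unfolding Continuum_Hypothesis_def by blast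
  ultimately have lt: "?w1 <o ctwo ^c natLeq" by (simp add: ordLeq_iff_ordLess_or_ordIso)
  \<comment> \<open>Without CH, omega_1 is strictly below the continuum, so its successor does not
    exceed it.\<close>
  then have "r2 \<le>o ctwo ^c natLeq" unfolding r2_def by (rule cardSuc_least[OF C0(1) Card_order_cexp])
  then have le2: "r2 \<le>o |UNIV :: nat set set|" using continuum_nat_set by (rule ordLeq_ordIso_trans)
  have le1: "r1 \<le>o |UNIV :: nat set set|"
    using ordIso_ordLeq_trans[OF ordIso_symmetric[OF r1] ordLess_imp_ordLeq[OF ordLess_ordIso_trans[OF lt continuum_nat_set]]] .
  obtain e1 where e1: "tower r1 e1"
    using tower_exists[OF C1 reg1 ordLess_ordIso_trans[OF w1 r1] le1] .
  obtain e2 where e2: "tower r2 e2"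
    using tower_exists[OF C2 reg2 ordLess_transitive[OF w1 w12] le2] .
  interpret T1: tower r1 e1 by (rule e1)
  interpret T2: tower r2 e2 by (rule e2)
  define T where "T b = (if b then T1.space else T2.space)" for b
  have PT: "Parovicenko_space (T b)" for b
    using T1.Parovicenko_space_tower T2.Parovicenko_space_tower by (simp add: T_def)
  have "Parovicenko_space (sum_topology (\<lambda>(i, j :: bool). T i) UNIV)"
    by (rule Parovicenko_space_sum) (auto simp: PT split: prod.split)
  moreover have "\<exists>a b. commuting_conjugates (homeo_group (sum_topology (\<lambda>(i, j :: bool). T i) UNIV)) a b"
  proof (rule commuting_conjugates_double_sum)
    fix U assume "U \<in> clopens (T True)" "U \<noteq> {}"
    then obtain W where W: "W \<subseteq> clopens T1.space" "|W| \<le>o r1" "\<forall>w\<in>W. w \<noteq> {} \<and> w \<subseteq> U"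
      "\<forall>c\<in>clopens T1.space. \<exists>w\<in>W. w \<subseteq> c \<or> w \<inter> c = {}" using T1.deciding_family[of U] unfolding T_def by auto
    have "|W| \<le>o ?w1" using W(2) ordIso_symmetric[OF r1] by (rule ordLeq_ordIso_trans)
    then show "finely_decided (T True) U" unfolding finely_decided_def T_def using W by auto
  next
    fix W assume W: "W \<subseteq> clopens (T False)" "{} \<notin> W" "|W| \<le>o ?w1"
    have "|W| <o r2" using W(3) w12 by (rule ordLeq_ordLess_trans)
    then show "\<exists>c\<in>clopens (T False). \<forall>w\<in>W. \<not> w \<subseteq> c \<and> w \<inter> c \<noteq> {}"
      using T2.small_family_split[of W] W unfolding T_def by simp
  next
    show "topspace (T b) \<noteq> {}" for b
    proof (cases b)
      case True
      show ?thesis using T1.carr_nonempty unfolding T_def if_P[OF True] T1.space_basics(4) .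
    next
      case False
      show ?thesis using T2.carr_nonempty unfolding T_def if_not_P[OF False] T2.space_basics(4) .
    qed
  qed
  ultimately show ?thesis using that by blast
qed

theorem theorem1p3:
  shows "(Continuum_Hypothesis \<longleftrightarrow>
      (\<forall>(X :: nat set set topology) (Y :: nat set set topology).
         Parovicenko_space X \<and> Parovicenko_space Y \<longrightarrow> homeo_group X \<cong> homeo_group Y)) \<and>
    (Continuum_Hypothesis \<longrightarrow>
      (\<forall>(X :: 'a topology) (Y :: 'b topology).
         Parovicenko_space X \<and> Parovicenko_space Y \<longrightarrow> homeo_group X \<cong> homeo_group Y))"
proof (intro conjI iffI impI)
  show "\<forall>(X :: nat set set topology) (Y :: nat set set topology).
      Parovicenko_space X \<and> Parovicenko_space Y \<longrightarrow> homeo_group X \<cong> homeo_group Y" if Continuum_Hypothesis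
    using homeo_group_cong[OF Parovicenko_spaces_homeomorphic[OF that]] by blast
  show "\<forall>(X :: 'a topology) (Y :: 'b topology).
      Parovicenko_space X \<and> Parovicenko_space Y \<longrightarrow> homeo_group X \<cong> homeo_group Y" if Continuum_Hypothesis
    using homeo_group_cong[OF Parovicenko_spaces_homeomorphic[OF that]] by blast
next
  assume iso: "\<forall>(X :: nat set set topology) (Y :: nat set set topology).
      Parovicenko_space X \<and> Parovicenko_space Y \<longrightarrow> homeo_group X \<cong> homeo_group Y"
  show Continuum_Hypothesis
  proof (rule ccontr)
    assume "\<not> Continuum_Hypothesis"
    then obtain S :: "((bool \<times> bool) \<times> (nat set set \<times> nat set \<Rightarrow> bool)) topology" and a b
      where S: "Parovicenko_space S" "commuting_conjugates (homeo_group S) a b"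
      by (rule not_CH_commuting_conjugates)
    \<comment> \<open>The sum and the remainder live on other types; the hypothesis speaks about
      their copies on \<open>nat set set\<close>. Of the two groups only that of \<open>S\<close>
      has commuting conjugates.\<close>
    obtain X :: "nat set set topology" where X: "S homeomorphic_space X"
      using Parovicenko_space_embed[OF S(1)] by blast
    obtain Y :: "nat set set topology" where Y: "omega_star homeomorphic_space Y"
      using Parovicenko_space_embed[OF Parovicenko_space_omega_star] by blast
    have "homeo_group X \<cong> homeo_group Y"
      using iso Parovicenko_space_homeomorphic[OF X S(1)]
        Parovicenko_space_homeomorphic[OF Y Parovicenko_space_omega_star] by blast
    moreover have "homeo_group S \<cong> homeo_group X" by (rule homeo_group_cong[OF X])
    moreover have "homeo_group Y \<cong> homeo_group omega_star"
      using homeo_group_cong Y homeomorphic_space_sym by blast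
    ultimately have "homeo_group S \<cong> homeo_group omega_star" using iso_trans by metis
    then show False
      using commuting_conjugates_iso[OF group_homeo_group group_homeo_group _ S(2)]
        no_commuting_conjugates_omega_star by blast
  qed
qed

end
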